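(* Let $f(Z)=\sum_{i=1}^d \alpha_i Z^i\in\mathbb{R}[Z]$ be any polynomial of degree $d\ge 3$, and let $a,q$ be integers with $q\ge 1$, $\gcd(a,q)=1$ and $$\left|\alpha_d-\frac aq\right|<\frac1{q^2}.$$ Let $\ell$ be a positive integer and let $0\le s\le r$ be integers. Then $$|S_f(r,\ell,s)|\le r2^{r/2}\binom rs^{1/2}\left(\ell^{\widetilde\eta_1(d)}q^{-\widetilde\eta_1(d)}+\ell^{\widetilde\vartheta(d)}2^{-\widetilde\zeta_1(d)r}+2^{-\widetilde\zeta_2(d)r}+2^{-\widetilde\zeta_3(d)r}q^{\widetilde\eta_2(d)}\right)^{1/2}$$ as $r\to\infty$ (that is, for all sufficiently large $r$), where $$\widetilde\eta_1(d)=\frac1{d^2-2d+4},\qquad \widetilde\eta_2(d)=\frac1{d^2-2d+3},\qquad \widetilde\vartheta(d)=\frac1{d^2-d+2},$$ $$\widetilde\zeta_1(d)=\frac{d-2}{d^2-d+2},\qquad \widetilde\zeta_2(d)=\frac1{d^2-3d+5},\qquad \widetilde\zeta_3(d)=\frac{d-1}{d^2-2d+3}.$$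
   Context: Let $\mathbf{e}(z)=\exp(2\pi i z)$, and let $\sigma(n)$ denote the sum of the binary digits of $n$. For integers $0\le s\le r$ put $$\mathcal{G}_s(r)=\{0\le n<2^r:\ \sigma(n)=s\},\qquad S_f(r,\ell,s)=\sum_{n\in\mathcal{G}_s(r)}\mathbf{e}(\ell f(n)).$$ "Sufficiently large" means $r\ge r_0$ for some $r_0$ depending only on $d$ (and not on $f,a,q,\ell,s$). *)

theory Defs
  imports "HOL-Analysis.Analysis" "HOL-Computational_Algebra.Polynomial"
begin

definition e :: "real \<Rightarrow> complex" where
  "e z = exp (2 * of_real pi * \<i> * of_real z)"

(* n div 2 ^ i mod 2 is the i-th binary digit of n; it vanishes for i \<ge> n since n < 2 ^ n. *)
definition binary_digit_sum :: "nat \<Rightarrow> nat" where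
  "binary_digit_sum n = (\<Sum>i<n. n div 2 ^ i mod 2)"

definition G :: "nat \<Rightarrow> nat \<Rightarrow> nat set" where
  "G s r = {n. n < 2 ^ r \<and> binary_digit_sum n = s}"

definition S :: "real poly \<Rightarrow> nat \<Rightarrow> nat \<Rightarrow> nat \<Rightarrow> complex" where
  "S f r l s = (\<Sum>n\<in>G s r. e (real l * poly f (real n)))"

definition eta1 :: "nat \<Rightarrow> real" where
  "eta1 d = 1 / (real d ^ 2 - 2 * real d + 4)"

definition eta2 :: "nat \<Rightarrow> real" where
  "eta2 d = 1 / (real d ^ 2 - 2 * real d + 3)"

definition vartheta :: "nat \<Rightarrow> real" where
  "vartheta d = 1 / (real d ^ 2 - real d + 2)"

definition zeta1 :: "nat \<Rightarrow> real" where
  "zeta1 d = (real d - 2) / (real d ^ 2 - real d + 2)"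

definition zeta2 :: "nat \<Rightarrow> real" where
  "zeta2 d = 1 / (real d ^ 2 - 3 * real d + 5)"

definition zeta3 :: "nat \<Rightarrow> real" where
  "zeta3 d = (real d - 1) / (real d ^ 2 - 2 * real d + 3)"

end

theory Submission
  imports Defs
begin

text \<open>Write \<open>n = k + 2\<^sup>u m\<close>. By Cauchy--Schwarz over the high part \<open>m\<close>, completed to a full
  interval, the sum is controlled by Weyl sums over \<open>m\<close> of degree \<open>d - 1\<close> whose leading coefficient is
  an explicit integer multiple of \<open>\<alpha>\<^sub>d\<close>; the diagonal costs \<open>2\<^sup>-\<^sup>u\<close>, and \<open>2\<^sup>u\<close> is chosen as
  the inverse of the bracket in the theorem. The Weyl sums need a saving with exponent
  \<open>1 / (k (k - 1) + 2)\<close> for degree \<open>k = d - 1\<close> without any loss of \<open>2\<^sup>\<epsilon>\<^sup>r\<close>. Up to such a loss,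
  Vinogradov's mean value theorem of degree \<open>k - 1\<close> at the critical exponent yields the better
  exponent \<open>1 / (k (k - 1))\<close>; the loss disappears since the sum can be replaced by sums of polynomial
  length in the saving. The mean value theorem itself is proved by decoupling the moment curve over
  the \<open>p\<close>-adic integers for a fixed prime \<open>p > k\<close>, following the bilinear argument of Guo, Li, Yung
  and Zorin-Kranich: over the \<open>p\<close>-adics the uncertainty principle is exact, so all steps become
  statements on finite exponential sums and congruences.\<close>

text \<open>Origin of the exponents: put \<open>H = 2 ^ u\<close>, \<open>N = 2 ^ r\<close> and
  \<open>D = (d - 1) * (d - 2)\<close>. The Weyl sums over \<open>m\<close> must save a factor
  \<open>H\<close>, so the saving parameter is \<open>L\<close>, a constant times
  \<open>H ^ (D + 2)\<close>. Up to constants this requires \<open>L * H \<le> N\<close> (exponent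
  \<open>D + 3\<close> of \<open>H\<close>), \<open>l * L * H ^ d \<le> q\<close>, which keeps the
  relevant multiples of the leading coefficient away from integers (exponent
  \<open>D + 2 + d\<close>), and \<open>q * L \<le> (N / H) ^ (d - 1)\<close> (exponent
  \<open>D + 2 + (d - 1)\<close>). The denominators of \<open>zeta2\<close>, \<open>eta1\<close> and
  \<open>eta2\<close> are these three numbers. The summand 2 in \<open>D + 2\<close> is the price of
  uniformity: one unit pays for using only about \<open>M / L powr \<sigma>\<close> shifts of a Weyl
  sum of length \<open>M\<close>, the other for the losses \<open>M powr \<epsilon>\<close>. On the
  decoupling side all inequalities are quantified over arbitrary coefficients and arbitrary finite
  sets. Rescaling to a residue class, or restricting to a slice of frequencies, moves the remaining
  phases into the coefficients, so that only this generality lets the induction close. The prime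
  exceeds the degree so that the integers met in Taylor expansions are units.\<close>

definition avg :: "'a set \<Rightarrow> ('a \<Rightarrow> real) \<Rightarrow> real" where
  "avg X f = (\<Sum>x\<in>X. f x) / real (card X)"

lemma avg_mono: "(\<And>x. x \<in> X \<Longrightarrow> f x \<le> g x) \<Longrightarrow> avg X f \<le> avg X g"
  unfolding avg_def by (intro divide_right_mono sum_mono) auto

lemma avg_cong: "(\<And>x. x \<in> X \<Longrightarrow> f x = g x) \<Longrightarrow> avg X f = avg X g"
  unfolding avg_def by (simp cong: sum.cong)

lemma avg_nonneg: "(\<And>x. x \<in> X \<Longrightarrow> 0 \<le> f x) \<Longrightarrow> 0 \<le> avg X f"
  unfolding avg_def by (simp add: sum_nonneg)

lemma avg_cmult: "avg X (\<lambda>x. c * f x) = c * avg X f"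
  unfolding avg_def by (simp add: sum_distrib_left)

lemma avg_add: "avg X (\<lambda>x. f x + g x) = avg X f + avg X g"
  unfolding avg_def by (simp add: sum.distrib add_divide_distrib)

lemma avg_sum: "avg X (\<lambda>x. \<Sum>i\<in>I. f i x) = (\<Sum>i\<in>I. avg X (f i))"
  unfolding avg_def by (subst sum.swap) (simp add: sum_divide_distrib)

lemma avg_const: "finite X \<Longrightarrow> X \<noteq> {} \<Longrightarrow> avg X (\<lambda>x. c) = c"
  unfolding avg_def by (simp add: card_gt_0_iff)

lemma avg_swap: "avg X (\<lambda>x. avg T (f x)) = avg T (\<lambda>y. avg X (\<lambda>x. f x y))"
  unfolding avg_def by (simp add: sum_divide_distrib[symmetric] sum.swap[of _ T X])

lemma avg_eq_0:
  assumes "finite X" "\<And>x. x \<in> X \<Longrightarrow> 0 \<le> f x" "avg X f = 0" "x \<in> X"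
  shows "f x = 0"
proof -
  have "card X \<noteq> 0" using assms by (auto simp: card_eq_0_iff)
  then have "(\<Sum>x\<in>X. f x) = 0" using assms(3) by (simp add: avg_def)
  then show ?thesis using assms by (simp add: sum_nonneg_eq_0_iff)
qed

lemma power_convex_nonneg: "convex_on {0::real..} (\<lambda>x. x ^ n)"
proof (cases "even n")
  case True
  then show ?thesis using convex_on_subset[OF convex_power_even[OF True]] by auto
qed (rule convex_power_odd)

text \<open>Convexity of \<open>x ^ t\<close>, applied to the normalised functions
  \<open>u i / L i\<close> with weights \<open>L i / T\<close>. Functions of norm zero vanish
  pointwise and are discarded beforehand, so that the divisions are legitimate.\<close>

lemma avg_minkowski:
  fixes u :: "'i \<Rightarrow> 'a \<Rightarrow> real"
  assumes X: "finite X" and I: "finite I" and t: "t \<ge> 1"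
    and u: "\<And>i x. i \<in> I \<Longrightarrow> x \<in> X \<Longrightarrow> 0 \<le> u i x"
  shows "avg X (\<lambda>x. (\<Sum>i\<in>I. u i x) ^ t) \<le> (\<Sum>i\<in>I. avg X (\<lambda>x. u i x ^ t) powr (1 / real t)) ^ t"
proof -
  define L where "L i = avg X (\<lambda>x. u i x ^ t) powr (1 / real t)" for i
  have Lt: "L i ^ t = avg X (\<lambda>x. u i x ^ t)" if "i \<in> I" for i
  proof -
    have "avg X (\<lambda>x. u i x ^ t) \<ge> 0" using u that by (intro avg_nonneg) auto
    then show ?thesis unfolding L_def using t
      by (cases "avg X (\<lambda>x. u i x ^ t) = 0") (auto simp: powr_powr simp flip: powr_realpow)
  qed
  have L0: "L i \<ge> 0" for i by (simp add: L_def)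
  have uz: "u i x = 0" if "i \<in> I" "x \<in> X" "L i = 0" for i x
  proof -
    have "avg X (\<lambda>x. u i x ^ t) = 0" using Lt[OF that(1)] that(3) t by (simp flip: Lt[OF that(1)])
    then have "u i x ^ t = 0" using avg_eq_0[OF X _ _ that(2), of "\<lambda>x. u i x ^ t"] u that by auto
    then show ?thesis by simp
  qed
  define J where "J = {i\<in>I. L i > 0}"
  define T where "T = (\<Sum>i\<in>I. L i)"
  have JI: "J \<subseteq> I" "finite J" using I by (auto simp: J_def)
  have TJ: "T = (\<Sum>i\<in>J. L i)" unfolding T_def
    by (rule sum.mono_neutral_right) (use I L0 in \<open>auto simp: J_def order.order_iff_strict\<close>)
  have uJ: "(\<Sum>i\<in>I. u i x) = (\<Sum>i\<in>J. u i x)" if "x \<in> X" for x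
    by (rule sum.mono_neutral_right) (use I L0 uz that in \<open>auto simp: J_def order.order_iff_strict\<close>)
  show ?thesis
  proof (cases "J = {}")
    case True
    have "avg X (\<lambda>x. (\<Sum>i\<in>I. u i x) ^ t) = avg X (\<lambda>x. 0)"
      using t uJ True by (intro avg_cong) (simp add: power_0_left)
    also have "\<dots> = 0" by (simp add: avg_def)
    finally show ?thesis using sum_nonneg[of I L] L0 by (simp add: L_def)
  next
    case False
    have Tp: "T > 0" unfolding TJ using False JI by (intro sum_pos) (auto simp: J_def)
    have pt: "(\<Sum>i\<in>I. u i x) ^ t \<le> T ^ t * (\<Sum>i\<in>J. L i / T * (u i x / L i) ^ t)" if x: "x \<in> X" for x
    proof -
      have eq: "(\<Sum>i\<in>J. (L i / T) *\<^sub>R (u i x / L i)) = (\<Sum>i\<in>I. u i x) / T"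
        unfolding uJ[OF x] sum_divide_distrib by (rule sum.cong) (auto simp: J_def)
      have "(\<Sum>i\<in>J. (L i / T) *\<^sub>R (u i x / L i)) ^ t \<le> (\<Sum>i\<in>J. L i / T * (u i x / L i) ^ t)"
        using JI False Tp L0 u x
        by (intro convex_on_sum[OF _ _ power_convex_nonneg])
           (auto simp: TJ J_def simp flip: sum_divide_distrib intro!: divide_nonneg_nonneg)
      then show ?thesis unfolding eq using Tp by (simp add: power_divide field_simps)
    qed
    have "avg X (\<lambda>x. (\<Sum>i\<in>I. u i x) ^ t) \<le> avg X (\<lambda>x. T ^ t * (\<Sum>i\<in>J. L i / T * (u i x / L i) ^ t))"
      by (rule avg_mono) (rule pt)
    also have "\<dots> = T ^ t * (\<Sum>i\<in>J. avg X (\<lambda>x. L i / T / L i ^ t * u i x ^ t))"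
      by (simp add: avg_cmult avg_sum power_divide)
    also have "\<dots> = T ^ t * (\<Sum>i\<in>J. L i / T / L i ^ t * L i ^ t)"
      unfolding avg_cmult using JI by (intro arg_cong[of _ _ "\<lambda>z. T ^ t * z"] sum.cong) (auto simp: Lt subset_iff)
    also have "(\<Sum>i\<in>J. L i / T / L i ^ t * L i ^ t) = (\<Sum>i\<in>J. L i / T)"
      by (rule sum.cong) (auto simp: J_def)
    also have "\<dots> = 1" using Tp by (simp add: TJ flip: sum_divide_distrib)
    finally show ?thesis by (simp add: T_def L_def)
  qed
qed

text \<open>Young's inequality for the functions divided by their averages \<open>U\<close> and
  \<open>V\<close>; if one average is zero, so is every product.\<close>

lemma avg_Hoelder:
  fixes u v :: "'a \<Rightarrow> real"
  assumes X: "finite X" and a: "0 < a" "0 < b" "a + b = 1"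
    and u: "\<And>x. x \<in> X \<Longrightarrow> 0 \<le> u x" and v: "\<And>x. x \<in> X \<Longrightarrow> 0 \<le> v x"
  shows "avg X (\<lambda>x. u x powr a * v x powr b) \<le> avg X u powr a * avg X v powr b"
proof -
  define U where "U = avg X u"
  define V where "V = avg X v"
  have U0: "U \<ge> 0" "V \<ge> 0" unfolding U_def V_def using u v by (auto intro: avg_nonneg)
  show ?thesis
  proof (cases "U = 0 \<or> V = 0")
    case True
    then have "u x powr a * v x powr b = 0" if "x \<in> X" for x
      using avg_eq_0[OF X, of u x] avg_eq_0[OF X, of v x] u v that a unfolding U_def V_def by auto
    then have "avg X (\<lambda>x. u x powr a * v x powr b) = avg X (\<lambda>x. 0)" by (intro avg_cong)
    also have "\<dots> = 0" by (simp add: avg_def)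
    finally show ?thesis by simp
  next
    case False
    then have UV: "U > 0" "V > 0" using U0 by auto
    have Sne: "X \<noteq> {}" using UV by (auto simp: U_def avg_def)
    have pt: "u x powr a * v x powr b \<le> U powr a * V powr b * (a / U * u x + b / V * v x)" if x: "x \<in> X" for x
    proof (cases "u x = 0 \<or> v x = 0")
      case True
      then show ?thesis using u[OF x] v[OF x] UV a by auto
    next
      case False
      then have p: "u x > 0" "v x > 0" using u[OF x] v[OF x] by auto
      have "(u x / U) powr a * (v x / V) powr b \<le> a * (u x / U) + b * (v x / V)"
        using p UV a by (intro Youngs_inequality_0) auto
      then show ?thesis using p UV by (simp add: powr_divide field_simps)
    qed
    have "avg X (\<lambda>x. u x powr a * v x powr b) \<le> avg X (\<lambda>x. U powr a * V powr b * (a / U * u x + b / V * v x))"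
      by (rule avg_mono) (rule pt)
    also have "\<dots> = U powr a * V powr b * (a / U * U + b / V * V)"
      unfolding avg_cmult avg_add U_def V_def by simp
    also have "\<dots> = U powr a * V powr b" using UV a by simp
    finally show ?thesis by (simp add: U_def V_def)
  qed
qed

subsection \<open>Exponential sums\<close>

lemma e_add: "e (x + y) = e x * e y"
  by (simp add: e_def distrib_left exp_add)

lemma e_0 [simp]: "e 0 = 1"
  by (simp add: e_def)

lemma cmod_e [simp]: "cmod (e x) = 1"
proof -
  have "e x = exp (\<i> * of_real (2 * pi * x))" by (simp add: e_def mult_ac)
  then show ?thesis by (simp only: norm_exp_i_times)
qed

lemma e_of_int [simp]: "e (of_int n) = 1"
proof -
  have "e (of_int n) = exp (2 * of_real pi * \<i> * of_int n)" by (simp add: e_def)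
  also have "\<dots> = 1" using exp_integer_2pi[of "of_int n"] by (simp add: mult_ac)
  finally show ?thesis .
qed

lemma e_uminus: "e (- x) = cnj (e x)"
  by (simp add: e_def exp_cnj)

lemma e_sum: "e (\<Sum>i\<in>I. f i) = (\<Prod>i\<in>I. e (f i))"
  by (induction I rule: infinite_finite_induct) (auto simp: e_add)

lemma e_cong_int: "x - y \<in> \<int> \<Longrightarrow> e x = e y"
  by (metis Ints_cases diff_add_cancel e_add e_of_int mult_1)

lemma e_div_cong:
  fixes u v Z :: int
  assumes "Z > 0" "Z dvd (u - v)"
  shows "e (of_int u / of_int Z) = e (of_int v / of_int Z)"
proof -
  obtain k where "u - v = Z * k" using assms by auto
  then have "u = v + Z * k" by simp
  then have "real_of_int u / of_int Z = of_int v / of_int Z + of_int k"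
    using assms by (simp add: field_simps)
  then show ?thesis by (simp add: e_add)
qed

lemma e_eq_1_iff: "e x = 1 \<longleftrightarrow> x \<in> \<int>"
proof
  assume "e x = 1"
  then obtain n :: int where "2 * pi * x = of_int (2 * n) * pi"
    by (auto simp: e_def exp_eq_1)
  then have "x = of_int n" by simp
  then show "x \<in> \<int>" by simp
qed (auto elim!: Ints_cases)

subsection \<open>Moment curves over residue rings\<close>

definition rbox :: "nat \<Rightarrow> int \<Rightarrow> (nat \<Rightarrow> int) set" where
  "rbox l Z = PiE {1..l} (\<lambda>_. {0..<Z})"

text \<open>The frequency \<open>a\<close> is paired with the curve
  \<open>(x ^ (m + 1), ..., x ^ (m + l))\<close>. The moment curve is \<open>m = 0\<close>; the
  curves with \<open>m = k - l\<close> appear when a moment curve of degree \<open>k\<close> is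
  restricted to a slice of frequencies.\<close>

definition cform :: "nat \<Rightarrow> nat \<Rightarrow> (nat \<Rightarrow> int) \<Rightarrow> int \<Rightarrow> int" where
  "cform m l a x = (\<Sum>i=1..l. a i * x ^ (m + i))"

definition expsum :: "int \<Rightarrow> nat \<Rightarrow> nat \<Rightarrow> (int \<Rightarrow> complex) \<Rightarrow> int set \<Rightarrow> (nat \<Rightarrow> int) \<Rightarrow> complex" where
  "expsum Z m l c A a = (\<Sum>n\<in>A. c n * e (of_int (cform m l a n) / of_int Z))"

definition res_parts :: "int \<Rightarrow> int set \<Rightarrow> int set set" where
  "res_parts M A = (\<lambda>n. {k\<in>A. M dvd k - n}) ` A"

text \<open>Half of the critical exponent \<open>l * (l + 1)\<close>, so that critical moments are
  even powers \<open>2 * tri l\<close>.\<close>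

definition tri :: "nat \<Rightarrow> nat" where
  "tri l = l * (l + 1) div 2"

definition moment :: "int \<Rightarrow> nat \<Rightarrow> nat \<Rightarrow> nat \<Rightarrow> (int \<Rightarrow> complex) \<Rightarrow> int set \<Rightarrow> real" where
  "moment Z m l t c A = avg (rbox l Z) (\<lambda>a. cmod (expsum Z m l c A a) ^ (2 * t))"

text \<open>A moment to the power \<open>1 / t\<close> is the square of a norm with exponent
  \<open>2 * t\<close>. The value is therefore the square of the right-hand side of an
  \<open>l\<^sup>2\<close> decoupling inequality; in this normalisation it is additive over coarser
  classes.\<close>

definition sqfun :: "int \<Rightarrow> nat \<Rightarrow> nat \<Rightarrow> nat \<Rightarrow> int \<Rightarrow> (int \<Rightarrow> complex) \<Rightarrow> int set \<Rightarrow> real" where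
  "sqfun Z m l t M c A = (\<Sum>J\<in>res_parts M A. moment Z m l t c J powr (1 / real t))"

text \<open>The \<open>l\<^sup>2\<close> decoupling inequality into residue classes at the critical exponent \<open>l (l + 1)\<close>;
  \<open>K\<close> is the decoupling constant raised to that exponent.\<close>

definition decoup :: "int \<Rightarrow> nat \<Rightarrow> nat \<Rightarrow> int \<Rightarrow> real \<Rightarrow> (int \<Rightarrow> complex) \<Rightarrow> int set \<Rightarrow> bool" where
  "decoup Z m l M K c A \<longleftrightarrow> moment Z m l (tri l) c A \<le> K * sqfun Z m l (tri l) M c A ^ tri l"

text \<open>The modulus \<open>p ^ (l * N)\<close> fits the classes modulo \<open>p ^ N\<close>:
  after recentring, the \<open>l\<close>-th power of an element of such a class is 0 modulo
  \<open>p ^ (l * N)\<close>. The constant \<open>K\<close> has to serve all coefficients and all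
  finite sets.\<close>

definition Dec :: "int \<Rightarrow> nat \<Rightarrow> nat \<Rightarrow> real \<Rightarrow> bool" where
  "Dec p l N K \<longleftrightarrow> (\<forall>c A. finite A \<longrightarrow> decoup (p ^ (l * N)) 0 l (p ^ N) K c A)"

lemma double_tri: "2 * tri l = l * (l + 1)"
  unfolding tri_def by (simp add: dvd_mult_div_cancel)

lemma real_tri: "real (tri l) = real l * (real l + 1) / 2"
proof -
  have "real (2 * tri l) = real (l * (l + 1))" by (simp only: double_tri)
  then show ?thesis by (simp add: algebra_simps)
qed

lemma tri_ge_1: "l \<ge> 1 \<Longrightarrow> tri l \<ge> 1"
  using double_tri[of l] by (cases "tri l") auto

lemma finite_rbox [simp]: "finite (rbox l Z)"
  unfolding rbox_def by (intro finite_PiE) auto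

lemma rbox_nonempty: "Z > 0 \<Longrightarrow> rbox l Z \<noteq> {}"
  unfolding rbox_def by (auto simp: PiE_eq_empty_iff)

lemma card_rbox: "Z > 0 \<Longrightarrow> real (card (rbox l Z)) = of_int Z ^ l"
  unfolding rbox_def by (subst card_PiE) auto

lemma avg_rbox_shift:
  assumes Z: "Z > 0"
    and per: "\<And>a b. (\<And>i. i \<in> {1..l} \<Longrightarrow> Z dvd a i - b i) \<Longrightarrow> f a = f b"
  shows "avg (rbox l Z) (\<lambda>a. f (\<lambda>i. a i + s i)) = avg (rbox l Z) f"
proof -
  define T where "T a = restrict (\<lambda>i. (a i + s i) mod Z) {1..l}" for a :: "nat \<Rightarrow> int"
  have inj: "inj_on T (rbox l Z)"
  proof (rule inj_onI)
    fix a b assume ab: "a \<in> rbox l Z" "b \<in> rbox l Z" "T a = T b"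
    show "a = b"
    proof (rule PiE_ext[of a "{1..l}" "\<lambda>_. {0..<Z}"])
      show "a \<in> PiE {1..l} (\<lambda>_. {0..<Z})" "b \<in> PiE {1..l} (\<lambda>_. {0..<Z})"
        using ab by (auto simp: rbox_def)
      fix i assume i: "i \<in> {1..l}"
      then have "(a i + s i) mod Z = (b i + s i) mod Z"
        using fun_cong[OF ab(3), of i] by (simp add: T_def)
      then have "((a i + s i) - s i) mod Z = ((b i + s i) - s i) mod Z" by (rule mod_diff_cong) simp
      then have "a i mod Z = b i mod Z" by simp
      moreover have "a i \<in> {0..<Z}" "b i \<in> {0..<Z}" using ab i by (auto simp: rbox_def PiE_iff)
      ultimately show "a i = b i" by simp
    qed
  qed
  have sub: "T ` rbox l Z \<subseteq> rbox l Z" using Z by (auto simp: T_def rbox_def PiE_iff)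
  have bij: "bij_betw T (rbox l Z) (rbox l Z)"
    using inj endo_inj_surj[OF finite_rbox sub inj] by (simp add: bij_betw_def)
  have "f (\<lambda>i. a i + s i) = f (T a)" for a
    by (rule per) (auto simp: T_def minus_mod_eq_div_mult)
  then have "(\<Sum>a\<in>rbox l Z. f (\<lambda>i. a i + s i)) = (\<Sum>a\<in>rbox l Z. f (T a))" by simp
  also have "\<dots> = (\<Sum>a\<in>rbox l Z. f a)" by (rule sum.reindex_bij_betw[OF bij])
  finally show ?thesis by (simp add: avg_def)
qed

text \<open>Translations permute the frequencies, so an additional average over any family of shifts
  is free. With shifts that act on the sums as frequencies of a smaller modulus, this localises a
  moment exactly; it is the form in which the uncertainty principle is used.\<close>

lemma avg_rbox_double:
  assumes "Z > 0" "finite B" "B \<noteq> {}"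
    and "\<And>a b. (\<And>i. i \<in> {1..l} \<Longrightarrow> Z dvd a i - b i) \<Longrightarrow> f a = f b"
  shows "avg (rbox l Z) f = avg (rbox l Z) (\<lambda>a. avg B (\<lambda>\<tau>. f (\<lambda>i. a i + s \<tau> i)))"
  using assms by (subst avg_swap) (simp add: avg_rbox_shift avg_const)

lemma cform_add: "cform m l (\<lambda>i. a i + b i) x = cform m l a x + cform m l b x"
  unfolding cform_def by (simp add: distrib_right sum.distrib)

lemma cform_smult: "cform m l (\<lambda>i. z * a i) x = z * cform m l a x"
  unfolding cform_def by (simp add: sum_distrib_left mult.assoc)

lemma cform_cong:
  assumes "\<And>i. i \<in> {1..l} \<Longrightarrow> Z dvd a i - b i"
  shows "Z dvd cform m l a x - cform m l b x"
proof -
  have "cform m l a x - cform m l b x = (\<Sum>i=1..l. (a i - b i) * x ^ (m + i))"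
    by (simp add: cform_def sum_subtractf left_diff_distrib)
  also have "Z dvd \<dots>" using assms by (intro dvd_sum) auto
  finally show ?thesis .
qed

lemma expsum_cong:
  assumes "Z > 0" "\<And>i. i \<in> {1..l} \<Longrightarrow> Z dvd a i - b i"
  shows "expsum Z m l c A a = expsum Z m l c A b"
  unfolding expsum_def
  by (intro sum.cong refl arg_cong2[of _ _ _ _ "(*)"] e_div_cong assms cform_cong)

lemma moment_nonneg [simp]: "moment Z m l t c A \<ge> 0"
  unfolding moment_def by (intro avg_nonneg) auto

lemma sqfun_nonneg [simp]: "sqfun Z m l t M c A \<ge> 0"
  unfolding sqfun_def by (intro sum_nonneg) auto

lemma powr_inverse_power:
  assumes "t \<ge> 1" "x \<ge> 0"
  shows "(x powr (1 / real t)) ^ t = x"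
  using assms by (cases "x = 0") (auto simp: powr_powr simp flip: powr_realpow)

lemma power_powr_inverse:
  assumes "t \<ge> 1" "x \<ge> 0"
  shows "(x ^ t) powr (1 / real t) = x"
  using assms by (cases "x = 0") (auto simp: powr_powr simp flip: powr_realpow)

subsection \<open>Residue classes\<close>

lemma finite_res_parts [simp]: "finite A \<Longrightarrow> finite (res_parts M A)"
  by (simp add: res_parts_def)

lemma res_parts_subset: "J \<in> res_parts M A \<Longrightarrow> J \<subseteq> A"
  by (auto simp: res_parts_def)

lemma res_parts_finite: "finite A \<Longrightarrow> J \<in> res_parts M A \<Longrightarrow> finite J"
  by (rule finite_subset[OF res_parts_subset])

lemma res_parts_cong: "J \<in> res_parts M A \<Longrightarrow> x \<in> J \<Longrightarrow> y \<in> J \<Longrightarrow> M dvd x - y"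
proof -
  assume "J \<in> res_parts M A" "x \<in> J" "y \<in> J"
  then obtain n where "M dvd x - n" "M dvd y - n" by (auto simp: res_parts_def)
  then have "M dvd (x - n) - (y - n)" by (rule dvd_diff)
  then show ?thesis by simp
qed

lemma res_parts_nonempty: "J \<in> res_parts M A \<Longrightarrow> J \<noteq> {}"
  by (auto simp: res_parts_def)

lemma res_parts_eq:
  assumes "J \<in> res_parts M A" "x \<in> J"
  shows "J = {k\<in>A. M dvd k - x}"
proof -
  obtain n where n: "J = {k\<in>A. M dvd k - n}" using assms by (auto simp: res_parts_def)
  have "M dvd k - n \<longleftrightarrow> M dvd k - x" for k
  proof -
    have "M dvd x - n" using assms n by auto
    moreover have "k - n = (k - x) + (x - n)" by simp
    ultimately show ?thesis by (metis dvd_add_left_iff)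
  qed
  then show ?thesis using n by simp
qed

lemma res_parts_disjoint:
  assumes "J \<in> res_parts M A" "J' \<in> res_parts M A" "J \<noteq> J'"
  shows "J \<inter> J' = {}"
  using assms res_parts_eq by blast

lemma Union_res_parts: "\<Union>(res_parts M A) = A"
  by (auto simp: res_parts_def)

lemma sum_res_parts:
  assumes "finite A"
  shows "(\<Sum>J\<in>res_parts M A. \<Sum>n\<in>J. f n) = (\<Sum>n\<in>A. f n)"
proof -
  have "sum f (\<Union>(res_parts M A)) = (sum \<circ> sum) f (res_parts M A)"
    using assms res_parts_disjoint res_parts_finite[OF assms] by (intro sum.Union_disjoint) blast+
  then show ?thesis unfolding Union_res_parts by simp
qed

lemma expsum_res_parts:
  assumes "finite A"
  shows "expsum Z m l c A a = (\<Sum>J\<in>res_parts M A. expsum Z m l c J a)"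
  unfolding expsum_def by (rule sum_res_parts[OF assms, symmetric])

lemma card_res_parts:
  assumes "M > 0" "finite A"
  shows "int (card (res_parts M A)) \<le> M"
proof -
  have "res_parts M A = (\<lambda>r. {k\<in>A. M dvd k - r}) ` ((\<lambda>n. n mod M) ` A)"
    unfolding res_parts_def image_image by (intro image_cong) (auto simp: mod_eq_dvd_iff[symmetric])
  then have "card (res_parts M A) \<le> card ((\<lambda>n. n mod M) ` A)"
    using assms by (simp add: card_image_le)
  also have "\<dots> \<le> card {0..<M}" using assms by (intro card_mono) auto
  finally show ?thesis using assms by simp
qed

lemma sum_res_parts_refine:
  assumes "finite A" "M1 dvd M2"
  shows "(\<Sum>J\<in>res_parts M1 A. \<Sum>J'\<in>res_parts M2 J. f J') = (\<Sum>J'\<in>res_parts M2 A. f J')"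
proof -
  have eq: "{k\<in>J. M2 dvd k - n} = {k\<in>A. M2 dvd k - n}" if "J \<in> res_parts M1 A" "n \<in> J" for J n
    using res_parts_eq[OF that] assms(2) by (auto intro: dvd_trans)
  have "res_parts M2 A = (\<Union>J\<in>res_parts M1 A. res_parts M2 J)"
  proof (intro equalityI subsetI)
    fix X assume "X \<in> res_parts M2 A"
    then obtain n where n: "n \<in> A" "X = {k\<in>A. M2 dvd k - n}" by (auto simp: res_parts_def)
    then obtain J where J: "J \<in> res_parts M1 A" "n \<in> J" using Union_res_parts by blast
    then show "X \<in> (\<Union>J\<in>res_parts M1 A. res_parts M2 J)" using eq[OF J] n by (auto simp: res_parts_def)
  next
    fix X assume "X \<in> (\<Union>J\<in>res_parts M1 A. res_parts M2 J)"
    then obtain J n where J: "J \<in> res_parts M1 A" "n \<in> J" "X = {k\<in>J. M2 dvd k - n}"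
      by (auto simp: res_parts_def[of M2])
    then show "X \<in> res_parts M2 A" using eq[OF J(1,2)] res_parts_subset[OF J(1)] by (auto simp: res_parts_def)
  qed
  moreover have "res_parts M2 J \<inter> res_parts M2 J' = {}"
    if J: "J \<in> res_parts M1 A" "J' \<in> res_parts M1 A" "J \<noteq> J'" for J J'
  proof -
    have "J \<inter> J' = {}" by (rule res_parts_disjoint[OF J])
    moreover have "X \<subseteq> J" "X \<noteq> {}" "X \<subseteq> J'" if "X \<in> res_parts M2 J \<inter> res_parts M2 J'" for X
      using res_parts_subset res_parts_nonempty that by blast+
    ultimately show ?thesis by blast
  qed
  ultimately show ?thesis
    using assms(1) res_parts_finite[OF assms(1)] by (simp add: sum.UNION_disjoint)
qed

lemma res_parts_affine:
  assumes "d \<noteq> 0"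
  shows "res_parts (d * M) ((\<lambda>y. x0 + d * y) ` B) = (image (\<lambda>y. x0 + d * y)) ` res_parts M B"
proof -
  have "{k \<in> (\<lambda>y. x0 + d * y) ` B. d * M dvd k - (x0 + d * n)} = (\<lambda>y. x0 + d * y) ` {k\<in>B. M dvd k - n}" for n
  proof -
    have "d * M dvd x0 + d * k - (x0 + d * n) \<longleftrightarrow> M dvd k - n" for k
      using assms by (simp flip: right_diff_distrib)
    then show ?thesis by auto
  qed
  then show ?thesis unfolding res_parts_def image_image by simp
qed

section \<open>Composition of decoupling inequalities\<close>

lemma sqfun_refine:
  assumes "finite A" "M1 dvd M2"
  shows "(\<Sum>J\<in>res_parts M1 A. sqfun Z m l t M2 c J) = sqfun Z m l t M2 c A"
  unfolding sqfun_def by (rule sum_res_parts_refine[OF assms])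

text \<open>The \<open>tri l\<close>-th roots of the inequalities on the coarse classes can be
  summed because \<open>sqfun\<close> is additive over these classes; hence the constants
  multiply.\<close>

lemma decoup_trans:
  assumes A: "finite A" and M: "M1 dvd M2" and l: "l \<ge> 1" and K: "K1 \<ge> 0" "K2 \<ge> 0"
    and 1: "decoup Z m l M1 K1 c A"
    and 2: "\<And>J. J \<in> res_parts M1 A \<Longrightarrow> decoup Z m l M2 K2 c J"
  shows "decoup Z m l M2 (K1 * K2) c A"
proof -
  let ?t = "tri l"
  have t: "?t \<ge> 1" by (rule tri_ge_1[OF l])
  have "moment Z m l ?t c J powr (1 / real ?t) \<le> K2 powr (1 / real ?t) * sqfun Z m l ?t M2 c J"
    if J: "J \<in> res_parts M1 A" for J
  proof -
    have "moment Z m l ?t c J powr (1 / real ?t) \<le> (K2 * sqfun Z m l ?t M2 c J ^ ?t) powr (1 / real ?t)"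
      using 2[OF J] by (intro powr_mono2) (auto simp: decoup_def)
    also have "\<dots> = K2 powr (1 / real ?t) * sqfun Z m l ?t M2 c J"
      using K t by (simp add: powr_mult power_powr_inverse)
    finally show ?thesis .
  qed
  then have "sqfun Z m l ?t M1 c A \<le> (\<Sum>J\<in>res_parts M1 A. K2 powr (1 / real ?t) * sqfun Z m l ?t M2 c J)"
    unfolding sqfun_def[of _ _ _ _ M1] by (rule sum_mono)
  also have "\<dots> = K2 powr (1 / real ?t) * sqfun Z m l ?t M2 c A"
    by (simp add: sum_distrib_left[symmetric] sqfun_refine[OF A M])
  finally have "sqfun Z m l ?t M1 c A ^ ?t \<le> (K2 powr (1 / real ?t) * sqfun Z m l ?t M2 c A) ^ ?t"
    by (intro power_mono) auto
  also have "\<dots> = K2 * sqfun Z m l ?t M2 c A ^ ?t"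
    using t K by (simp add: power_mult_distrib powr_inverse_power)
  finally have "K1 * sqfun Z m l ?t M1 c A ^ ?t \<le> K1 * (K2 * sqfun Z m l ?t M2 c A ^ ?t)"
    using K by (intro mult_left_mono) auto
  then show ?thesis using 1 unfolding decoup_def by simp
qed

text \<open>Cauchy--Schwarz at each frequency over at most \<open>M\<close> classes, then
  Minkowski's inequality with exponent \<open>tri l\<close> for the squared sums.\<close>

lemma decoup_trivial:
  assumes A: "finite A" and M: "M > 0" and l: "l \<ge> 1"
  shows "decoup Z m l M (of_int M ^ tri l) c A"
proof -
  let ?t = "tri l"
  have t: "?t \<ge> 1" by (rule tri_ge_1[OF l])
  have pt: "cmod (expsum Z m l c A a) ^ (2 * ?t) \<le> of_int M ^ ?t * (\<Sum>J\<in>res_parts M A. cmod (expsum Z m l c J a) ^ 2) ^ ?t" for a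
  proof -
    have "cmod (expsum Z m l c A a) \<le> (\<Sum>J\<in>res_parts M A. cmod (expsum Z m l c J a))"
      unfolding expsum_res_parts[OF A, of Z m l c a M] by (rule norm_sum)
    then have "cmod (expsum Z m l c A a) ^ 2 \<le> (\<Sum>J\<in>res_parts M A. cmod (expsum Z m l c J a)) ^ 2"
      by (intro power_mono) auto
    also have "\<dots> \<le> (\<Sum>J\<in>res_parts M A. cmod (expsum Z m l c J a) ^ 2) * card (res_parts M A)"
      by (rule sum_squared_le_sum_of_squares)
    also have "\<dots> \<le> (\<Sum>J\<in>res_parts M A. cmod (expsum Z m l c J a) ^ 2) * of_int M"
    proof (intro mult_left_mono sum_nonneg)
      have "real_of_int (int (card (res_parts M A))) \<le> of_int M"
        using card_res_parts[OF M A] by (simp only: of_int_le_iff)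
      then show "real (card (res_parts M A)) \<le> of_int M" by simp
    qed auto
    finally have "(cmod (expsum Z m l c A a) ^ 2) ^ ?t \<le> ((\<Sum>J\<in>res_parts M A. cmod (expsum Z m l c J a) ^ 2) * of_int M) ^ ?t"
      by (rule power_mono) auto
    then show ?thesis by (simp add: power_mult power_mult_distrib mult.commute power2_eq_square)
  qed
  have "moment Z m l ?t c A \<le> of_int M ^ ?t * avg (rbox l Z) (\<lambda>a. (\<Sum>J\<in>res_parts M A. cmod (expsum Z m l c J a) ^ 2) ^ ?t)"
    unfolding moment_def avg_cmult[symmetric] by (rule avg_mono) (rule pt)
  also have "\<dots> \<le> of_int M ^ ?t * (\<Sum>J\<in>res_parts M A. avg (rbox l Z) (\<lambda>a. (cmod (expsum Z m l c J a) ^ 2) ^ ?t) powr (1 / real ?t)) ^ ?t"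
    using A M t by (intro mult_left_mono avg_minkowski) auto
  finally show ?thesis by (simp add: decoup_def sqfun_def moment_def power_mult)
qed

section \<open>Recentring a curve and rescaling a residue class\<close>

definition cpoly :: "nat \<Rightarrow> nat \<Rightarrow> (nat \<Rightarrow> int) \<Rightarrow> int poly" where
  "cpoly m l a = (\<Sum>i=1..l. monom (a i) (m + i))"

lemma poly_cpoly: "poly (cpoly m l a) x = cform m l a x"
  by (simp add: cpoly_def cform_def poly_sum poly_monom)

lemma coeff_cpoly: "coeff (cpoly m l a) n = (if m < n \<and> n \<le> m + l then a (n - m) else 0)"
proof -
  have "coeff (cpoly m l a) n = (\<Sum>i=1..l. if m + i = n then a i else 0)"
    by (simp add: cpoly_def coeff_sum)
  also have "\<dots> = (\<Sum>i=1..l. if n - m = i \<and> m < n then a i else 0)"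
    by (intro sum.cong) auto
  also have "\<dots> = (if m < n \<and> n \<le> m + l then a (n - m) else 0)"
    by (cases "m < n") auto
  finally show ?thesis .
qed

lemma cpoly_add_smult: "cpoly m l (\<lambda>i. a i + z * b i) = cpoly m l a + smult z (cpoly m l b)"
  by (rule poly_eqI) (simp add: coeff_cpoly)

lemma degree_cpoly: "degree (cpoly m l a) \<le> m + l"
  by (rule degree_le) (simp add: coeff_cpoly)

lemma pcompose_power: "pcompose (q ^ n) r = pcompose q r ^ n"
  by (induction n) (simp_all add: pcompose_mult pcompose_1)

text \<open>The antiderivative of a multiple of \<open>x\<^sup>m (x - x0)\<^sup>i\<^sup>-\<^sup>1\<close> has no terms of
  order \<open>1, ..., i - 1\<close> at \<open>x0\<close>.\<close>

lemma cpoly_triangular: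
  fixes p :: int
  assumes p: "prime p" and ml: "int (m + l) < p" and x0: "m = 0 \<or> \<not> p dvd x0"
    and i: "1 \<le> i" "i \<le> l"
  obtains b where "\<And>j. 1 \<le> j \<Longrightarrow> j < i \<Longrightarrow> coeff (pcompose (cpoly m l b) [:x0, 1:]) j = 0"
    and "\<not> p dvd coeff (pcompose (cpoly m l b) [:x0, 1:]) i"
proof -
  \<comment> \<open>Multiplying by \<open>W\<close> makes the antiderivative integral, since every
    exponent \<open>m + j\<close> divides it. It remains a unit modulo \<open>p\<close> because all
    its factors are below \<open>p\<close>.\<close>
  define W where "W = (\<Prod>j=1..l. int (m + j))"
  define Q where "Q = smult W (monom 1 m * [:- x0, 1:] ^ (i - 1))"
  define b where "b j = coeff Q (m + j - 1) div int (m + j)" for j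
  define T where "T = pcompose (cpoly m l b) [:x0, 1:]"
  have Wd: "int (m + j) dvd W" if "j \<in> {1..l}" for j
    unfolding W_def using that by (intro dvd_prodI) auto
  have pW: "\<not> p dvd W"
  proof
    assume "p dvd W"
    then obtain j where j: "j \<in> {1..l}" "p dvd int (m + j)"
      unfolding W_def using prime_dvd_prod_iff[of "{1..l}" p "\<lambda>j. int (m + j)"] p by auto
    then have "p \<le> int (m + j)" using zdvd_imp_le[of p "int (m + j)"] by auto
    then show False using j ml by auto
  qed
  have dQ: "degree ([:- x0, 1:] ^ (i - 1)) \<le> i - 1"
    using degree_power_le[of "[:- x0, 1:]" "i - 1"] by simp
  have pd: "pderiv (cpoly m l b) = Q"
  proof (rule poly_eqI)
    fix n
    consider "n < m" | "m \<le> n" "n < m + l" | "m + l \<le> n" by linarith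
    then show "coeff (pderiv (cpoly m l b)) n = coeff Q n"
    proof cases
      case 1
      then show ?thesis by (simp add: coeff_pderiv coeff_cpoly Q_def coeff_monom_mult)
    next
      case 2
      then have "Suc n - m \<in> {1..l}" "int (m + (Suc n - m)) = int (Suc n)" by auto
      then have "int (Suc n) dvd coeff Q n" using Wd[of "Suc n - m"] by (simp add: Q_def)
      then show ?thesis using 2
        by (simp add: coeff_pderiv coeff_cpoly b_def Suc_diff_le)
    next
      case 3
      then have "coeff ([:- x0, 1:] ^ (i - 1)) (n - m) = 0"
        using i by (intro coeff_eq_0 le_less_trans[OF dQ]) auto
      then show ?thesis using 3 by (simp add: coeff_pderiv coeff_cpoly Q_def coeff_monom_mult)
    qed
  qed
  have "pderiv T = pcompose Q [:x0, 1:] * pderiv [:x0, 1:]"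
    unfolding T_def by (simp only: pderiv_pcompose pd)
  also have "\<dots> = pcompose Q [:x0, 1:]" by (simp add: pderiv_pCons)
  also have "\<dots> = smult W (pcompose (monom 1 m) [:x0, 1:] * pcompose [:- x0, 1:] [:x0, 1:] ^ (i - 1))"
    by (simp add: Q_def pcompose_smult pcompose_mult pcompose_power)
  also have "pcompose [:- x0, 1:] [:x0, 1:] = [:0, 1:]" by (simp add: pcompose_pCons)
  also have "[:0, 1 :: int:] ^ (i - 1) = monom 1 (i - 1)" by (simp add: monom_altdef)
  finally have dT: "pderiv T = smult W (monom 1 (i - 1) * pcompose (monom 1 m) [:x0, 1:])"
    by (simp add: mult.commute)
  have c: "int (Suc n) * coeff T (Suc n) = W * (if n < i - 1 then 0 else coeff (pcompose (monom 1 m) [:x0, 1:]) (n - (i - 1)))" for n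
    using arg_cong[OF dT, of "\<lambda>q. coeff q n"] by (simp add: coeff_pderiv coeff_monom_mult)
  have z: "coeff T j = 0" if "1 \<le> j" "j < i" for j
  proof -
    have "j - 1 < i - 1" "Suc (j - 1) = j" using that by auto
    then show ?thesis using c[of "j - 1"] that by simp
  qed
  have "coeff (pcompose (monom 1 m) [:x0, 1:]) 0 = x0 ^ m"
    by (simp add: poly_0_coeff_0[symmetric] poly_pcompose poly_monom)
  then have ci: "int i * coeff T i = W * x0 ^ m"
    using c[of "i - 1"] i by simp
  have "\<not> p dvd x0 ^ m" using x0 p prime_dvd_power[OF p, of x0 m] not_prime_unit[of p] by (cases "m = 0") auto
  then have "\<not> p dvd W * x0 ^ m" using pW p by (simp add: prime_dvd_mult_iff)
  then have "\<not> p dvd coeff T i" using ci by (metis dvd_mult)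
  with z show ?thesis using that[of b] unfolding T_def by blast
qed

text \<open>The Taylor coefficients at \<open>x0\<close> form a triangular system whose diagonal
  entries are units modulo \<open>p\<close>. The correction for order \<open>i + 1\<close> uses a
  vector whose coefficients of orders 1 to \<open>i\<close> vanish, so the equations already solved
  persist.\<close>

lemma cpoly_solve:
  fixes p :: int
  assumes p: "prime p" and ml: "int (m + l) < p" and x0: "m = 0 \<or> \<not> p dvd x0"
    and i: "i \<le> l"
  shows "\<exists>b. \<forall>j\<in>{1..i}. p ^ E dvd coeff (pcompose (cpoly m l b) [:x0, 1:]) j - u j"
  using i
proof (induction i)
  case 0
  then show ?case by auto
next
  case (Suc i)
  then obtain a where a: "\<forall>j\<in>{1..i}. p ^ E dvd coeff (pcompose (cpoly m l a) [:x0, 1:]) j - u j" by auto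
  obtain b where b: "\<And>j. 1 \<le> j \<Longrightarrow> j < Suc i \<Longrightarrow> coeff (pcompose (cpoly m l b) [:x0, 1:]) j = 0"
    "\<not> p dvd coeff (pcompose (cpoly m l b) [:x0, 1:]) (Suc i)"
    using cpoly_triangular[OF p ml x0, of "Suc i"] Suc.prems by auto
  define w where "w = coeff (pcompose (cpoly m l b) [:x0, 1:]) (Suc i)"
  define v where "v = u (Suc i) - coeff (pcompose (cpoly m l a) [:x0, 1:]) (Suc i)"
  have "coprime w (p ^ E)" using b(2) p unfolding w_def
    by (simp add: prime_imp_coprime coprime_commute coprime_power_right_iff)
  then obtain s t where st: "s * w + t * p ^ E = 1"
    using bezout_int[of w "p ^ E"] by auto
  have co: "coeff (pcompose (cpoly m l (\<lambda>i. a i + (v * s) * b i)) [:x0, 1:]) j =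
     coeff (pcompose (cpoly m l a) [:x0, 1:]) j + (v * s) * coeff (pcompose (cpoly m l b) [:x0, 1:]) j" for j
    by (simp only: cpoly_add_smult pcompose_add pcompose_smult coeff_add coeff_smult)
  have last: "p ^ E dvd coeff (pcompose (cpoly m l (\<lambda>i. a i + (v * s) * b i)) [:x0, 1:]) (Suc i) - u (Suc i)"
  proof -
    have "coeff (pcompose (cpoly m l (\<lambda>i. a i + (v * s) * b i)) [:x0, 1:]) (Suc i) - u (Suc i) = v * (s * w) - v"
      unfolding co by (simp add: v_def w_def)
    also have "s * w = 1 - t * p ^ E" using st by linarith
    also have "v * (1 - t * p ^ E) - v = p ^ E * (- v * t)" by (simp add: algebra_simps)
    finally show ?thesis by simp
  qed
  show ?case
  proof (intro exI ballI)
    fix j assume "j \<in> {1..Suc i}"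
    then consider "j = Suc i" | "j \<in> {1..i}" by (auto simp: le_Suc_eq)
    then show "p ^ E dvd coeff (pcompose (cpoly m l (\<lambda>i. a i + (v * s) * b i)) [:x0, 1:]) j - u j"
    proof cases
      case 1
      then show ?thesis using last by simp
    next
      case 2
      then show ?thesis using a b(1)[of j] unfolding co by simp
    qed
  qed
qed

lemma poly_bounded_degree:
  fixes q :: "'a :: comm_semiring_1 poly"
  assumes "degree q \<le> n"
  shows "poly q y = (\<Sum>i\<le>n. coeff q i * y ^ i)"
  unfolding poly_altdef using assms by (intro sum.mono_neutral_left) (auto simp: coeff_eq_0)

text \<open>Near \<open>x0\<close> the curve can realise any prescribed combination \<open>u\<close>
  of \<open>y, ..., y ^ l\<close> modulo \<open>p ^ E\<close>, at the price of a constant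
  \<open>\<kappa>\<close> and a tail of order \<open>l + 1\<close>. For \<open>m = 0\<close> the
  degree leaves no room for a tail.\<close>

lemma cform_solve:
  fixes p :: int
  assumes p: "prime p" and ml: "int (m + l) < p" and x0: "m = 0 \<or> \<not> p dvd x0"
  obtains b \<kappa> R where
    "\<And>y. p ^ E dvd cform m l b (x0 + y) - \<kappa> - cform 0 l u y - y ^ (l + 1) * R y"
    "m = 0 \<Longrightarrow> R = (\<lambda>_. 0)"
proof -
  obtain b where b: "\<And>j. j \<in> {1..l} \<Longrightarrow> p ^ E dvd coeff (pcompose (cpoly m l b) [:x0, 1:]) j - u j"
    using cpoly_solve[OF p ml x0 order_refl] by blast
  define T where "T = pcompose (cpoly m l b) [:x0, 1:]"
  define R where "R y = (\<Sum>i=l+1..m+l. coeff T i * y ^ (i - (l + 1)))" for y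
  have dT: "degree T \<le> m + l"
    unfolding T_def by (simp add: degree_pcompose degree_cpoly)
  have "p ^ E dvd cform m l b (x0 + y) - coeff T 0 - cform 0 l u y - y ^ (l + 1) * R y" for y
  proof -
    have "cform m l b (x0 + y) = poly T y"
      by (simp add: T_def poly_pcompose poly_cpoly)
    also have "\<dots> = (\<Sum>i\<le>m+l. coeff T i * y ^ i)" by (rule poly_bounded_degree[OF dT])
    also have "{..m+l} = insert 0 ({1..l} \<union> {l+1..m+l})" by auto
    also have "(\<Sum>i\<in>insert 0 ({1..l} \<union> {l+1..m+l}). coeff T i * y ^ i)
      = coeff T 0 + ((\<Sum>i\<in>{1..l}. coeff T i * y ^ i) + (\<Sum>i\<in>{l+1..m+l}. coeff T i * y ^ i))"
      by (subst sum.insert) (auto simp: sum.union_disjoint)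
    also have "(\<Sum>i\<in>{l+1..m+l}. coeff T i * y ^ i) = y ^ (l + 1) * R y"
      unfolding R_def sum_distrib_left
    proof (rule sum.cong)
      fix i assume "i \<in> {l+1..m+l}"
      then have "y ^ i = y ^ (l + 1 + (i - (l + 1)))" by (intro arg_cong2[of _ _ _ _ "(^)"]) auto
      then have "y ^ i = y ^ (l + 1) * y ^ (i - (l + 1))" by (simp only: power_add)
      then show "coeff T i * y ^ i = y ^ (l + 1) * (coeff T i * y ^ (i - (l + 1)))" by simp
    qed simp
    finally have "cform m l b (x0 + y) - coeff T 0 - cform 0 l u y - y ^ (l + 1) * R y
       = (\<Sum>i\<in>{1..l}. (coeff T i - u i) * y ^ i)"
      by (simp add: cform_def left_diff_distrib sum_subtractf)
    also have "p ^ E dvd \<dots>" using b by (intro dvd_sum) (auto simp: T_def)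
    finally show ?thesis .
  qed
  moreover have "m = 0 \<Longrightarrow> R = (\<lambda>_. 0)" by (simp add: R_def fun_eq_iff)
  ultimately show ?thesis using that[of b "coeff T 0" R] by blast
qed

text \<open>The substitution \<open>x0 + p ^ c1 * y\<close> turns the class into a moment curve at
  scale \<open>c2 - c1\<close>, by the affine invariance of that curve. For \<open>m > 0\<close> the
  tail of order \<open>l + 1\<close> is divisible by \<open>p ^ ((l + 1) * c1)\<close> and
  disappears because \<open>l * c2 \<le> (l + 1) * c1\<close>. An ambient modulus
  \<open>p ^ T\<close> larger than \<open>p ^ (l * c2)\<close> costs nothing.\<close>

lemma decoup_class:
  fixes p :: int
  assumes p: "prime p" and ml: "int (m + l) < p" and l: "l \<ge> 1"
    and x0: "m = 0 \<or> (\<not> p dvd x0 \<and> l * c2 \<le> (l + 1) * c1)"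
    and c12: "c1 \<le> c2" and T: "l * c2 \<le> T"
    and D: "Dec p l (c2 - c1) K" and K: "K \<ge> 0"
    and A: "finite A" "\<And>n. n \<in> A \<Longrightarrow> p ^ c1 dvd n - x0"
  shows "decoup (p ^ T) m l (p ^ c2) K c A"
proof -
  define N where "N = c2 - c1"
  define Z where "Z = p ^ T"
  define Z' where "Z' = p ^ (l * N)"
  define \<psi> where "\<psi> y = x0 + p ^ c1 * y" for y
  define B where "B = (\<lambda>n. (n - x0) div p ^ c1) ` A"
  have pp: "p > 0" using p by (simp add: prime_gt_0_int)
  have Zp: "Z > 0" "Z' > 0" using pp by (auto simp: Z_def Z'_def)
  have "\<psi> ((n - x0) div p ^ c1) = n" if "n \<in> A" for n
    using A(2)[OF that] by (simp add: \<psi>_def)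
  then have AB: "A = \<psi> ` B" by (force simp: B_def image_image)
  have fB: "finite B" using A by (simp add: B_def)
  have inj: "inj \<psi>" using pp by (auto simp: inj_def \<psi>_def)
  have lN: "l * N = l * c2 - l * c1" by (simp add: N_def diff_mult_distrib2)
  have lNT: "l * N \<le> T" using T lN by simp
  have ZZ: "Z = p ^ (T - l * N) * Z'" using lNT by (simp add: Z_def Z'_def flip: power_add)
  have "\<exists>b \<kappa>. \<forall>y. Z dvd cform m l b (\<psi> y) - \<kappa> - p ^ (T - l * N) * cform 0 l \<tau> y" for \<tau>
  proof -
    \<comment> \<open>The weights equalise the orders: with \<open>w = p ^ c1 * y\<close> every
      monomial \<open>u j * w ^ j\<close> carries the same factor
      \<open>p ^ (l * c1)\<close>.\<close>
    define u where "u j = p ^ ((l - j) * c1) * \<tau> j" for j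
    \<comment> \<open>Lifts the congruence modulo \<open>p ^ (l * c2)\<close> to one modulo
      \<open>Z\<close>.\<close>
    define P where "P = p ^ (T - l * c2)"
    obtain b \<kappa> R where b: "\<And>y. p ^ (l * c2) dvd cform m l b (x0 + y) - \<kappa> - cform 0 l u y - y ^ (l + 1) * R y"
      and R: "m = 0 \<Longrightarrow> R = (\<lambda>_. 0)"
      using cform_solve[OF p ml, of x0 "l * c2" u] x0 by metis
    have "Z dvd cform m l (\<lambda>i. P * b i) (\<psi> y) - P * \<kappa> - p ^ (T - l * N) * cform 0 l \<tau> y" for y
    proof -
      define w where "w = p ^ c1 * y"
      have ZP: "Z = P * p ^ (l * c2)" using T by (simp add: Z_def P_def flip: power_add)
      have "p ^ ((l - j) * c1) * \<tau> j * w ^ j = p ^ (l * c1) * (\<tau> j * y ^ j)" if "j \<in> {1..l}" for j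
      proof -
        have "p ^ ((l - j) * c1) * (p ^ c1) ^ j = p ^ (l * c1)"
          using that by (simp flip: power_add power_mult add: mult.commute[of c1] flip: distrib_right)
        then show ?thesis by (simp add: w_def power_mult_distrib mult_ac)
      qed
      then have u: "cform 0 l u w = p ^ (l * c1) * cform 0 l \<tau> y"
        unfolding cform_def u_def sum_distrib_left by (intro sum.cong) auto
      have e1: "P * p ^ (l * c1) = p ^ (T - l * N)"
        using T lN c12 by (simp add: P_def flip: power_add)
      have "p ^ (l * c2) dvd w ^ (l + 1) * R w"
      proof (cases "m = 0")
        case False
        then have "l * c2 \<le> c1 * (l + 1)" using x0 by (simp add: mult.commute)
        then have "p ^ (l * c2) dvd (p ^ c1) ^ (l + 1)" unfolding power_mult[symmetric] by (rule le_imp_power_dvd)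
        then show ?thesis unfolding w_def power_mult_distrib by (simp del: power_Suc)
      qed (simp add: R)
      then have "p ^ (l * c2) dvd cform m l b (x0 + w) - \<kappa> - cform 0 l u w"
        using dvd_add[OF b[of w]] by (metis diff_add_cancel)
      then have "Z dvd P * (cform m l b (x0 + w) - \<kappa> - cform 0 l u w)"
        unfolding ZP by (rule mult_dvd_mono[OF dvd_refl])
      also have "P * (cform m l b (x0 + w) - \<kappa> - cform 0 l u w)
         = cform m l (\<lambda>i. P * b i) (\<psi> y) - P * \<kappa> - p ^ (T - l * N) * cform 0 l \<tau> y"
        unfolding u cform_smult by (simp add: right_diff_distrib \<psi>_def w_def flip: e1)
      finally show ?thesis .
    qed
    then show ?thesis by blast
  qed
  then obtain s \<kappa> where s: "\<And>\<tau> y. Z dvd cform m l (s \<tau>) (\<psi> y) - \<kappa> \<tau> - p ^ (T - l * N) * cform 0 l \<tau> y"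
    by metis
  \<comment> \<open>The original frequency \<open>a\<close> becomes part of the coefficients;
    \<open>Dec\<close> can then be applied for each \<open>a\<close> separately, with the same
    constant.\<close>
  define c' where "c' a y = c (\<psi> y) * e (of_int (cform m l a (\<psi> y)) / of_int Z)" for a y
  have key: "cmod (expsum Z m l c (\<psi> ` J) (\<lambda>i. a i + s \<tau> i)) = cmod (expsum Z' 0 l (c' a) J \<tau>)" for J a \<tau>
  proof -
    have "e (of_int (cform m l (\<lambda>i. a i + s \<tau> i) (\<psi> y)) / of_int Z) =
       e (of_int (\<kappa> \<tau>) / of_int Z) * (e (of_int (cform m l a (\<psi> y)) / of_int Z) * e (of_int (cform 0 l \<tau> y) / of_int Z'))" for y
    proof -
      have "e (of_int (cform m l (s \<tau>) (\<psi> y)) / of_int Z) = e (of_int (\<kappa> \<tau> + p ^ (T - l * N) * cform 0 l \<tau> y) / of_int Z)"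
        using s[of \<tau> y] by (intro e_div_cong Zp) (simp add: algebra_simps)
      also have "real_of_int (\<kappa> \<tau> + p ^ (T - l * N) * cform 0 l \<tau> y) / of_int Z = of_int (\<kappa> \<tau>) / of_int Z + of_int (cform 0 l \<tau> y) / of_int Z'"
        using pp Zp unfolding ZZ by (simp add: field_simps)
      finally show ?thesis by (simp add: cform_add add_divide_distrib e_add)
    qed
    then have "expsum Z m l c (\<psi> ` J) (\<lambda>i. a i + s \<tau> i) = e (of_int (\<kappa> \<tau>) / of_int Z) * expsum Z' 0 l (c' a) J \<tau>"
      using inj unfolding expsum_def c'_def sum_distrib_left
      by (subst sum.reindex) (auto simp: inj_on_def inj_def mult_ac)
    then show ?thesis by (simp add: norm_mult)
  qed
  have mom: "moment Z m l t c (\<psi> ` J) = avg (rbox l Z) (\<lambda>a. moment Z' 0 l t (c' a) J)" for t J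
  proof -
    have per: "cmod (expsum Z m l c (\<psi> ` J) a) ^ (2 * t) = cmod (expsum Z m l c (\<psi> ` J) b) ^ (2 * t)"
      if "\<And>i. i \<in> {1..l} \<Longrightarrow> Z dvd a i - b i" for a b
      using expsum_cong[OF Zp(1), of l a b m c] that by simp
    have "moment Z m l t c (\<psi> ` J) = avg (rbox l Z) (\<lambda>a. avg (rbox l Z') (\<lambda>\<tau>. cmod (expsum Z m l c (\<psi> ` J) (\<lambda>i. a i + s \<tau> i)) ^ (2 * t)))"
      unfolding moment_def using Zp
      by (intro avg_rbox_double[where f = "\<lambda>a. cmod (expsum Z m l c (\<psi> ` J) a) ^ (2 * t)"])
         (auto simp: rbox_nonempty intro: per)
    then show ?thesis unfolding key moment_def .
  qed
  let ?t = "tri l"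
  have t1: "?t \<ge> 1" by (rule tri_ge_1[OF l])
  have fR: "finite (res_parts (p ^ N) B)" using fB by simp
  have "moment Z m l ?t c A = avg (rbox l Z) (\<lambda>a. moment Z' 0 l ?t (c' a) B)"
    unfolding AB by (rule mom)
  also have "\<dots> \<le> avg (rbox l Z) (\<lambda>a. K * sqfun Z' 0 l ?t (p ^ N) (c' a) B ^ ?t)"
    using D fB unfolding Dec_def decoup_def Z'_def N_def by (intro avg_mono) auto
  also have "\<dots> = K * avg (rbox l Z) (\<lambda>a. sqfun Z' 0 l ?t (p ^ N) (c' a) B ^ ?t)" by (rule avg_cmult)
  also have "\<dots> \<le> K * (\<Sum>J\<in>res_parts (p ^ N) B. avg (rbox l Z) (\<lambda>a. (moment Z' 0 l ?t (c' a) J powr (1 / real ?t)) ^ ?t) powr (1 / real ?t)) ^ ?t"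
    unfolding sqfun_def using fR t1 K by (intro mult_left_mono avg_minkowski) auto
  also have "(\<lambda>J. avg (rbox l Z) (\<lambda>a. (moment Z' 0 l ?t (c' a) J powr (1 / real ?t)) ^ ?t) powr (1 / real ?t))
     = (\<lambda>J. moment Z m l ?t c (\<psi> ` J) powr (1 / real ?t))"
    using t1 by (simp add: powr_inverse_power mom)
  also have "(\<Sum>J\<in>res_parts (p ^ N) B. moment Z m l ?t c (\<psi> ` J) powr (1 / real ?t)) = sqfun Z m l ?t (p ^ c2) c A"
  proof -
    have "p ^ c2 = p ^ c1 * p ^ N" using c12 by (simp add: N_def flip: power_add)
    then have "res_parts (p ^ c2) A = (image \<psi>) ` res_parts (p ^ N) B"
      using res_parts_affine[of "p ^ c1" "p ^ N" x0 B] pp unfolding AB \<psi>_def by simp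
    moreover have "inj_on (image \<psi>) X" for X using inj by (auto simp: inj_on_def inj_image_eq_iff)
    ultimately show ?thesis unfolding sqfun_def by (simp add: sum.reindex)
  qed
  finally show ?thesis unfolding decoup_def Z_def .
qed

section \<open>Decoupling exponents, and curves away from the origin\<close>

definition Dec_eps :: "int \<Rightarrow> nat \<Rightarrow> real \<Rightarrow> bool" where
  "Dec_eps p l \<mu> \<longleftrightarrow> (\<exists>C\<ge>1. \<forall>N. Dec p l N (C * of_int p powr (\<mu> * real N)))"

lemma decoup_mono:
  assumes "decoup Z m l M K c A" "K \<le> K'"
  shows "decoup Z m l M K' c A"
  using assms unfolding decoup_def
  by (meson mult_right_mono order_trans sqfun_nonneg zero_le_power)

lemma Dec_mono:
  assumes "Dec p l N K" "K \<le> K'"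
  shows "Dec p l N K'"
  unfolding Dec_def
proof (intro allI impI)
  fix c A assume "finite (A :: int set)"
  then have "decoup (p ^ (l * N)) 0 l (p ^ N) K c A" using assms(1) by (simp add: Dec_def)
  then show "decoup (p ^ (l * N)) 0 l (p ^ N) K' c A" using assms(2) by (rule decoup_mono)
qed

lemma Dec_trivial: "p > 0 \<Longrightarrow> l \<ge> 1 \<Longrightarrow> Dec p l N (of_int p powr (real (tri l) * real N))"
proof -
  assume "p > 0" "l \<ge> 1"
  then have "Dec p l N (of_int (p ^ N) ^ tri l)" unfolding Dec_def by (intro allI impI decoup_trivial) simp_all
  moreover have "(of_int (p ^ N) :: real) ^ tri l = of_int p powr (real (tri l) * real N)"
    using \<open>p > 0\<close> by (simp add: powr_realpow[symmetric] powr_powr mult.commute)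
  ultimately show ?thesis by simp
qed

text \<open>On a class of modulus \<open>p\<^sup>c\<close> the curve agrees with a moment curve to order \<open>l\<close>, so it can be
  decoupled down to modulus \<open>p\<^sup>c\<^sup>'\<close> with \<open>l c' \<le> (l + 1) c\<close>; iterate.\<close>

lemma decoup_unit_curve:
  fixes p :: int
  assumes p: "prime p" and ml: "int (m + l) < p" and l: "l \<ge> 1"
    and D: "\<And>\<epsilon>. \<epsilon> > 0 \<Longrightarrow> Dec_eps p l \<epsilon>" and \<epsilon>: "\<epsilon> > 0"
  shows "\<exists>C\<ge>1. \<forall>c' T x0 c A. \<not> p dvd x0 \<longrightarrow> finite A \<longrightarrow> (\<forall>n\<in>A. p dvd n - x0) \<longrightarrow> l * c' \<le> T \<longrightarrow>
     decoup (p ^ T) m l (p ^ c') (C * of_int p powr (\<epsilon> * real c')) c A"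
proof -
  have p2: "p \<ge> 2" using p by (simp add: prime_ge_2_int)
  then have rp: "real_of_int p \<ge> 2" by simp
  obtain C1 where C1: "C1 \<ge> 1" "\<And>N. Dec p l N (C1 * of_int p powr (\<epsilon> / 2 * real N))"
    using D[of "\<epsilon> / 2"] \<epsilon> unfolding Dec_eps_def by auto
  \<comment> \<open>Each step of the iteration refines the modulus by at least
    \<open>p ^ c0\<close>, so half of the permitted exponent \<open>\<epsilon>\<close> absorbs the
    constant \<open>C1\<close> of that step and no constants accumulate.\<close>
  obtain c0 :: nat where c0: "C1 \<le> of_int p powr (\<epsilon> / 2 * real c0)" "c0 \<ge> 1"
  proof -
    define c0 where "c0 = nat \<lceil>2 * log p C1 / \<epsilon>\<rceil> + 1"
    have "2 * log p C1 / \<epsilon> \<le> real c0" unfolding c0_def by linarith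
    then have "log p C1 \<le> \<epsilon> / 2 * real c0" using \<epsilon> by (simp add: field_simps)
    moreover have "1 < real_of_int p" "0 < C1" using rp C1 by auto
    ultimately have "C1 \<le> of_int p powr (\<epsilon> / 2 * real c0)"
      using log_le_iff[of "real_of_int p" C1 "\<epsilon> / 2 * real c0"] by blast
    then show ?thesis using that[of c0] by (simp add: c0_def)
  qed
  define n0 where "n0 = (l + 1) * c0"
  define C where "C = real_of_int p ^ (n0 * tri l)"
  have C: "C \<ge> 1" using rp unfolding C_def by (intro one_le_power) auto
  have main: "decoup (p ^ T) m l (p ^ c') (C * of_int p powr (\<epsilon> * real c')) c A"
    if h: "\<not> p dvd x0" "finite A" "\<forall>n\<in>A. p dvd n - x0" "l * c' \<le> T" for c' T x0 c A
    using h
  proof (induction c' arbitrary: T x0 c A rule: less_induct)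
    case (less c')
    show ?case
    proof (cases "c' \<le> n0")
      case True
      have "decoup (p ^ T) m l (p ^ c') (of_int (p ^ c') ^ tri l) c A"
        using less.prems p2 l by (intro decoup_trivial) auto
      moreover have "of_int (p ^ c') ^ tri l \<le> C * of_int p powr (\<epsilon> * real c')"
      proof -
        have "real_of_int (p ^ c') ^ tri l = of_int p ^ (c' * tri l)" by (simp add: power_mult)
        also have "\<dots> \<le> C" unfolding C_def using True rp by (intro power_increasing mult_right_mono) auto
        also have "\<dots> \<le> C * of_int p powr (\<epsilon> * real c')"
          using C rp \<epsilon> by (simp add: ge_one_powr_ge_zero)
        finally show ?thesis .
      qed
      ultimately show ?thesis by (rule decoup_mono)
    next
      case False
      \<comment> \<open>The largest refinement for which
        \<open>l * c' \<le> (l + 1) * (c' - g)\<close>, the condition that lets the tail of order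
        \<open>l + 1\<close> vanish.\<close>
      define g where "g = c' div (l + 1)"
      define c1 where "c1 = c' - g"
      have g: "g \<ge> c0" using False unfolding g_def n0_def
        by (simp add: less_eq_div_iff_mult_less_eq mult.commute)
      have gc: "(l + 1) * g \<le> c'" unfolding g_def by (rule times_div_less_eq_dividend)
      then have gc': "g \<le> c'" by simp
      have "c1 < c'" using g c0 gc' by (simp add: c1_def)
      have lc: "l * c' \<le> (l + 1) * c1" using gc gc' by (simp add: c1_def diff_mult_distrib2)
      have "l * c1 \<le> T" using less.prems(4) \<open>c1 < c'\<close> mult_le_mono2[of c1 c' l] by linarith
      then have "decoup (p ^ T) m l (p ^ c1) (C * of_int p powr (\<epsilon> * real c1)) c A"
        using less.prems \<open>c1 < c'\<close> by (intro less.IH) auto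
      moreover have "decoup (p ^ T) m l (p ^ c') (C1 * of_int p powr (\<epsilon> / 2 * real g)) c J"
        if J: "J \<in> res_parts (p ^ c1) A" for J
      proof -
        obtain x1 where x1: "x1 \<in> J" using res_parts_nonempty[OF J] by auto
        then have "x1 \<in> A" using res_parts_subset[OF J] by auto
        have nd: "\<not> p dvd x1"
        proof
          assume "p dvd x1"
          moreover have "p dvd x1 - x0" using less.prems \<open>x1 \<in> A\<close> by blast
          ultimately have "p dvd x1 - (x1 - x0)" by (rule dvd_diff)
          then show False using less.prems by simp
        qed
        have "c' - c1 = g" using gc' by (simp add: c1_def)
        then show ?thesis using p ml l nd lc C1 less.prems \<open>c1 < c'\<close> x1 res_parts_cong[OF J _ x1] res_parts_finite[OF less.prems(2) J]
          by (intro decoup_class[where ?x0.0 = x1 and ?c1.0 = c1]) auto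
      qed
      ultimately have "decoup (p ^ T) m l (p ^ c') ((C * of_int p powr (\<epsilon> * real c1)) * (C1 * of_int p powr (\<epsilon> / 2 * real g))) c A"
        using less.prems l C C1 \<open>c1 < c'\<close>
        by (rule_tac decoup_trans[of _ "p ^ c1" "p ^ c'"]) (simp_all add: le_imp_power_dvd)
      moreover have "(C * of_int p powr (\<epsilon> * real c1)) * (C1 * of_int p powr (\<epsilon> / 2 * real g)) \<le> C * of_int p powr (\<epsilon> * real c')"
      proof -
        have "C1 * of_int p powr (\<epsilon> / 2 * real g) \<le> of_int p powr (\<epsilon> / 2 * real g) * of_int p powr (\<epsilon> / 2 * real g)"
        proof (intro mult_right_mono)
          have "of_int p powr (\<epsilon> / 2 * real c0) \<le> of_int p powr (\<epsilon> / 2 * real g)"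
            using g \<epsilon> rp by (intro powr_mono) auto
          then show "C1 \<le> of_int p powr (\<epsilon> / 2 * real g)" using c0 by linarith
        qed auto
        also have "\<dots> = of_int p powr (\<epsilon> * real g)" by (simp flip: powr_add)
        finally have "(C * of_int p powr (\<epsilon> * real c1)) * (C1 * of_int p powr (\<epsilon> / 2 * real g)) \<le> (C * of_int p powr (\<epsilon> * real c1)) * of_int p powr (\<epsilon> * real g)"
          using C by (intro mult_left_mono) auto
        also have "\<dots> = C * of_int p powr (\<epsilon> * real c1 + \<epsilon> * real g)" by (simp add: powr_add)
        also have "\<epsilon> * real c1 + \<epsilon> * real g = \<epsilon> * real c'" using gc' by (simp add: c1_def of_nat_diff algebra_simps)
        finally show ?thesis .
      qed
      ultimately show ?thesis by (rule decoup_mono)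
    qed
  qed
  then show ?thesis using C by blast
qed

section \<open>Bilinear decoupling for two separated classes\<close>

definition bmoment :: "int \<Rightarrow> nat \<Rightarrow> nat \<Rightarrow> nat \<Rightarrow> (int \<Rightarrow> complex) \<Rightarrow> int set \<Rightarrow> int set \<Rightarrow> real" where
  "bmoment Z k t t' c A A' =
     avg (rbox k Z) (\<lambda>a. cmod (expsum Z 0 k c A a) ^ (2 * t) * cmod (expsum Z 0 k c A' a) ^ (2 * t'))"

text \<open>The classes modulo \<open>p ^ a\<close> and \<open>p ^ b\<close> lie over different
  residues modulo \<open>p\<close> once \<open>a\<close> and \<open>b\<close> are positive; this is
  the transversality. The exponents add up to the critical one of degree \<open>k\<close>, and the
  factor of \<open>A\<close> has the critical exponent of degree \<open>l\<close>, to which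
  decoupling on an \<open>l\<close>-dimensional slice applies.\<close>

definition Bil :: "int \<Rightarrow> nat \<Rightarrow> nat \<Rightarrow> nat \<Rightarrow> nat \<Rightarrow> nat \<Rightarrow> real \<Rightarrow> bool" where
  "Bil p k N l a b K \<longleftrightarrow> (\<forall>c A A' \<xi> \<xi>'. finite A \<longrightarrow> finite A' \<longrightarrow> \<not> p dvd \<xi> - \<xi>' \<longrightarrow>
     (\<forall>n\<in>A. p ^ a dvd n - \<xi>) \<longrightarrow> (\<forall>n\<in>A'. p ^ b dvd n - \<xi>') \<longrightarrow>
     bmoment (p ^ (k * N)) k (tri l) (tri k - tri l) c A A' \<le>
       K * (sqfun (p ^ (k * N)) 0 k (tri k) (p ^ N) c A ^ tri l *
            sqfun (p ^ (k * N)) 0 k (tri k) (p ^ N) c A' ^ (tri k - tri l)))"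

lemma BilI:
  assumes "\<And>c A A' \<xi> \<xi>'. finite A \<Longrightarrow> finite A' \<Longrightarrow> \<not> p dvd \<xi> - \<xi>' \<Longrightarrow>
     (\<And>n. n \<in> A \<Longrightarrow> p ^ a dvd n - \<xi>) \<Longrightarrow> (\<And>n. n \<in> A' \<Longrightarrow> p ^ b dvd n - \<xi>') \<Longrightarrow>
     bmoment (p ^ (k * N)) k (tri l) (tri k - tri l) c A A' \<le>
       K * (sqfun (p ^ (k * N)) 0 k (tri k) (p ^ N) c A ^ tri l *
            sqfun (p ^ (k * N)) 0 k (tri k) (p ^ N) c A' ^ (tri k - tri l))"
  shows "Bil p k N l a b K"
  unfolding Bil_def by (intro allI impI assms) auto

lemma BilD:
  assumes "Bil p k N l a b K" "finite A" "finite A'" "\<not> p dvd \<xi> - \<xi>'"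
     "\<And>n. n \<in> A \<Longrightarrow> p ^ a dvd n - \<xi>" "\<And>n. n \<in> A' \<Longrightarrow> p ^ b dvd n - \<xi>'"
  shows "bmoment (p ^ (k * N)) k (tri l) (tri k - tri l) c A A' \<le>
       K * (sqfun (p ^ (k * N)) 0 k (tri k) (p ^ N) c A ^ tri l *
            sqfun (p ^ (k * N)) 0 k (tri k) (p ^ N) c A' ^ (tri k - tri l))"
  using assms(1)[unfolded Bil_def, rule_format, of A A' \<xi> \<xi>' c] assms(2-) by blast

lemma Bil_mono:
  assumes B: "Bil p k N l a b K" and le: "a \<le> a'" "b \<le> b'" "K \<le> K'"
  shows "Bil p k N l a' b' K'"
proof (rule BilI)
  fix c and A A' :: "int set" and \<xi> \<xi>' :: int
  assume h: "finite A" "finite A'" "\<not> p dvd \<xi> - \<xi>'" "\<And>n. n \<in> A \<Longrightarrow> p ^ a' dvd n - \<xi>" "\<And>n. n \<in> A' \<Longrightarrow> p ^ b' dvd n - \<xi>'"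
  let ?X = "sqfun (p ^ (k * N)) 0 k (tri k) (p ^ N) c A ^ tri l *
            sqfun (p ^ (k * N)) 0 k (tri k) (p ^ N) c A' ^ (tri k - tri l)"
  have "bmoment (p ^ (k * N)) k (tri l) (tri k - tri l) c A A' \<le> K * ?X"
    using h le by (intro BilD[OF B, of A A' \<xi> \<xi>'] ) (auto intro: dvd_trans[OF le_imp_power_dvd])
  also have "\<dots> \<le> K' * ?X" using le by (intro mult_right_mono mult_nonneg_nonneg) auto
  finally show "bmoment (p ^ (k * N)) k (tri l) (tri k - tri l) c A A' \<le> K' * ?X" .
qed

text \<open>Positivity of \<open>a\<close> and \<open>b\<close> takes care of a vanishing base: one
  of the exponents it carries on the left is then nonzero as well, and
  \<open>0 powr \<theta> = 0\<close>.\<close>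

lemma powr_interpolate:
  fixes x y :: real
  assumes "x \<ge> 0" "y \<ge> 0" "\<theta> > 0" "\<phi> > 0" "a \<ge> 1" "b \<ge> 1"
    and "\<theta> * real a1 + \<phi> * real a2 = real a" "\<theta> * real b1 + \<phi> * real b2 = real b"
  shows "(x ^ a1 * y ^ b1) powr \<theta> * (x ^ a2 * y ^ b2) powr \<phi> = x ^ a * y ^ b"
proof -
  consider "x = 0" | "y = 0" | "x > 0" "y > 0" using assms by linarith
  then show ?thesis
  proof cases
    case 1
    have "a1 \<noteq> 0 \<or> a2 \<noteq> 0" using assms(5,7) by (auto intro: ccontr)
    then show ?thesis using 1 assms(5) by (elim disjE) (simp_all add: power_0_left)
  next
    case 2
    have "b1 \<noteq> 0 \<or> b2 \<noteq> 0" using assms(6,8) by (auto intro: ccontr)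
    then show ?thesis using 2 assms(6) by (elim disjE) (simp_all add: power_0_left)
  next
    case 3
    then have "(x ^ a1 * y ^ b1) powr \<theta> * (x ^ a2 * y ^ b2) powr \<phi>
      = x powr (\<theta> * real a1 + \<phi> * real a2) * y powr (\<theta> * real b1 + \<phi> * real b2)"
      by (simp add: powr_mult powr_powr powr_add mult_ac flip: powr_realpow)
    also have "\<dots> = x ^ a * y ^ b" unfolding assms(7,8) using 3 by (simp add: powr_realpow)
    finally show ?thesis .
  qed
qed

lemma tri_strict_mono: "l < k \<Longrightarrow> tri l < tri k"
proof -
  assume "l < k"
  then have "real (tri l) < real (tri k)"
    unfolding real_tri by (intro divide_strict_right_mono mult_strict_mono) auto
  then show ?thesis by simp
qed

lemma Bil_trivial:
  assumes l: "1 \<le> l" "l < k" and D: "Dec p k N K" and K: "K \<ge> 0"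
  shows "Bil p k N l a b K"
proof (rule BilI)
  fix c and A A' :: "int set" and \<xi> \<xi>' :: int
  assume fin: "finite A" "finite A'"
  define Z where "Z = p ^ (k * N)"
  define X where "X = sqfun Z 0 k (tri k) (p ^ N) c"
  let ?f = "\<lambda>a. cmod (expsum Z 0 k c A a)" and ?g = "\<lambda>a. cmod (expsum Z 0 k c A' a)"
  define \<theta> where "\<theta> = real (tri l) / real (tri k)"
  define \<phi> where "\<phi> = real (tri k - tri l) / real (tri k)"
  have t: "tri l \<ge> 1" "tri l < tri k" using l tri_ge_1 tri_strict_mono by auto
  have th: "\<theta> > 0" "\<phi> > 0" "\<theta> + \<phi> = 1" "\<theta> * real (tri k) = real (tri l)" "\<phi> * real (tri k) = real (tri k - tri l)"
    using t by (auto simp: \<theta>_def \<phi>_def of_nat_diff field_simps)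
  have m: "moment Z 0 k (tri k) c A \<le> K * X A ^ tri k" "moment Z 0 k (tri k) c A' \<le> K * X A' ^ tri k"
    using D fin unfolding Dec_def decoup_def Z_def X_def by auto
  have X0: "X A \<ge> 0" "X A' \<ge> 0" by (auto simp: X_def)
  have "bmoment Z k (tri l) (tri k - tri l) c A A' = avg (rbox k Z) (\<lambda>a. (?f a ^ (2 * tri k)) powr \<theta> * (?g a ^ (2 * tri k)) powr \<phi>)"
    unfolding bmoment_def
  proof (rule avg_cong)
    fix a
    show "?f a ^ (2 * tri l) * ?g a ^ (2 * (tri k - tri l)) = (?f a ^ (2 * tri k)) powr \<theta> * (?g a ^ (2 * tri k)) powr \<phi>"
      using powr_interpolate[of "?f a" "?g a" \<theta> \<phi> "2 * tri l" "2 * (tri k - tri l)" "2 * tri k" 0 0 "2 * tri k"] th t by simp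
  qed
  also have "\<dots> \<le> moment Z 0 k (tri k) c A powr \<theta> * moment Z 0 k (tri k) c A' powr \<phi>"
    unfolding moment_def by (rule avg_Hoelder) (use th in auto)
  also have "\<dots> \<le> (K * X A ^ tri k) powr \<theta> * (K * X A' ^ tri k) powr \<phi>"
    using th m by (intro mult_mono powr_mono2) auto
  also have "\<dots> = (K powr \<theta> * K powr \<phi>) * ((X A ^ tri k * X A' ^ 0) powr \<theta> * (X A ^ 0 * X A' ^ tri k) powr \<phi>)"
    using K X0 by (simp add: powr_mult)
  also have "K powr \<theta> * K powr \<phi> = K" using th K by (cases "K = 0") (auto simp flip: powr_add)
  also have "(X A ^ tri k * X A' ^ 0) powr \<theta> * (X A ^ 0 * X A' ^ tri k) powr \<phi> = X A ^ tri l * X A' ^ (tri k - tri l)"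
    using th t X0 by (intro powr_interpolate) auto
  finally show "bmoment (p ^ (k * N)) k (tri l) (tri k - tri l) c A A' \<le>
       K * (sqfun (p ^ (k * N)) 0 k (tri k) (p ^ N) c A ^ tri l *
            sqfun (p ^ (k * N)) 0 k (tri k) (p ^ N) c A' ^ (tri k - tri l))"
    unfolding X_def Z_def .
qed

text \<open>Interpolates between exponent index \<open>l - 1\<close> on \<open>A\<close> and, with
  the roles exchanged, index \<open>k - l\<close> on \<open>A'\<close>. The weights
  \<open>(k - l) / (k - l + 1)\<close> and \<open>1 / (k - l + 1)\<close> are forced by \<open>(k -
  l) * tri (l - 1) + (tri k - tri (k - l)) = (k - l + 1) * tri l\<close>.\<close>

lemma Bil_Hoelder:
  assumes l: "1 \<le> l" "l < k" and K: "C1 \<ge> 1" "C2 \<ge> 1" and pp: "p > 0"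
    and 1: "Bil p k N (l - 1) a b (C1 * of_int p powr x1)"
    and 2: "Bil p k N (k - l) b a (C2 * of_int p powr x2)"
  shows "Bil p k N l a b (C1 * C2 * of_int p powr ((real (k - l) * x1 + x2) / real (k - l + 1)))"
proof (rule BilI)
  fix c and A A' :: "int set" and \<xi> \<xi>' :: int
  assume h: "finite A" "finite A'" "\<not> p dvd \<xi> - \<xi>'" "\<And>n. n \<in> A \<Longrightarrow> p ^ a dvd n - \<xi>" "\<And>n. n \<in> A' \<Longrightarrow> p ^ b dvd n - \<xi>'"
  have h3: "\<not> p dvd \<xi>' - \<xi>" using h(3) by (simp add: dvd_diff_commute)
  define Z where "Z = p ^ (k * N)"
  define X where "X = sqfun Z 0 k (tri k) (p ^ N) c"
  let ?f = "\<lambda>a. cmod (expsum Z 0 k c A a)" and ?g = "\<lambda>a. cmod (expsum Z 0 k c A' a)"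
  define n where "n = k - l"
  define \<theta> where "\<theta> = real n / real (n + 1)"
  define \<phi> where "\<phi> = 1 / real (n + 1)"
  have n: "n \<ge> 1" using l by (simp add: n_def)
  have th: "\<theta> > 0" "\<phi> > 0" "\<theta> + \<phi> = 1" "\<theta> \<le> 1" "\<phi> \<le> 1" using n by (auto simp: \<theta>_def \<phi>_def field_simps)
  have t: "tri l \<ge> 1" "tri l < tri k" "tri (l - 1) < tri k" "tri (k - l) < tri k"
    using l tri_ge_1[of l] tri_strict_mono[of l k] tri_strict_mono[of "l - 1" k] tri_strict_mono[of "k - l" k] by linarith+
  have kl: "real k = real l + real n" "real (l - 1) = real l - 1" using l by (auto simp: n_def)
  have e1: "\<theta> * real (tri (l - 1)) + \<phi> * real (tri k - tri n) = real (tri l)"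
  proof -
    have "real (tri k - tri n) = real (tri k) - real (tri n)" using t(4) by (simp add: n_def of_nat_diff)
    then have "real n * real (tri (l - 1)) + real (tri k - tri n) = real (n + 1) * real (tri l)"
      unfolding real_tri kl by (simp add: field_simps)
    then have "(real n * real (tri (l - 1)) + real (tri k - tri n)) / real (n + 1) = real (tri l)" by simp
    then show ?thesis unfolding \<theta>_def \<phi>_def by (simp add: add_divide_distrib)
  qed
  have e2: "\<theta> * real (tri k - tri (l - 1)) + \<phi> * real (tri n) = real (tri k - tri l)"
  proof -
    have "real (tri k - tri n) = real (tri k) - real (tri n)" "real (tri k - tri l) = real (tri k) - real (tri l)"
      "real (tri k - tri (l - 1)) = real (tri k) - real (tri (l - 1))" using t by (auto simp: n_def of_nat_diff)
    moreover have "\<theta> * real (tri k) + \<phi> * real (tri k) = real (tri k)" using th(3) by (metis distrib_right mult_1)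
    ultimately show ?thesis using e1 by (simp add: right_diff_distrib)
  qed
  have X0: "X A \<ge> 0" "X A' \<ge> 0" by (auto simp: X_def)
  let ?u = "\<lambda>a. ?f a ^ (2 * tri (l - 1)) * ?g a ^ (2 * (tri k - tri (l - 1)))"
  let ?v = "\<lambda>a. ?f a ^ (2 * (tri k - tri n)) * ?g a ^ (2 * tri n)"
  define E1 where "E1 = X A ^ tri (l - 1) * X A' ^ (tri k - tri (l - 1))"
  define E2 where "E2 = X A ^ (tri k - tri n) * X A' ^ tri n"
  have E0: "E1 \<ge> 0" "E2 \<ge> 0" using X0 by (auto simp: E1_def E2_def)
  have m1: "avg (rbox k Z) ?u \<le> C1 * of_int p powr x1 * E1"
    using BilD[OF 1 h, of c] by (simp add: bmoment_def Z_def X_def E1_def)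
  have m2: "avg (rbox k Z) ?v \<le> C2 * of_int p powr x2 * E2"
    using BilD[OF 2 h(2,1) h3 h(5,4), of c] by (simp add: bmoment_def Z_def X_def E2_def n_def mult_ac)
  have "bmoment Z k (tri l) (tri k - tri l) c A A' = avg (rbox k Z) (\<lambda>a. ?u a powr \<theta> * ?v a powr \<phi>)"
    unfolding bmoment_def
  proof (rule avg_cong)
    fix a
    show "?f a ^ (2 * tri l) * ?g a ^ (2 * (tri k - tri l)) = ?u a powr \<theta> * ?v a powr \<phi>"
    proof (rule powr_interpolate[symmetric])
      show "\<theta> * real (2 * tri (l - 1)) + \<phi> * real (2 * (tri k - tri n)) = real (2 * tri l)"
        using arg_cong[OF e1, of "(*) 2"] by (simp only: of_nat_mult of_nat_numeral distrib_left mult.left_commute)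
      show "\<theta> * real (2 * (tri k - tri (l - 1))) + \<phi> * real (2 * tri n) = real (2 * (tri k - tri l))"
        using arg_cong[OF e2, of "(*) 2"] by (simp only: of_nat_mult of_nat_numeral distrib_left mult.left_commute)
    qed (use t th in auto)
  qed
  also have "\<dots> \<le> avg (rbox k Z) ?u powr \<theta> * avg (rbox k Z) ?v powr \<phi>"
    by (rule avg_Hoelder) (use th in auto)
  also have "\<dots> \<le> (C1 * of_int p powr x1 * E1) powr \<theta> * (C2 * of_int p powr x2 * E2) powr \<phi>"
    using th m1 m2 by (intro mult_mono powr_mono2) (auto intro!: avg_nonneg)
  also have "\<dots> = C1 powr \<theta> * C2 powr \<phi> * (of_int p powr (\<theta> * x1 + \<phi> * x2) * (E1 powr \<theta> * E2 powr \<phi>))"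
    using K E0 pp by (simp add: powr_mult powr_powr powr_add mult_ac)
  also have "\<dots> \<le> C1 * C2 * (of_int p powr (\<theta> * x1 + \<phi> * x2) * (E1 powr \<theta> * E2 powr \<phi>))"
  proof (intro mult_right_mono mult_mono)
    show "C1 powr \<theta> \<le> C1" using powr_mono[of \<theta> 1 C1] th K by simp
    show "C2 powr \<phi> \<le> C2" using powr_mono[of \<phi> 1 C2] th K by simp
  qed (use K in auto)
  also have "E1 powr \<theta> * E2 powr \<phi> = X A ^ tri l * X A' ^ (tri k - tri l)"
    unfolding E1_def E2_def by (rule powr_interpolate[OF X0 th(1,2) _ _ e1 e2]) (use t in auto)
  also have "\<theta> * x1 + \<phi> * x2 = (real (k - l) * x1 + x2) / real (k - l + 1)"
    by (simp add: \<theta>_def \<phi>_def n_def add_divide_distrib)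
  finally show "bmoment (p ^ (k * N)) k (tri l) (tri k - tri l) c A A' \<le>
       C1 * C2 * of_int p powr ((real (k - l) * x1 + x2) / real (k - l + 1)) * (sqfun (p ^ (k * N)) 0 k (tri k) (p ^ N) c A ^ tri l *
            sqfun (p ^ (k * N)) 0 k (tri k) (p ^ N) c A' ^ (tri k - tri l))"
    unfolding X_def Z_def by (simp add: mult_ac)
qed

text \<open>Around the class of \<open>A'\<close> the sum over \<open>A'\<close> does not see shifts of the last \<open>l\<close> coordinates by
  \<open>p\<^sup>k\<^sup>N\<^sup>-\<^sup>(\<^sup>k\<^sup>-\<^sup>l\<^sup>+\<^sup>1\<^sup>)\<^sup>b\<close>, and on such a slice the sum over \<open>A\<close> runs over a curve of degree \<open>l\<close>.\<close>

lemma Bil_lower_degree: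
  fixes p :: int
  assumes p: "prime p" and l: "1 \<le> l" "l < k" and a: "a \<ge> 1"
    and b: "b \<ge> 1" "b \<le> N" and a': "a' \<le> N" "l * a' \<le> (k - l + 1) * b"
    and KT: "KT \<ge> 0" "\<And>T x0 c A. \<not> p dvd x0 \<Longrightarrow> finite A \<Longrightarrow> \<forall>n\<in>A. p dvd n - x0 \<Longrightarrow> l * a' \<le> T \<Longrightarrow>
        decoup (p ^ T) (k - l) l (p ^ a') KT c A"
    and B: "Bil p k N l a' b K" and K: "K \<ge> 0"
  shows "Bil p k N l a b (KT * K)"
proof (rule BilI)
  fix c and A A' :: "int set" and \<xi> \<xi>' :: int
  assume h: "finite A" "finite A'" "\<not> p dvd \<xi> - \<xi>'" "\<And>n. n \<in> A \<Longrightarrow> p ^ a dvd n - \<xi>" "\<And>n. n \<in> A' \<Longrightarrow> p ^ b dvd n - \<xi>'"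
  define m where "m = k - l"
  define T where "T = k * N"
  define R where "R = (m + 1) * b"
  define P where "P = p ^ (T - R)"
  define Z where "Z = p ^ T"
  define Z' where "Z' = p ^ R"
  have pp: "p > 0" using p by (simp add: prime_gt_0_int)
  have Zp: "Z > 0" "Z' > 0" "P > 0" using pp by (auto simp: Z_def Z'_def P_def)
  have mk: "m + 1 \<le> k" "m + l = k" using l by (auto simp: m_def)
  have "R \<le> T" unfolding R_def T_def using mk b by (intro mult_le_mono) auto
  then have ZP: "Z = P * Z'" by (simp add: Z_def P_def Z'_def flip: power_add)
  have aZ: "p dvd p ^ a" using a by (simp add: dvd_power)
  have nA: "p dvd n - \<xi>" if "n \<in> A" for n using dvd_trans[OF aZ h(4)[OF that]] .
  have "\<exists>s \<kappa>. \<forall>x. cform 0 k s x = P * cform m l \<tau> (x - \<xi>') - \<kappa>" for \<tau>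
  proof -
    \<comment> \<open>A shift of the frequencies by the coefficients of \<open>q\<close> adds a
      phase of orders at least \<open>k - l + 1\<close> around \<open>\<xi>'\<close>. This phase is
      trivial on \<open>A'\<close> and a full curve of dimension \<open>l\<close> on
      \<open>A\<close>; the constant term only contributes a unimodular factor.\<close>
    define q where "q = smult P (pcompose (cpoly m l \<tau>) [:- \<xi>', 1:])"
    have dq: "degree q \<le> k" using degree_cpoly[of m l \<tau>] mk by (simp add: q_def degree_pcompose)
    have "P * cform m l \<tau> (x - \<xi>') = coeff q 0 + cform 0 k (coeff q) x" for x
    proof -
      have "P * cform m l \<tau> (x - \<xi>') = poly q x" by (simp add: q_def poly_pcompose poly_cpoly)
      also have "\<dots> = (\<Sum>i\<le>k. coeff q i * x ^ i)" by (rule poly_bounded_degree[OF dq])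
      also have "{..k} = insert 0 {1..k}" by auto
      finally show ?thesis by (simp add: cform_def)
    qed
    then have "\<forall>x. cform 0 k (coeff q) x = P * cform m l \<tau> (x - \<xi>') - coeff q 0" by simp
    then show ?thesis by blast
  qed
  then obtain s \<kappa> where s: "\<And>\<tau> x. cform 0 k (s \<tau>) x = P * cform m l \<tau> (x - \<xi>') - \<kappa> \<tau>" by metis
  define sh where "sh J = (\<lambda>n. - \<xi>' + 1 * n) ` J" for J
  define c' where "c' a y = c (y + \<xi>') * e (of_int (cform 0 k a (y + \<xi>')) / of_int Z)" for a y
  have keyA: "cmod (expsum Z 0 k c J (\<lambda>i. a i + s \<tau> i)) = cmod (expsum Z' m l (c' a) (sh J) \<tau>)" for J a \<tau>
  proof -
    have "e (of_int (cform 0 k (\<lambda>i. a i + s \<tau> i) n) / of_int Z) =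
       e (- of_int (\<kappa> \<tau>) / of_int Z) * (e (of_int (cform 0 k a n) / of_int Z) * e (of_int (cform m l \<tau> (n - \<xi>')) / of_int Z'))" for n
    proof -
      have "real_of_int (cform 0 k (\<lambda>i. a i + s \<tau> i) n) / of_int Z = - of_int (\<kappa> \<tau>) / of_int Z + (of_int (cform 0 k a n) / of_int Z + of_int (cform m l \<tau> (n - \<xi>')) / of_int Z')"
        unfolding cform_add s using Zp unfolding ZP by (simp add: field_simps)
      then show ?thesis by (simp only: e_add)
    qed
    then have "expsum Z 0 k c J (\<lambda>i. a i + s \<tau> i) = e (- of_int (\<kappa> \<tau>) / of_int Z) * expsum Z' m l (c' a) (sh J) \<tau>"
      unfolding expsum_def c'_def sh_def sum_distrib_left
      by (subst sum.reindex) (auto simp: inj_on_def mult_ac)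
    then show ?thesis by (simp add: norm_mult)
  qed
  have keyA': "cmod (expsum Z 0 k c A' (\<lambda>i. a i + s \<tau> i)) = cmod (expsum Z 0 k c A' a)" for a \<tau>
  proof -
    have "e (of_int (cform 0 k (\<lambda>i. a i + s \<tau> i) n) / of_int Z) =
       e (- of_int (\<kappa> \<tau>) / of_int Z) * e (of_int (cform 0 k a n) / of_int Z)" if n: "n \<in> A'" for n
    proof -
      have "Z' dvd \<tau> i * (n - \<xi>') ^ (m + i)" if "i \<in> {1..l}" for i
      proof -
        have "(p ^ b) ^ (m + 1) dvd (n - \<xi>') ^ (m + 1)" using h(5)[OF n] by (rule dvd_power_same)
        also have "(n - \<xi>') ^ (m + 1) dvd (n - \<xi>') ^ (m + i)" using that by (intro le_imp_power_dvd) auto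
        finally have "Z' dvd (n - \<xi>') ^ (m + i)" unfolding Z'_def R_def by (simp only: power_mult[symmetric] mult.commute)
        then show ?thesis by (rule dvd_mult)
      qed
      then have "Z' dvd cform m l \<tau> (n - \<xi>')" unfolding cform_def by (intro dvd_sum) auto
      then have "Z dvd P * cform m l \<tau> (n - \<xi>')" unfolding ZP by (rule mult_dvd_mono[OF dvd_refl])
      then have "e (of_int (cform 0 k (\<lambda>i. a i + s \<tau> i) n) / of_int Z) = e (of_int (- \<kappa> \<tau> + cform 0 k a n) / of_int Z)"
        unfolding cform_add s by (intro e_div_cong Zp) (simp add: algebra_simps)
      then show ?thesis by (simp only: of_int_add of_int_minus add_divide_distrib e_add)
    qed
    then have "expsum Z 0 k c A' (\<lambda>i. a i + s \<tau> i) = e (- of_int (\<kappa> \<tau>) / of_int Z) * expsum Z 0 k c A' a"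
      unfolding expsum_def sum_distrib_left by (intro sum.cong) (auto simp: mult_ac)
    then show ?thesis by (simp add: norm_mult)
  qed
  define t where "t = tri l"
  define t' where "t' = tri k - tri l"
  define g where "g a = cmod (expsum Z 0 k c A' a) ^ (2 * t')" for a
  define H where "H J a = moment Z' m l t (c' a) (sh J)" for J a
  have t1: "t \<ge> 1" using l tri_ge_1[of l] by (simp add: t_def)
  have g0: "g a \<ge> 0" for a by (simp add: g_def)
  have H0: "H J a \<ge> 0" for J a by (simp add: H_def)
  have bm: "bmoment Z k t t' c J A' = avg (rbox k Z) (\<lambda>a. g a * H J a)" for J
  proof -
    have per: "cmod (expsum Z 0 k c J a) ^ (2 * t) * g a = cmod (expsum Z 0 k c J b) ^ (2 * t) * g b"
      if "\<And>i. i \<in> {1..k} \<Longrightarrow> Z dvd a i - b i" for a b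
      using expsum_cong[OF Zp(1), of k a b 0 c] that by (simp add: g_def)
    have "bmoment Z k t t' c J A' = avg (rbox k Z) (\<lambda>a. avg (rbox l Z') (\<lambda>\<tau>. cmod (expsum Z 0 k c J (\<lambda>i. a i + s \<tau> i)) ^ (2 * t) * g (\<lambda>i. a i + s \<tau> i)))"
      unfolding bmoment_def g_def[symmetric] using Zp
      by (intro avg_rbox_double[where f = "\<lambda>a. cmod (expsum Z 0 k c J a) ^ (2 * t) * g a"])
         (auto simp: rbox_nonempty intro: per)
    also have "\<dots> = avg (rbox k Z) (\<lambda>a. avg (rbox l Z') (\<lambda>\<tau>. g a * cmod (expsum Z' m l (c' a) (sh J) \<tau>) ^ (2 * t)))"
      unfolding g_def keyA' unfolding keyA by (simp add: mult.commute)
    finally show ?thesis unfolding avg_cmult H_def moment_def .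
  qed
  define Q where "Q = res_parts (p ^ a') A"
  define X where "X = sqfun Z 0 k (tri k) (p ^ N) c"
  have fQ: "finite Q" using h(1) by (simp add: Q_def)
  have X0: "X J \<ge> 0" for J by (simp add: X_def)
  have HA: "H A a \<le> KT * (\<Sum>J\<in>Q. H J a powr (1 / real t)) ^ t" for a
  proof -
    have "\<not> p dvd \<xi> - \<xi>'" by (rule h(3))
    moreover have "\<forall>n\<in>sh A. p dvd n - (\<xi> - \<xi>')" using nA by (auto simp: sh_def)
    ultimately have "decoup Z' m l (p ^ a') KT (c' a) (sh A)"
      unfolding Z'_def m_def using KT(2)[of "\<xi> - \<xi>'" "sh A" R "c' a"] h(1) a'(2) by (simp add: sh_def R_def m_def)
    moreover have "res_parts (p ^ a') (sh A) = sh ` Q"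
      unfolding sh_def Q_def using res_parts_affine[of 1 "p ^ a'" "- \<xi>'" A] by simp
    moreover have "inj_on sh Q" unfolding sh_def
      by (intro inj_onI) (auto simp: inj_image_eq_iff inj_def)
    ultimately show ?thesis
      unfolding decoup_def sqfun_def H_def t_def by (simp add: sum.reindex)
  qed
  have BJ: "bmoment Z k t t' c J A' \<le> K * (X J ^ t * X A' ^ t')" if J: "J \<in> Q" for J
  proof -
    obtain x where x: "x \<in> J" using res_parts_nonempty J unfolding Q_def by blast
    then have "x \<in> A" using res_parts_subset J unfolding Q_def by blast
    have "\<not> p dvd x - \<xi>'"
    proof
      assume "p dvd x - \<xi>'"
      then have "p dvd (x - \<xi>') - (x - \<xi>)" using nA[OF \<open>x \<in> A\<close>] by (rule dvd_diff)
      then show False using h(3) by simp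
    qed
    then show ?thesis
      unfolding Z_def T_def X_def t_def t'_def using h(2,5) x J res_parts_cong[of J "p ^ a'" A _ x] res_parts_finite[OF h(1)]
      by (intro BilD[OF B, of J A' x \<xi>']) (auto simp: Q_def)
  qed
  have "bmoment Z k t t' c A A' = avg (rbox k Z) (\<lambda>a. g a * H A a)" by (rule bm)
  \<comment> \<open>The factor \<open>g\<close> of \<open>A'\<close> is drawn into the sum over
    classes before Minkowski's inequality. The averages of the products are then again bilinear
    moments, now with \<open>A\<close> replaced by a class modulo \<open>p ^ a'\<close>.\<close>
  also have "\<dots> \<le> avg (rbox k Z) (\<lambda>a. KT * (\<Sum>J\<in>Q. (g a * H J a) powr (1 / real t)) ^ t)"
  proof (rule avg_mono)
    fix a
    have "g a * H A a \<le> g a * (KT * (\<Sum>J\<in>Q. H J a powr (1 / real t)) ^ t)"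
      using HA g0 by (intro mult_left_mono) auto
    also have "\<dots> = KT * ((g a powr (1 / real t)) ^ t * (\<Sum>J\<in>Q. H J a powr (1 / real t)) ^ t)"
      using g0 t1 by (simp add: powr_inverse_power)
    also have "(g a powr (1 / real t)) ^ t * (\<Sum>J\<in>Q. H J a powr (1 / real t)) ^ t = (\<Sum>J\<in>Q. (g a * H J a) powr (1 / real t)) ^ t"
      using g0 H0 by (simp add: powr_mult sum_distrib_left flip: power_mult_distrib)
    finally show "g a * H A a \<le> KT * (\<Sum>J\<in>Q. (g a * H J a) powr (1 / real t)) ^ t" .
  qed
  also have "\<dots> = KT * avg (rbox k Z) (\<lambda>a. (\<Sum>J\<in>Q. (g a * H J a) powr (1 / real t)) ^ t)" by (rule avg_cmult)
  also have "\<dots> \<le> KT * (\<Sum>J\<in>Q. avg (rbox k Z) (\<lambda>a. ((g a * H J a) powr (1 / real t)) ^ t) powr (1 / real t)) ^ t"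
    using fQ t1 KT by (intro mult_left_mono avg_minkowski) auto
  also have "\<dots> = KT * (\<Sum>J\<in>Q. bmoment Z k t t' c J A' powr (1 / real t)) ^ t"
    using g0 H0 t1 by (simp add: powr_inverse_power bm)
  also have "\<dots> \<le> KT * (\<Sum>J\<in>Q. (K * (X J ^ t * X A' ^ t')) powr (1 / real t)) ^ t"
    using BJ KT by (intro mult_left_mono power_mono sum_mono powr_mono2 sum_nonneg)
      (auto simp: bmoment_def intro!: avg_nonneg)
  also have "(\<Sum>J\<in>Q. (K * (X J ^ t * X A' ^ t')) powr (1 / real t)) = (K * X A' ^ t') powr (1 / real t) * (\<Sum>J\<in>Q. X J)"
    unfolding sum_distrib_left using K X0 t1 by (intro sum.cong) (auto simp: powr_mult power_powr_inverse)
  also have "(\<Sum>J\<in>Q. X J) = X A"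
    unfolding X_def Q_def using h(1) a'(1) by (intro sqfun_refine le_imp_power_dvd)
  also have "((K * X A' ^ t') powr (1 / real t) * X A) ^ t = (K * X A' ^ t') * X A ^ t"
    using K X0 t1 by (simp add: power_mult_distrib powr_inverse_power)
  finally show "bmoment (p ^ (k * N)) k (tri l) (tri k - tri l) c A A' \<le>
       KT * K * (sqfun (p ^ (k * N)) 0 k (tri k) (p ^ N) c A ^ tri l *
            sqfun (p ^ (k * N)) 0 k (tri k) (p ^ N) c A' ^ (tri k - tri l))"
    by (simp add: X_def Z_def T_def t_def t'_def mult_ac)
qed

section \<open>From bilinear back to linear decoupling\<close>

lemma sum_le_card_max:
  fixes f :: "'a \<Rightarrow> real"
  assumes "finite I" "I \<noteq> {}"
  obtains m where "m \<in> I" "\<And>i. i \<in> I \<Longrightarrow> f i \<le> f m" "(\<Sum>i\<in>I. f i) \<le> real (card I) * f m"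
proof -
  have "Max (f ` I) \<in> f ` I" using assms by (intro Max_in) auto
  then obtain m where m: "m \<in> I" "f m = Max (f ` I)" by force
  have le: "f i \<le> f m" if "i \<in> I" for i using that assms m by auto
  then have "(\<Sum>i\<in>I. f i) \<le> real (card I) * f m"
    using sum_bounded_above[of I f "f m"] by simp
  then show ?thesis using that m le by blast
qed

lemma sum_power_le_card:
  fixes f :: "'a \<Rightarrow> real"
  assumes "finite I" "\<And>i. i \<in> I \<Longrightarrow> f i \<ge> 0" "q \<ge> 1"
  shows "(\<Sum>i\<in>I. f i) ^ q \<le> real (card I) ^ q * (\<Sum>i\<in>I. f i ^ q)"
proof (cases "I = {}")
  case False
  obtain m where m: "m \<in> I" "(\<Sum>i\<in>I. f i) \<le> real (card I) * f m"
    using sum_le_card_max[OF assms(1) False, of f] by metis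
  have "(\<Sum>i\<in>I. f i) ^ q \<le> (real (card I) * f m) ^ q"
    using m assms by (intro power_mono sum_nonneg) auto
  also have "\<dots> = real (card I) ^ q * f m ^ q" by (rule power_mult_distrib)
  also have "f m ^ q \<le> (\<Sum>i\<in>I. f i ^ q)"
    using member_le_sum[of m I "\<lambda>i. f i ^ q"] m assms by auto
  finally show ?thesis by (simp add: mult_left_mono)
qed (use assms in \<open>simp add: power_0_left\<close>)

lemma sum_power_le_power_sum:
  fixes f :: "'a \<Rightarrow> real"
  assumes "finite I" "\<And>i. i \<in> I \<Longrightarrow> f i \<ge> 0" "n \<ge> 1"
  shows "(\<Sum>i\<in>I. f i ^ n) \<le> (\<Sum>i\<in>I. f i) ^ n"
proof -
  define T where "T = (\<Sum>i\<in>I. f i)"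
  have T0: "T \<ge> 0" unfolding T_def using assms by (intro sum_nonneg) auto
  have "(\<Sum>i\<in>I. f i ^ n) \<le> (\<Sum>i\<in>I. f i * T ^ (n - 1))"
  proof (rule sum_mono)
    fix i assume i: "i \<in> I"
    have "f i ^ n = f i * f i ^ (n - 1)" using assms(3) by (cases n) auto
    also have "\<dots> \<le> f i * T ^ (n - 1)"
      unfolding T_def using i assms by (intro mult_left_mono power_mono member_le_sum) auto
    finally show "f i ^ n \<le> f i * T ^ (n - 1)" .
  qed
  also have "\<dots> = T * T ^ (n - 1)" by (simp add: T_def sum_distrib_right)
  also have "\<dots> = T ^ n" using assms(3) by (cases n) auto
  finally show ?thesis by (simp add: T_def)
qed

text \<open>Let \<open>x\<close> be the largest modulus and \<open>y\<close> the sum of the others.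
  If \<open>y \<le> \<eta> * x\<close>, the largest term dominates at the cost of
  \<open>1 + \<eta>\<close>. Otherwise \<open>x + y\<close> is controlled by \<open>y\<close>, hence
  by \<open>M\<close> times the second largest modulus, and all but two of the \<open>P\<close>
  powers of that one may be replaced by powers of the largest. The two that remain match
  \<open>2 * tri 1\<close>.\<close>

lemma broad_narrow:
  fixes f :: "'a \<Rightarrow> complex"
  assumes I: "finite I" "real (card I) \<le> M" and P: "P \<ge> 2" and \<eta>: "\<eta> > 0"
  shows "cmod (\<Sum>i\<in>I. f i) ^ P \<le> (1 + \<eta>) ^ P * (\<Sum>i\<in>I. cmod (f i) ^ P) +
     (M * (1 + 1 / \<eta>)) ^ P * (\<Sum>i\<in>I. \<Sum>j\<in>I - {i}. cmod (f i) ^ 2 * cmod (f j) ^ (P - 2))"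
proof (cases "I = {}")
  case True
  then show ?thesis using P by (simp add: power_0_left)
next
  case False
  have M0: "M \<ge> 0" using I(2) by (rule order_trans[rotated]) simp
  obtain m where m: "m \<in> I" "\<And>i. i \<in> I \<Longrightarrow> cmod (f i) \<le> cmod (f m)"
    using sum_le_card_max[OF I(1) False, of "\<lambda>i. cmod (f i)"] by metis
  define x where "x = cmod (f m)"
  define y where "y = (\<Sum>i\<in>I-{m}. cmod (f i))"
  define U where "U = (\<Sum>i\<in>I. cmod (f i) ^ P)"
  define V where "V = (\<Sum>i\<in>I. \<Sum>j\<in>I - {i}. cmod (f i) ^ 2 * cmod (f j) ^ (P - 2))"
  have xy: "x \<ge> 0" "y \<ge> 0" by (auto simp: x_def y_def sum_nonneg)
  have UV: "U \<ge> 0" "V \<ge> 0" by (auto simp: U_def V_def sum_nonneg)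
  have "(\<Sum>i\<in>I. f i) = f m + (\<Sum>i\<in>I-{m}. f i)" using m I by (simp add: sum.remove)
  then have "cmod (\<Sum>i\<in>I. f i) \<le> x + y"
    unfolding x_def y_def by (metis norm_sum norm_triangle_mono order_refl)
  then have 1: "cmod (\<Sum>i\<in>I. f i) ^ P \<le> (x + y) ^ P" by (intro power_mono) auto
  have "(x + y) ^ P \<le> (1 + \<eta>) ^ P * x ^ P + (1 + 1 / \<eta>) ^ P * y ^ P"
  proof (cases "y \<le> \<eta> * x")
    case True
    then have "(x + y) ^ P \<le> ((1 + \<eta>) * x) ^ P" using xy by (intro power_mono) (auto simp: algebra_simps)
    moreover have "0 \<le> (1 + 1 / \<eta>) ^ P * y ^ P"
      using xy \<eta> by (intro mult_nonneg_nonneg zero_le_power add_nonneg_nonneg) auto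
    ultimately show ?thesis by (simp add: power_mult_distrib)
  next
    case False
    then have "x \<le> y / \<eta>" using \<eta> by (simp add: field_simps)
    then have "(x + y) ^ P \<le> ((1 + 1 / \<eta>) * y) ^ P" using xy by (intro power_mono) (auto simp: algebra_simps)
    moreover have "0 \<le> (1 + \<eta>) ^ P * x ^ P" using xy \<eta> by simp
    ultimately show ?thesis by (simp add: power_mult_distrib)
  qed
  also have "x ^ P \<le> U" unfolding x_def U_def using m I by (intro member_le_sum) auto
  also have "y ^ P \<le> M ^ P * V"
  proof (cases "I - {m} = {}")
    case True
    then have "y = 0" unfolding y_def by (simp only: sum.empty)
    then show ?thesis using P UV M0 by (simp add: power_0_left)
  next
    case False
    obtain j where j: "j \<in> I - {m}" "y \<le> real (card (I - {m})) * cmod (f j)"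
      using sum_le_card_max[of "I - {m}" "\<lambda>i. cmod (f i)"] I False unfolding y_def by blast
    have "real (card (I - {m})) \<le> real (card I)" using I by (simp add: card_mono)
    then have "y \<le> M * cmod (f j)" using j(2) I(2) by (meson mult_right_mono norm_ge_zero order_trans)
    then have "y ^ P \<le> (M * cmod (f j)) ^ P" using xy by (intro power_mono) auto
    also have "\<dots> = M ^ P * (cmod (f j) ^ 2 * cmod (f j) ^ (P - 2))"
      using P by (simp only: power_mult_distrib power_add[symmetric] le_add_diff_inverse)
    also have "cmod (f j) ^ 2 * cmod (f j) ^ (P - 2) \<le> cmod (f j) ^ 2 * cmod (f m) ^ (P - 2)"
      using j m by (intro mult_left_mono power_mono) auto
    also have "\<dots> \<le> (\<Sum>i\<in>I - {j}. cmod (f j) ^ 2 * cmod (f i) ^ (P - 2))"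
      using j m I member_le_sum[of m "I - {j}" "\<lambda>i. cmod (f j) ^ 2 * cmod (f i) ^ (P - 2)"] by auto
    also have "\<dots> \<le> V" unfolding V_def
      using j I member_le_sum[of j I "\<lambda>j. \<Sum>i\<in>I - {j}. cmod (f j) ^ 2 * cmod (f i) ^ (P - 2)"] by (auto simp: sum_nonneg)
    finally show ?thesis using M0 by (simp add: mult_left_mono)
  qed
  finally have "(x + y) ^ P \<le> (1 + \<eta>) ^ P * U + (1 + 1 / \<eta>) ^ P * (M ^ P * V)"
    using \<eta> by (simp add: mult_left_mono add_mono)
  also have "(1 + 1 / \<eta>) ^ P * (M ^ P * V) = (M * (1 + 1 / \<eta>)) ^ P * V" by (simp add: power_mult_distrib mult_ac)
  finally show ?thesis using 1 unfolding U_def V_def by linarith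
qed

lemma card_res_parts_real:
  assumes "M > 0" "finite A"
  shows "real (card (res_parts M A)) \<le> of_int M"
proof -
  have "real_of_int (int (card (res_parts M A))) \<le> of_int M"
    using card_res_parts[OF assms] by (simp only: of_int_le_iff)
  then show ?thesis by simp
qed

text \<open>Cuts \<open>A'\<close> into at most \<open>p ^ b\<close> classes and pays for them
  crudely. The loss is exponential in \<open>b\<close>, but of a fixed rate, while the rate of the
  gain obtained by iteration can be made as large as desired.\<close>

lemma Bil_split:
  fixes p :: int
  assumes p: "prime p" and k: "k \<ge> 2" and b: "b \<ge> 1" "b \<le> N" and K: "K \<ge> 0" and B: "Bil p k N 1 1 b K"
  shows "Bil p k N 1 1 1 (of_int (p ^ b) ^ (2 * tri k) * K)"
proof (rule BilI)
  fix c and A A' :: "int set" and \<xi> \<xi>' :: int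
  assume h: "finite A" "finite A'" "\<not> p dvd \<xi> - \<xi>'" "\<And>n. n \<in> A \<Longrightarrow> p ^ 1 dvd n - \<xi>" "\<And>n. n \<in> A' \<Longrightarrow> p ^ 1 dvd n - \<xi>'"
  define Z where "Z = p ^ (k * N)"
  define X where "X = sqfun Z 0 k (tri k) (p ^ N) c"
  define q where "q = tri k - 1"
  define R where "R = res_parts (p ^ b) A'"
  have pp: "p > 0" using p by (simp add: prime_gt_0_int)
  have p1: "real_of_int p \<ge> 1" using pp by simp
  have tri1: "tri 1 = 1" by (simp add: tri_def)
  have "tri 1 < tri k" using k by (intro tri_strict_mono) auto
  then have q: "q \<ge> 1" unfolding q_def tri1 by linarith
  have fR: "finite R" using h by (simp add: R_def)
  have X0: "X J \<ge> 0" for J by (simp add: X_def)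
  have cR: "real (card R) \<le> of_int (p ^ b)" unfolding R_def using pp h by (intro card_res_parts_real) auto
  have BJ: "bmoment Z k 1 q c A J \<le> K * (X A * X J ^ q)" if J: "J \<in> R" for J
  proof -
    obtain x where x: "x \<in> J" using res_parts_nonempty J unfolding R_def by blast
    then have "x \<in> A'" using res_parts_subset J unfolding R_def by blast
    have "\<not> p dvd \<xi> - x"
    proof
      assume "p dvd \<xi> - x"
      then have "p dvd (\<xi> - x) + (x - \<xi>')" using h(5)[OF \<open>x \<in> A'\<close>] by (intro dvd_add) auto
      then show False using h(3) by simp
    qed
    then have "bmoment (p ^ (k * N)) k (tri 1) (tri k - tri 1) c A J \<le> K * (sqfun (p ^ (k * N)) 0 k (tri k) (p ^ N) c A ^ tri 1 *
            sqfun (p ^ (k * N)) 0 k (tri k) (p ^ N) c J ^ (tri k - tri 1))"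
      using h(1,4) x J res_parts_cong[of J "p ^ b" A' _ x] res_parts_finite[OF h(2)]
      by (intro BilD[OF B, of A J \<xi> x]) (auto simp: R_def)
    then show ?thesis unfolding tri1 X_def Z_def q_def by simp
  qed
  have "bmoment Z k 1 q c A A' \<le> avg (rbox k Z) (\<lambda>a. \<Sum>J\<in>R. real (card R) ^ (2 * q) * (cmod (expsum Z 0 k c A a) ^ 2 * cmod (expsum Z 0 k c J a) ^ (2 * q)))"
    unfolding bmoment_def
  proof (rule avg_mono)
    fix a
    have "cmod (expsum Z 0 k c A' a) \<le> (\<Sum>J\<in>R. cmod (expsum Z 0 k c J a))"
      unfolding expsum_res_parts[OF h(2), of Z 0 k c a "p ^ b"] R_def by (rule norm_sum)
    then have "cmod (expsum Z 0 k c A' a) ^ (2 * q) \<le> (\<Sum>J\<in>R. cmod (expsum Z 0 k c J a)) ^ (2 * q)"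
      by (intro power_mono) auto
    also have "\<dots> \<le> real (card R) ^ (2 * q) * (\<Sum>J\<in>R. cmod (expsum Z 0 k c J a) ^ (2 * q))"
      using fR q by (intro sum_power_le_card) auto
    finally have "cmod (expsum Z 0 k c A a) ^ 2 * cmod (expsum Z 0 k c A' a) ^ (2 * q) \<le>
      cmod (expsum Z 0 k c A a) ^ 2 * (real (card R) ^ (2 * q) * (\<Sum>J\<in>R. cmod (expsum Z 0 k c J a) ^ (2 * q)))"
      by (intro mult_left_mono) auto
    then show "cmod (expsum Z 0 k c A a) ^ (2 * 1) * cmod (expsum Z 0 k c A' a) ^ (2 * q) \<le>
      (\<Sum>J\<in>R. real (card R) ^ (2 * q) * (cmod (expsum Z 0 k c A a) ^ 2 * cmod (expsum Z 0 k c J a) ^ (2 * q)))"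
      by (simp add: sum_distrib_left mult_ac)
  qed
  also have "\<dots> = real (card R) ^ (2 * q) * (\<Sum>J\<in>R. bmoment Z k 1 q c A J)"
    unfolding avg_sum avg_cmult bmoment_def by (simp add: sum_distrib_left)
  also have "\<dots> \<le> real (card R) ^ (2 * q) * (\<Sum>J\<in>R. K * (X A * X J ^ q))"
    using BJ by (intro mult_left_mono sum_mono) auto
  also have "\<dots> = real (card R) ^ (2 * q) * (K * X A * (\<Sum>J\<in>R. X J ^ q))"
    by (simp add: sum_distrib_left mult_ac)
  also have "(\<Sum>J\<in>R. X J ^ q) \<le> (\<Sum>J\<in>R. X J) ^ q"
    using fR X0 q by (intro sum_power_le_power_sum) auto
  also have "(\<Sum>J\<in>R. X J) = X A'"
    unfolding X_def R_def using h(2) b by (intro sqfun_refine le_imp_power_dvd)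
  also have "real (card R) ^ (2 * q) \<le> of_int (p ^ b) ^ (2 * q)" using cR by (intro power_mono) auto
  also have "\<dots> \<le> of_int (p ^ b) ^ (2 * tri k)"
    using p1 by (intro power_increasing) (auto simp: q_def)
  finally have "bmoment Z k 1 q c A A' \<le> of_int (p ^ b) ^ (2 * tri k) * (K * X A * X A' ^ q)"
    using K X0 by (simp add: mult_left_mono mult_right_mono)
  then show "bmoment (p ^ (k * N)) k (tri 1) (tri k - tri 1) c A A' \<le>
       of_int (p ^ b) ^ (2 * tri k) * K * (sqfun (p ^ (k * N)) 0 k (tri k) (p ^ N) c A ^ tri 1 *
            sqfun (p ^ (k * N)) 0 k (tri k) (p ^ N) c A' ^ (tri k - tri 1))"
    unfolding X_def Z_def q_def tri1 by (simp add: mult_ac)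
qed

text \<open>Broad-narrow analysis of the classes modulo \<open>p\<close>. A single class rescales to
  scale \<open>N - 1\<close>, so the narrow part loses only a power of \<open>1 + \<eta>\<close> and
  no power of \<open>p\<close>; the broad part consists of at most \<open>p\<^sup>2\<close> bilinear
  moments.\<close>

lemma Dec_recursion:
  fixes p :: int
  assumes p: "prime p" "int k < p" and k: "k \<ge> 2" and N: "N \<ge> 1"
    and K: "K0 \<ge> 0" "K1 \<ge> 0" and \<eta>: "\<eta> > 0"
    and D: "Dec p k (N - 1) K0" and B: "Bil p k N 1 1 1 K1"
  shows "Dec p k N ((1 + \<eta>) ^ (2 * tri k) * K0 + (of_int p * (1 + 1 / \<eta>)) ^ (2 * tri k) * (of_int p ^ 2 * K1))"
  unfolding Dec_def
proof (intro allI impI)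
  fix c and A :: "int set"
  assume A: "finite A"
  define Z where "Z = p ^ (k * N)"
  define X where "X = sqfun Z 0 k (tri k) (p ^ N) c"
  define t where "t = tri k"
  define R where "R = res_parts p A"
  define f where "f J a = expsum Z 0 k c J a" for J a
  have pp: "p > 0" using p by (simp add: prime_gt_0_int)
  have tri1: "tri 1 = 1" by (simp add: tri_def)
  have "tri 1 < tri k" using k by (intro tri_strict_mono) auto
  then have t: "t \<ge> 2" unfolding t_def tri1 by linarith
  have fR: "finite R" using A by (simp add: R_def)
  have X0: "X J \<ge> 0" for J by (simp add: X_def)
  have cR: "real (card R) \<le> of_int p" unfolding R_def using pp A by (intro card_res_parts_real) auto
  have XR: "(\<Sum>J\<in>R. X J) = X A"
    unfolding X_def R_def using A N by (intro sqfun_refine) (auto simp: dvd_power)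
  have XJ: "X J \<le> X A" if "J \<in> R" for J unfolding XR[symmetric] using that fR X0 by (intro member_le_sum) auto
  have c1: "avg (rbox k Z) (\<lambda>a. cmod (f J a) ^ (2 * t)) \<le> K0 * X J ^ t" if J: "J \<in> R" for J
  proof -
    obtain x where x: "x \<in> J" using res_parts_nonempty J unfolding R_def by blast
    have "decoup (p ^ (k * N)) 0 k (p ^ N) K0 c J"
      using p k N D K res_parts_finite[OF A] J x res_parts_cong[of J p A _ x]
      by (intro decoup_class[where ?x0.0 = x and ?c1.0 = 1]) (auto simp: R_def)
    then show ?thesis by (simp add: decoup_def moment_def X_def Z_def t_def f_def)
  qed
  have c2: "avg (rbox k Z) (\<lambda>a. cmod (f J a) ^ 2 * cmod (f J' a) ^ (2 * t - 2)) \<le> K1 * X A ^ t"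
    if J: "J \<in> R" "J' \<in> R - {J}" for J J'
  proof -
    obtain x where x: "x \<in> J" using res_parts_nonempty J unfolding R_def by blast
    obtain y where y: "y \<in> J'" using res_parts_nonempty J unfolding R_def by blast
    have "\<not> p dvd x - y"
    proof
      assume "p dvd x - y"
      have "x \<in> A" using x J res_parts_subset[of J p A] by (auto simp: R_def)
      then have "x \<in> J'" using res_parts_eq[of J' p A y] y J \<open>p dvd x - y\<close> by (auto simp: R_def)
      then show False using res_parts_disjoint[of J p A J'] x J by (auto simp: R_def)
    qed
    then have "bmoment (p ^ (k * N)) k (tri 1) (tri k - tri 1) c J J' \<le> K1 * (sqfun (p ^ (k * N)) 0 k (tri k) (p ^ N) c J ^ tri 1 *
            sqfun (p ^ (k * N)) 0 k (tri k) (p ^ N) c J' ^ (tri k - tri 1))"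
      using x y J res_parts_cong[of J p A _ x] res_parts_cong[of J' p A _ y] res_parts_finite[OF A]
      by (intro BilD[OF B, of J J' x y]) (auto simp: R_def)
    then have "avg (rbox k Z) (\<lambda>a. cmod (f J a) ^ 2 * cmod (f J' a) ^ (2 * t - 2)) \<le> K1 * (X J * X J' ^ (t - 1))"
      unfolding bmoment_def X_def Z_def t_def f_def tri1 by (simp add: diff_mult_distrib2)
    also have "\<dots> \<le> K1 * (X A * X A ^ (t - 1))"
      using XJ X0 J K by (intro mult_left_mono mult_mono power_mono) auto
    also have "X A * X A ^ (t - 1) = X A ^ t" using t by (cases t) auto
    finally show ?thesis .
  qed
  have "moment Z 0 k t c A = avg (rbox k Z) (\<lambda>a. cmod (\<Sum>J\<in>R. f J a) ^ (2 * t))"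
    unfolding moment_def R_def f_def expsum_res_parts[OF A, of _ _ _ _ _ p] ..
  also have "\<dots> \<le> avg (rbox k Z) (\<lambda>a. (1 + \<eta>) ^ (2 * t) * (\<Sum>J\<in>R. cmod (f J a) ^ (2 * t)) +
     (of_int p * (1 + 1 / \<eta>)) ^ (2 * t) * (\<Sum>J\<in>R. \<Sum>J'\<in>R - {J}. cmod (f J a) ^ 2 * cmod (f J' a) ^ (2 * t - 2)))"
    using t \<eta> by (intro avg_mono broad_narrow fR cR) auto
  also have "\<dots> = (1 + \<eta>) ^ (2 * t) * (\<Sum>J\<in>R. avg (rbox k Z) (\<lambda>a. cmod (f J a) ^ (2 * t))) +
     (of_int p * (1 + 1 / \<eta>)) ^ (2 * t) * (\<Sum>J\<in>R. \<Sum>J'\<in>R - {J}. avg (rbox k Z) (\<lambda>a. cmod (f J a) ^ 2 * cmod (f J' a) ^ (2 * t - 2)))"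
    by (simp add: avg_add avg_cmult avg_sum)
  also have "\<dots> \<le> (1 + \<eta>) ^ (2 * t) * (K0 * X A ^ t) + (of_int p * (1 + 1 / \<eta>)) ^ (2 * t) * (of_int p ^ 2 * (K1 * X A ^ t))"
  proof (intro add_mono mult_left_mono)
    have "(\<Sum>J\<in>R. avg (rbox k Z) (\<lambda>a. cmod (f J a) ^ (2 * t))) \<le> (\<Sum>J\<in>R. K0 * X J ^ t)"
      by (intro sum_mono c1)
    also have "\<dots> = K0 * (\<Sum>J\<in>R. X J ^ t)" by (simp add: sum_distrib_left)
    also have "\<dots> \<le> K0 * (\<Sum>J\<in>R. X J) ^ t"
      using K t fR X0 by (intro mult_left_mono sum_power_le_power_sum) auto
    finally show "(\<Sum>J\<in>R. avg (rbox k Z) (\<lambda>a. cmod (f J a) ^ (2 * t))) \<le> K0 * X A ^ t" unfolding XR .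
    have KX: "0 \<le> K1 * X A ^ t" using K X0 by auto
    have "(\<Sum>J'\<in>R - {J}. avg (rbox k Z) (\<lambda>a. cmod (f J a) ^ 2 * cmod (f J' a) ^ (2 * t - 2))) \<le> of_int p * (K1 * X A ^ t)"
      if J: "J \<in> R" for J
    proof -
      have "(\<Sum>J'\<in>R - {J}. avg (rbox k Z) (\<lambda>a. cmod (f J a) ^ 2 * cmod (f J' a) ^ (2 * t - 2))) \<le> (\<Sum>J'\<in>R - {J}. K1 * X A ^ t)"
        by (intro sum_mono c2 J)
      also have "\<dots> \<le> (\<Sum>J'\<in>R. K1 * X A ^ t)" using fR KX by (intro sum_mono2) auto
      also have "\<dots> \<le> of_int p * (K1 * X A ^ t)" using cR KX by (simp add: mult_right_mono)
      finally show ?thesis .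
    qed
    then have "(\<Sum>J\<in>R. \<Sum>J'\<in>R - {J}. avg (rbox k Z) (\<lambda>a. cmod (f J a) ^ 2 * cmod (f J' a) ^ (2 * t - 2))) \<le> (\<Sum>J\<in>R. of_int p * (K1 * X A ^ t))"
      by (rule sum_mono)
    also have "\<dots> \<le> of_int p * (of_int p * (K1 * X A ^ t))" using cR KX pp by (simp add: mult_right_mono)
    finally show "(\<Sum>J\<in>R. \<Sum>J'\<in>R - {J}. avg (rbox k Z) (\<lambda>a. cmod (f J a) ^ 2 * cmod (f J' a) ^ (2 * t - 2))) \<le> of_int p ^ 2 * (K1 * X A ^ t)"
      by (simp add: power2_eq_square mult_ac)
  qed (use \<eta> pp in auto)
  finally show "decoup (p ^ (k * N)) 0 k (p ^ N) ((1 + \<eta>) ^ (2 * tri k) * K0 + (of_int p * (1 + 1 / \<eta>)) ^ (2 * tri k) * (of_int p ^ 2 * K1)) c A"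
    unfolding decoup_def X_def Z_def t_def by (simp add: algebra_simps)
qed

subsection \<open>Orthogonality\<close>

lemma e_of_nat_mult: "e (real n * x) = e x ^ n"
  by (induction n) (simp_all add: distrib_right e_add)

lemma sum_e_residues:
  fixes Z d :: int
  assumes Z: "Z > 0"
  shows "(\<Sum>a\<in>{0..<Z}. e (of_int (a * d) / of_int Z)) = (if Z dvd d then of_int Z else 0)"
proof -
  define z where "z = e (of_int d / of_int Z)"
  have "(\<Sum>a\<in>{0..<Z}. e (of_int (a * d) / of_int Z)) = (\<Sum>n<nat Z. e (of_int (int n * d) / of_int Z))"
    using Z by (intro sum.reindex_bij_witness[of _ int nat]) auto
  also have "\<dots> = (\<Sum>n<nat Z. z ^ n)"
    by (intro sum.cong refl) (simp add: z_def flip: e_of_nat_mult)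
  also have "\<dots> = (if Z dvd d then of_int Z else 0)"
  proof (cases "Z dvd d")
    case True
    then have "z = 1" using Z by (auto simp: z_def)
    then show ?thesis using True Z by simp
  next
    case False
    have "z \<noteq> 1"
    proof
      assume "z = 1"
      then obtain k :: int where "real_of_int d / of_int Z = of_int k"
        by (auto simp: z_def e_eq_1_iff elim: Ints_cases)
      then have "real_of_int d = of_int (Z * k)" using Z by (simp add: field_simps)
      then have "d = Z * k" by (simp only: of_int_eq_iff)
      then show False using False by simp
    qed
    moreover have "z ^ nat Z = 1"
      using Z by (simp add: z_def flip: e_of_nat_mult)
    ultimately show ?thesis using False by (simp add: geometric_sum)
  qed
  finally show ?thesis .
qed

lemma sum_e_rbox:
  assumes Z: "Z > 0"
  shows "(\<Sum>a\<in>rbox l Z. e (of_int (\<Sum>j=1..l. a j * d j) / of_int Z)) =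
    (if \<forall>j\<in>{1..l}. Z dvd d j then of_int Z ^ l else 0)"
proof -
  have "(\<Sum>a\<in>rbox l Z. e (of_int (\<Sum>j=1..l. a j * d j) / of_int Z)) =
      (\<Sum>a\<in>rbox l Z. \<Prod>j=1..l. e (of_int (a j * d j) / of_int Z))"
    by (simp add: sum_divide_distrib flip: e_sum)
  also have "\<dots> = (\<Prod>j=1..l. \<Sum>a\<in>{0..<Z}. e (of_int (a * d j) / of_int Z))"
    unfolding rbox_def by (rule prod_sum_PiE[symmetric]) auto
  also have "\<dots> = (\<Prod>j=1..l. if Z dvd d j then of_int Z else 0)"
    by (intro prod.cong refl sum_e_residues Z)
  also have "\<dots> = (if \<forall>j\<in>{1..l}. Z dvd d j then of_int Z ^ l else 0)"
    by (auto simp: prod_zero_iff)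
  finally show ?thesis .
qed

lemma cmod_sum_sq:
  "complex_of_real (cmod (\<Sum>i\<in>I. f i) ^ 2) = (\<Sum>i\<in>I. \<Sum>i'\<in>I. f i * cnj (f i'))"
  by (simp only: complex_norm_square cnj_sum sum_product)

lemma parseval_rbox:
  fixes \<phi> :: "'i \<Rightarrow> nat \<Rightarrow> int" and c :: "'i \<Rightarrow> complex"
  assumes Z: "Z > 0" and I: "finite I"
  shows "complex_of_real (avg (rbox l Z) (\<lambda>a. cmod (\<Sum>i\<in>I. c i * e (of_int (\<Sum>j=1..l. a j * \<phi> i j) / of_int Z)) ^ 2)) =
    (\<Sum>i\<in>I. \<Sum>i'\<in>I. if \<forall>j\<in>{1..l}. Z dvd \<phi> i j - \<phi> i' j then c i * cnj (c i') else 0)"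
proof -
  define E where "E i a = e (of_int (\<Sum>j=1..l. a j * \<phi> i j) / of_int Z)" for i a
  have EE: "E i a * cnj (E i' a) = e (of_int (\<Sum>j=1..l. a j * (\<phi> i j - \<phi> i' j)) / of_int Z)" for i i' a
    unfolding E_def e_uminus[symmetric] e_add[symmetric]
    by (simp add: right_diff_distrib sum_subtractf diff_divide_distrib)
  have "complex_of_real (\<Sum>a\<in>rbox l Z. cmod (\<Sum>i\<in>I. c i * E i a) ^ 2) =
      (\<Sum>a\<in>rbox l Z. \<Sum>i\<in>I. \<Sum>i'\<in>I. (c i * E i a) * cnj (c i' * E i' a))"
    by (simp only: of_real_sum cmod_sum_sq)
  also have "\<dots> = (\<Sum>i\<in>I. \<Sum>i'\<in>I. \<Sum>a\<in>rbox l Z. (c i * E i a) * cnj (c i' * E i' a))"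
    by (subst sum.swap, intro sum.cong refl, subst sum.swap, rule refl)
  also have "\<dots> = (\<Sum>i\<in>I. \<Sum>i'\<in>I. c i * cnj (c i') * (\<Sum>a\<in>rbox l Z. E i a * cnj (E i' a)))"
    by (intro sum.cong refl) (simp add: sum_distrib_left mult_ac)
  also have "\<dots> = (\<Sum>i\<in>I. \<Sum>i'\<in>I. of_int Z ^ l * (if \<forall>j\<in>{1..l}. Z dvd \<phi> i j - \<phi> i' j then c i * cnj (c i') else 0))"
    unfolding EE sum_e_rbox[OF Z] by (intro sum.cong refl) auto
  also have "\<dots> = of_int Z ^ l * (\<Sum>i\<in>I. \<Sum>i'\<in>I. if \<forall>j\<in>{1..l}. Z dvd \<phi> i j - \<phi> i' j then c i * cnj (c i') else 0)"
    by (simp only: sum_distrib_left)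
  finally have "complex_of_real (\<Sum>a\<in>rbox l Z. cmod (\<Sum>i\<in>I. c i * E i a) ^ 2) = \<dots>" .
  then show ?thesis unfolding avg_def card_rbox[OF Z] E_def using Z by (simp add: field_simps)
qed

text \<open>In degree one the frequency sees only \<open>n\<close> modulo \<open>p ^ N\<close>, so
  different classes are orthogonal.\<close>

lemma Dec_1:
  fixes p :: int
  assumes p: "p > 0"
  shows "Dec p 1 N 1"
  unfolding Dec_def
proof (intro allI impI)
  fix c and A :: "int set"
  assume A: "finite A"
  define Z where "Z = p ^ (1 * N)"
  have Z: "Z > 0" using p by (simp add: Z_def)
  have tri1: "tri 1 = 1" by (simp add: tri_def)
  have mom: "complex_of_real (moment Z 0 1 1 c B) = (\<Sum>i\<in>B. \<Sum>i'\<in>B. if Z dvd i - i' then c i * cnj (c i') else 0)"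
    if "finite B" for B
    using parseval_rbox[OF Z that, of 1 c "\<lambda>i j. i ^ j"] by (simp add: moment_def expsum_def cform_def)
  have "complex_of_real (\<Sum>J\<in>res_parts Z A. moment Z 0 1 1 c J) = (\<Sum>J\<in>res_parts Z A. \<Sum>i\<in>J. \<Sum>i'\<in>A. if Z dvd i - i' then c i * cnj (c i') else 0)"
    unfolding of_real_sum
  proof (intro sum.cong refl)
    fix J assume J: "J \<in> res_parts Z A"
    have "(\<Sum>i'\<in>J. if Z dvd i - i' then c i * cnj (c i') else 0) = (\<Sum>i'\<in>A. if Z dvd i - i' then c i * cnj (c i') else 0)"
      if i: "i \<in> J" for i
      using res_parts_eq[OF J i] A by (intro sum.mono_neutral_left) (auto simp: dvd_diff_commute)
    then show "complex_of_real (moment Z 0 1 1 c J) = (\<Sum>i\<in>J. \<Sum>i'\<in>A. if Z dvd i - i' then c i * cnj (c i') else 0)"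
      unfolding mom[OF res_parts_finite[OF A J]] by (rule sum.cong[OF refl])
  qed
  also have "\<dots> = complex_of_real (moment Z 0 1 1 c A)"
    unfolding mom[OF A] by (rule sum_res_parts[OF A])
  finally have "(\<Sum>J\<in>res_parts Z A. moment Z 0 1 1 c J) = moment Z 0 1 1 c A"
    by (simp only: of_real_eq_iff)
  then show "decoup (p ^ (1 * N)) 0 1 (p ^ N) 1 c A"
    unfolding decoup_def sqfun_def tri1 by (simp add: Z_def)
qed

subsection \<open>Iteration\<close>

text \<open>Since \<open>tri 0 = 0\<close>, only the sum over \<open>A'\<close> is left, and inside
  a class modulo \<open>p ^ b\<close> the scale drops from \<open>N\<close> to \<open>N - b\<close>.
  This is the source of the gain in the iteration.\<close>

lemma Bil_zero:
  fixes p :: int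
  assumes p: "prime p" "int k < p" and k: "k \<ge> 1" and b: "b \<le> N"
    and D: "Dec p k (N - b) K" and K: "K \<ge> 0"
  shows "Bil p k N 0 a b K"
proof (rule BilI)
  fix c and A A' :: "int set" and \<xi> \<xi>' :: int
  assume h: "finite A'" "\<And>n. n \<in> A' \<Longrightarrow> p ^ b dvd n - \<xi>'"
  have "decoup (p ^ (k * N)) 0 k (p ^ N) K c A'"
    using p k b D K h by (intro decoup_class[where ?x0.0 = \<xi>' and ?c1.0 = b]) auto
  then show "bmoment (p ^ (k * N)) k (tri 0) (tri k - tri 0) c A A' \<le>
       K * (sqfun (p ^ (k * N)) 0 k (tri k) (p ^ N) c A ^ tri 0 *
            sqfun (p ^ (k * N)) 0 k (tri k) (p ^ N) c A' ^ (tri k - tri 0))"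
    unfolding decoup_def bmoment_def moment_def by (simp add: tri_def)
qed

text \<open>In the limit of many iterations the gain \<open>n l (k - l) / k\<^sup>2\<close> in front of \<open>b\<close> is unbounded. The
  vector \<open>l (k - l)\<close> is the fixed vector of the recursion
  \<open>x\<^sub>l = (k - l) / (k - l + 1) x\<^sub>l\<^sub>-\<^sub>1 + x\<^sub>k\<^sub>-\<^sub>l / l\<close>, in which the boundary term \<open>x\<^sub>0 = 1\<close> provides the growth.\<close>

lemma Bil_iterate:
  fixes p :: int
  assumes p: "prime p" "int k < p" and k: "k \<ge> 2" and lam: "lam \<ge> 0"
    and HD: "\<And>\<epsilon>. \<epsilon> > 0 \<Longrightarrow> Dec_eps p k (lam + \<epsilon>)"
    and HT: "\<And>l \<epsilon>. 1 \<le> l \<Longrightarrow> l < k \<Longrightarrow> \<epsilon> > 0 \<Longrightarrow> Dec_eps p l \<epsilon>"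
    and l: "1 \<le> l" "l < k" and \<epsilon>: "\<epsilon> > 0"
  shows "\<exists>C\<ge>1. \<forall>N b. 1 \<le> b \<longrightarrow> fact k ^ n dvd b \<longrightarrow> k ^ n * b \<le> N \<longrightarrow>
     Bil p k N l 1 b (C * of_int p powr (lam * real N - lam * (real n / real k ^ 2) * (real l * real (k - l)) * real b + \<epsilon> * real N))"
  using l \<epsilon>
proof (induction n arbitrary: l \<epsilon>)
  case 0
  obtain C where C: "C \<ge> 1" "\<And>N. Dec p k N (C * of_int p powr ((lam + \<epsilon>) * real N))"
    using HD[OF 0(3)] unfolding Dec_eps_def by auto
  have "Bil p k N l 1 b (C * of_int p powr ((lam + \<epsilon>) * real N))" for N b
    using 0 C by (intro Bil_trivial) auto
  then show ?case using C by (intro exI[of _ C]) (auto simp: distrib_right)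
next
  case (Suc n)
  note stage = Suc.IH
  have pp: "p > 1" using p by (simp add: prime_gt_1_int)
  then have rp: "real_of_int p > 1" by simp
  \<comment> \<open>The current multiple \<open>n / k\<^sup>2\<close> of the fixed vector, plus
    \<open>(k - l) / k\<close>. The second summand solves
    \<open>x\<^sub>l = (k - l) / (k - l + 1) x\<^sub>l\<^sub>-\<^sub>1\<close> with
    \<open>x\<^sub>0 = 1\<close>; in particular \<open>y 0 = 1\<close>, the gain at
    \<open>l = 0\<close>.\<close>
  define y where "y l = real n / real k ^ 2 * (real l * real (k - l)) + real (k - l) / real k" for l
  have inner: "\<exists>C\<ge>1. \<forall>N b. 1 \<le> b \<longrightarrow> fact k ^ Suc n dvd b \<longrightarrow> k ^ Suc n * b \<le> N \<longrightarrow>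
     Bil p k N l 1 b (C * of_int p powr (lam * real N - lam * y l * real b + \<epsilon> * real N))"
    if "l < k" "\<epsilon> > 0" for l \<epsilon>
    using that
  proof (induction l arbitrary: \<epsilon>)
    case 0
    obtain C where C: "C \<ge> 1" "\<And>N. Dec p k N (C * of_int p powr ((lam + \<epsilon>) * real N))"
      using HD[OF 0(2)] unfolding Dec_eps_def by auto
    have "Bil p k N 0 1 b (C * of_int p powr (lam * real N - lam * y 0 * real b + \<epsilon> * real N))"
      if b: "k ^ Suc n * b \<le> N" for N b
    proof -
      have "1 * b \<le> k ^ Suc n * b" using k by (intro mult_right_mono one_le_power) auto
      then have bN: "b \<le> N" using b by linarith
      then have "Bil p k N 0 1 b (C * of_int p powr ((lam + \<epsilon>) * real (N - b)))"
        using p k C(1) by (intro Bil_zero C(2)) auto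
      moreover have "(lam + \<epsilon>) * real (N - b) \<le> lam * real N - lam * y 0 * real b + \<epsilon> * real N"
        using 0 bN k by (simp add: y_def of_nat_diff algebra_simps)
      then have "C * of_int p powr ((lam + \<epsilon>) * real (N - b)) \<le> C * of_int p powr (lam * real N - lam * y 0 * real b + \<epsilon> * real N)"
        using C rp by (intro mult_left_mono powr_mono) auto
      ultimately show ?thesis using Bil_mono by blast
    qed
    then show ?case using C by blast
  next
    case (Suc l0)
    define l where "l = Suc l0"
    have l: "1 \<le> l" "l < k" "l - 1 = l0" using Suc.prems by (auto simp: l_def)
    define \<delta> where "\<delta> = \<epsilon> / 3"
    have \<delta>: "\<delta> > 0" using Suc.prems by (simp add: \<delta>_def)
    obtain C1 where C1: "C1 \<ge> 1" "\<And>N b. 1 \<le> b \<Longrightarrow> fact k ^ Suc n dvd b \<Longrightarrow> k ^ Suc n * b \<le> N \<Longrightarrow>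
     Bil p k N l0 1 b (C1 * of_int p powr (lam * real N - lam * y l0 * real b + \<delta> * real N))"
      using Suc.IH[of \<delta>] Suc.prems(1) \<delta> by auto
    have kl: "1 \<le> k - l" "k - l < k" using l by auto
    obtain C2 where C2: "C2 \<ge> 1" "\<And>N b. 1 \<le> b \<Longrightarrow> fact k ^ n dvd b \<Longrightarrow> k ^ n * b \<le> N \<Longrightarrow>
     Bil p k N (k - l) 1 b (C2 * of_int p powr (lam * real N - lam * (real n / real k ^ 2) * (real (k - l) * real (k - (k - l))) * real b + \<delta> * real N))"
      using stage[OF kl \<delta>] by blast
    have "int (k - l + l) < p" using l p by simp
    from decoup_unit_curve[OF p(1) this l(1) HT[OF l(1,2)] \<delta>]
    obtain C3 where C3: "C3 \<ge> 1" "\<And>c' T x0 c A. \<not> p dvd x0 \<Longrightarrow> finite A \<Longrightarrow> (\<forall>n\<in>A. p dvd n - x0) \<Longrightarrow> l * c' \<le> T \<Longrightarrow>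
     decoup (p ^ T) (k - l) l (p ^ c') (C3 * of_int p powr (\<delta> * real c')) c A"
      by blast
    have "Bil p k N l 1 b (C1 * C2 * C3 * of_int p powr (lam * real N - lam * y l * real b + \<epsilon> * real N))"
      if b: "1 \<le> b" "fact k ^ Suc n dvd b" "k ^ Suc n * b \<le> N" for N b
    proof -
      obtain b' where b': "b = fact k ^ Suc n * b'" using b(2) by auto
      have lf: "l dvd fact k" using l by (intro dvd_fact) auto
      \<comment> \<open>This is \<open>(k - l + 1) * b / l\<close>. One factor \<open>fact k\<close>
        of \<open>b\<close> is used up to make the quotient integral, hence the growing divisibility
        requirement; \<open>a \<le> k * b\<close> explains the growing lower bound for
        \<open>N\<close>.\<close>
      define a where "a = (k - l + 1) * (fact k div l) * fact k ^ n * b'"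
      have la: "l * a = (k - l + 1) * b"
      proof -
        have "l * a = (k - l + 1) * (l * (fact k div l)) * fact k ^ n * b'" unfolding a_def by (simp only: mult_ac)
        also have "l * (fact k div l) = fact k" using lf by simp
        finally show ?thesis unfolding b' power_Suc by (simp only: mult_ac)
      qed
      have "l * a \<le> l * (k * b)"
      proof -
        have "(k - l + 1) * b \<le> k * b" using l by (intro mult_right_mono) auto
        also have "\<dots> \<le> l * (k * b)" using l by simp
        finally show ?thesis using la by simp
      qed
      then have ak: "a \<le> k * b" using l by simp
      have "a \<noteq> 0" using la b l by (intro notI) simp
      then have a1: "a \<ge> 1" by simp
      have afact: "fact k ^ n dvd a" unfolding a_def by simp
      have "k ^ n * a \<le> k ^ n * (k * b)" using ak by (rule mult_le_mono2)
      also have "\<dots> = k ^ Suc n * b" unfolding power_Suc by (simp only: mult_ac)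
      finally have kna: "k ^ n * a \<le> N" using b(3) by (rule order_trans)
      have "1 * b \<le> k ^ Suc n * b" using k by (intro mult_right_mono one_le_power) auto
      then have bN: "b \<le> N" using b by linarith
      have "1 * a \<le> k ^ n * a" using k by (intro mult_right_mono one_le_power) auto
      then have aN: "a \<le> N" using kna by linarith
      have ra: "real a = real (k - l + 1) * real b / real l"
        using arg_cong[OF la, of real] l by (simp add: field_simps)
      define x1 where "x1 = lam * real N - lam * y l0 * real b + \<delta> * real N"
      define x2 where "x2 = lam * real N - lam * (real n / real k ^ 2) * (real (k - l) * real (k - (k - l))) * real a + \<delta> * real N"
      have B1: "Bil p k N (l - 1) a b (C1 * of_int p powr x1)"
        using Bil_mono[OF C1(2)[OF b] a1 order_refl order_refl] unfolding x1_def l(3) .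
      have B2: "Bil p k N (k - l) b a (C2 * of_int p powr x2)"
        using Bil_mono[OF C2(2)[OF a1 afact kna] b(1) order_refl order_refl] unfolding x2_def .
      define x where "x = (real (k - l) * x1 + x2) / real (k - l + 1)"
      have B3: "Bil p k N l a b (C1 * C2 * of_int p powr x)"
        unfolding x_def using l C1 C2 pp by (intro Bil_Hoelder B1 B2) auto
      have "Bil p k N l 1 b ((C3 * of_int p powr (\<delta> * real a)) * (C1 * C2 * of_int p powr x))"
        using p l b bN aN la C1 C2 C3 by (intro Bil_lower_degree[OF _ _ _ _ _ _ _ _ _ _ B3]) auto
      moreover have "(C3 * of_int p powr (\<delta> * real a)) * (C1 * C2 * of_int p powr x) \<le> C1 * C2 * C3 * of_int p powr (lam * real N - lam * y l * real b + \<epsilon> * real N)"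
      proof -
        have kl: "k - (k - l) = l" "real (k - l + 1) = real (k - l) + 1" "real (k - l0) = real (k - l) + 1" "real l0 = real l - 1"
          using l by auto
        have "x = lam * real N + \<delta> * real N - lam * y l * real b"
        proof -
          have kp: "real k > 0" "real (k - l) + 1 > 0" "real l > 0" using l by auto
          have "real (k - l) * x1 + x2 = (real (k - l) + 1) * (lam * real N + \<delta> * real N - lam * y l * real b)"
            unfolding x1_def x2_def ra y_def kl using kp by (simp add: field_simps)
          then show ?thesis unfolding x_def kl using kp by simp
        qed
        moreover have "\<delta> * real a \<le> \<delta> * real N" using aN \<delta> by simp
        moreover have "\<epsilon> * real N = \<delta> * real N + \<delta> * real N + \<delta> * real N" by (simp add: \<delta>_def)
        moreover have "0 \<le> \<delta> * real N" using \<delta> by simp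
        ultimately have "\<delta> * real a + x \<le> lam * real N - lam * y l * real b + \<epsilon> * real N" by linarith
        then have "of_int p powr (\<delta> * real a + x) \<le> of_int p powr (lam * real N - lam * y l * real b + \<epsilon> * real N)"
          using rp by (intro powr_mono) auto
        then have "C1 * C2 * C3 * of_int p powr (\<delta> * real a + x) \<le> C1 * C2 * C3 * of_int p powr (lam * real N - lam * y l * real b + \<epsilon> * real N)"
          using C1 C2 C3 by (intro mult_left_mono) auto
        then show ?thesis by (simp add: powr_add mult_ac)
      qed
      ultimately show ?thesis using Bil_mono by blast
    qed
    moreover have "C1 * C2 * C3 \<ge> 1"
    proof -
      have "1 * 1 \<le> C1 * C2" using C1 C2 by (intro mult_mono) auto
      then have "1 * 1 \<le> (C1 * C2) * C3" using C3 by (intro mult_mono) auto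
      then show ?thesis by simp
    qed
    ultimately show ?case unfolding l_def by blast
  qed
  obtain C where C: "C \<ge> 1" "\<And>N b. 1 \<le> b \<Longrightarrow> fact k ^ Suc n dvd b \<Longrightarrow> k ^ Suc n * b \<le> N \<Longrightarrow>
     Bil p k N l 1 b (C * of_int p powr (lam * real N - lam * y l * real b + \<epsilon> * real N))"
    using inner[OF Suc.prems(2,3)] by auto
  \<comment> \<open>Only the fraction \<open>l / k\<close> of the new gain
    \<open>(k - l) / k\<close> is kept; the result is again a multiple of the fixed vector, with
    \<open>n\<close> raised by one.\<close>
  have yl: "real (Suc n) / real k ^ 2 * (real l * real (k - l)) \<le> y l"
  proof -
    have kp: "real k > 0" using Suc.prems by auto
    have "real l * real (k - l) \<le> real k * real (k - l)" using Suc.prems by (intro mult_right_mono) auto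
    then have "real l * real (k - l) / real k ^ 2 \<le> real (k - l) / real k"
      using kp by (simp add: field_simps power2_eq_square)
    then show ?thesis unfolding y_def by (simp add: add_divide_distrib distrib_right algebra_simps)
  qed
  have "C * of_int p powr (lam * real N - lam * y l * real b + \<epsilon> * real N) \<le>
     C * of_int p powr (lam * real N - lam * (real (Suc n) / real k ^ 2) * (real l * real (k - l)) * real b + \<epsilon> * real N)" for N b
  proof -
    have "lam * ((real (Suc n) / real k ^ 2) * (real l * real (k - l))) * real b \<le> lam * y l * real b"
      using yl lam by (intro mult_right_mono mult_left_mono) auto
    then have "of_int p powr (lam * real N - lam * y l * real b + \<epsilon> * real N) \<le> of_int p powr (lam * real N - lam * (real (Suc n) / real k ^ 2) * (real l * real (k - l)) * real b + \<epsilon> * real N)"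
      using rp by (intro powr_mono) (auto simp: mult_ac)
    then show ?thesis using C by (intro mult_left_mono) auto
  qed
  then show ?case using C Bil_mono[OF C(2) order_refl order_refl] by blast
qed

section \<open>The decoupling exponent is zero\<close>

lemma Dec_eps_mono:
  assumes "Dec_eps p l \<mu>" "\<mu> \<le> \<mu>'" "p > 1"
  shows "Dec_eps p l \<mu>'"
proof -
  obtain C where C: "C \<ge> 1" "\<And>N. Dec p l N (C * of_int p powr (\<mu> * real N))"
    using assms(1) unfolding Dec_eps_def by blast
  have "Dec p l N (C * of_int p powr (\<mu>' * real N))" for N
    using C(1) assms(2,3) by (intro Dec_mono[OF C(2)] mult_left_mono powr_mono mult_right_mono) auto
  then show ?thesis unfolding Dec_eps_def using C(1) by blast
qed

text \<open>For \<open>lam > 0\<close> the gain per unit of \<open>b\<close> eventually exceeds the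
  cost of \<open>Bil_split\<close>. With \<open>b\<close> a fixed proportion of \<open>N\<close>
  this lowers the bilinear exponent at separation scale 1, and \<open>Dec_recursion\<close> passes
  the improvement on to the linear constant.\<close>

lemma Dec_eps_improve:
  fixes p :: int
  assumes p: "prime p" "int k < p" and k: "k \<ge> 2" and lam: "lam > 0"
    and HD: "\<And>\<epsilon>. \<epsilon> > 0 \<Longrightarrow> Dec_eps p k (lam + \<epsilon>)"
    and HT: "\<And>l \<epsilon>. 1 \<le> l \<Longrightarrow> l < k \<Longrightarrow> \<epsilon> > 0 \<Longrightarrow> Dec_eps p l \<epsilon>"
  shows "\<exists>\<mu>\<ge>0. \<mu> < lam \<and> Dec_eps p k \<mu>"
proof -
  have pp: "p > 1" using p by (simp add: prime_gt_1_int)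
  then have rp: "real_of_int p > 1" by simp
  define P where "P = 2 * tri k"
  have P: "P \<ge> 1" using tri_ge_1[of k] k by (simp add: P_def)
  \<comment> \<open>Enough stages for a gain of \<open>P + 1\<close> per unit of \<open>b\<close>:
    \<open>P\<close> for the splitting and 1 as profit.\<close>
  obtain n :: nat where n: "(real P + 1) * real k ^ 2 / (lam * real (k - 1)) \<le> real n"
    using real_arch_simple by blast
  have gain: "lam * (real n / real k ^ 2) * (real 1 * real (k - 1)) \<ge> real P + 1"
  proof -
    have "lam * real (k - 1) > 0" "real k ^ 2 > 0" using lam k by auto
    then show ?thesis using n by (simp add: field_simps)
  qed
  \<comment> \<open>The admissible \<open>b\<close> is about \<open>N / k ^ n\<close>, up to the
    rounding error \<open>L\<close>. Half of this profit pays for the loss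
    \<open>\<kappa> * N\<close> of the iteration, the other half lowers \<open>lam\<close>.\<close>
  define \<kappa> where "\<kappa> = 1 / (2 * real k ^ n)"
  define L :: nat where "L = fact k ^ n"
  define N0 where "N0 = k ^ n * L"
  have \<kappa>: "\<kappa> > 0" using k by (simp add: \<kappa>_def)
  have L1: "L \<ge> 1" unfolding L_def by simp
  obtain C where C: "C \<ge> 1" "\<And>N b. 1 \<le> b \<Longrightarrow> fact k ^ n dvd b \<Longrightarrow> k ^ n * b \<le> N \<Longrightarrow>
     Bil p k N 1 1 b (C * of_int p powr (lam * real N - lam * (real n / real k ^ 2) * (real 1 * real (k - 1)) * real b + \<kappa> * real N))"
    using Bil_iterate[OF p k less_imp_le[OF lam] HD HT, where l = 1 and \<epsilon> = \<kappa> and n = n] k \<kappa> by auto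
  have B: "Bil p k N 1 1 1 (C * of_int p powr (real L) * of_int p powr ((lam - \<kappa>) * real N))" if N: "N \<ge> N0" for N
  proof -
    define b where "b = L * (N div N0)"
    have kn: "k ^ n \<ge> 1" using k by (intro one_le_power) auto
    have N0: "N0 \<ge> 1" unfolding N0_def using mult_le_mono[OF kn L1] by simp
    have "N div N0 \<ge> 1" using N N0 by (simp add: Suc_le_eq div_greater_zero_iff)
    then have b1: "b \<ge> 1" unfolding b_def using mult_le_mono[OF L1, of 1] by simp
    have bd: "fact k ^ n dvd b" by (simp add: b_def L_def)
    have "N0 * (N div N0) \<le> N" by (rule times_div_less_eq_dividend)
    then have kb: "k ^ n * b \<le> N" by (simp add: b_def N0_def mult_ac)
    then have bN: "b \<le> N" using mult_le_mono1[OF kn, of b] by linarith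
    have "N < N0 * (N div N0) + N0" using N0 mult_div_mod_eq[of N0 N] mod_less_divisor[of N0 N] by linarith
    then have "real N < real (k ^ n * (b + L))" by (simp only: of_nat_less_iff) (simp add: b_def N0_def algebra_simps)
    then have "real N < real k ^ n * (real b + real L)" by simp
    then have bb: "2 * \<kappa> * real N \<le> real b + real L"
      using k by (simp add: \<kappa>_def field_simps)
    have "Bil p k N 1 1 1 (of_int (p ^ b) ^ (2 * tri k) * (C * of_int p powr (lam * real N - lam * (real n / real k ^ 2) * (real 1 * real (k - 1)) * real b + \<kappa> * real N)))"
      using p k b1 bN C(1) by (intro Bil_split C(2)[OF b1 bd kb]) auto
    moreover have "of_int (p ^ b) ^ (2 * tri k) * (C * of_int p powr (lam * real N - lam * (real n / real k ^ 2) * (real 1 * real (k - 1)) * real b + \<kappa> * real N))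
      \<le> C * of_int p powr (real L) * of_int p powr ((lam - \<kappa>) * real N)"
    proof -
      have "of_int (p ^ b) ^ (2 * tri k) = of_int p powr (real P * real b)"
        using rp by (simp add: P_def powr_realpow[symmetric] powr_powr mult_ac)
      then have "of_int (p ^ b) ^ (2 * tri k) * (C * of_int p powr (lam * real N - lam * (real n / real k ^ 2) * (real 1 * real (k - 1)) * real b + \<kappa> * real N))
        = C * of_int p powr (real P * real b + (lam * real N - lam * (real n / real k ^ 2) * (real 1 * real (k - 1)) * real b + \<kappa> * real N))"
        by (simp only: powr_add mult_ac)
      also have "\<dots> \<le> C * of_int p powr (real L + (lam - \<kappa>) * real N)"
      proof (intro mult_left_mono powr_mono)
        have "(real P + 1) * real b \<le> lam * (real n / real k ^ 2) * (real 1 * real (k - 1)) * real b"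
          by (rule mult_right_mono[OF gain]) simp
        then show "real P * real b + (lam * real N - lam * (real n / real k ^ 2) * (real 1 * real (k - 1)) * real b + \<kappa> * real N) \<le> real L + (lam - \<kappa>) * real N"
          using bb unfolding distrib_right left_diff_distrib mult_1 by linarith
      qed (use C rp in auto)
      finally show ?thesis by (simp add: powr_add mult_ac)
    qed
    ultimately show ?thesis by (rule Bil_mono[OF _ order_refl order_refl])
  qed
  define \<mu> where "\<mu> = lam - min \<kappa> (lam / 2)"
  have \<mu>: "\<mu> > 0" "\<mu> < lam" "lam - \<kappa> \<le> \<mu>" using \<kappa> lam by (auto simp: \<mu>_def min_def)
  define \<tau> where "\<tau> = real_of_int p powr \<mu>"
  have \<tau>: "\<tau> > 1" unfolding \<tau>_def using rp \<mu> by simp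
  \<comment> \<open>With \<open>(1 + \<eta>) ^ P = \<rho>\<close> strictly below
    \<open>\<tau>\<close>, the narrow term leaves the proportion \<open>\<tau> - \<rho>\<close> of
    each step free for the broad term.\<close>
  define \<rho> where "\<rho> = (1 + \<tau>) / 2"
  have \<rho>: "\<rho> > 1" "\<rho> < \<tau>" using \<tau> by (auto simp: \<rho>_def)
  define \<eta> where "\<eta> = \<rho> powr (1 / real P) - 1"
  have \<eta>: "\<eta> > 0" unfolding \<eta>_def using \<rho> P by simp
  have \<eta>P: "(1 + \<eta>) ^ P = \<rho>" unfolding \<eta>_def using P \<rho> by (simp add: powr_inverse_power)
  define C4 where "C4 = (of_int p * (1 + 1 / \<eta>)) ^ P * (of_int p ^ 2 * (C * of_int p powr real L))"
  have C4: "C4 \<ge> 0" unfolding C4_def using rp \<eta> C by (intro mult_nonneg_nonneg zero_le_power add_nonneg_nonneg) auto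
  \<comment> \<open>The first summand covers the scales below \<open>N0\<close> by the trivial
    bound; the second satisfies the inequality needed to absorb the broad term in the
    induction.\<close>
  define C2 where "C2 = of_int p powr (real (tri k) * real N0) + C4 * \<tau> / (\<tau> - \<rho>)"
  have C2a: "C4 * \<tau> / (\<tau> - \<rho>) \<ge> 0" using C4 \<tau> \<rho> by simp
  have "of_int p powr (real (tri k) * real N0) \<ge> 1" using rp by (intro ge_one_powr_ge_zero) auto
  then have C2: "C2 \<ge> 1" using C2a by (simp add: C2_def)
  have "Dec p k N (C2 * \<tau> ^ N)" for N
  proof (induction N)
    case 0
    have "Dec p k 0 (of_int p powr (real (tri k) * real 0))" using pp k by (intro Dec_trivial) auto
    then show ?case by (rule Dec_mono) (use C2 pp in simp)
  next
    case (Suc N)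
    show ?case
    proof (cases "Suc N \<ge> N0")
      case False
      have "Dec p k (Suc N) (of_int p powr (real (tri k) * real (Suc N)))" using pp k by (intro Dec_trivial) auto
      moreover have "of_int p powr (real (tri k) * real (Suc N)) \<le> C2 * \<tau> ^ Suc N"
      proof -
        have "of_int p powr (real (tri k) * real (Suc N)) \<le> of_int p powr (real (tri k) * real N0)"
          using False rp by (intro powr_mono mult_left_mono) auto
        also have "\<dots> \<le> C2" using C2a by (simp add: C2_def)
        also have "\<dots> \<le> C2 * \<tau> ^ Suc N" using C2 one_le_power[of \<tau> "Suc N"] \<tau> by (simp del: power_Suc)
        finally show ?thesis .
      qed
      ultimately show ?thesis by (rule Dec_mono)
    next
      case True
      define K1 where "K1 = C * of_int p powr (real L) * of_int p powr ((lam - \<kappa>) * real (Suc N))"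
      have "Dec p k (Suc N - 1) (C2 * \<tau> ^ N)" using Suc.IH by simp
      moreover have "K1 \<ge> 0" "C2 * \<tau> ^ N \<ge> 0" using C C2 \<tau> by (auto simp: K1_def)
      ultimately have "Dec p k (Suc N) ((1 + \<eta>) ^ (2 * tri k) * (C2 * \<tau> ^ N) + (of_int p * (1 + 1 / \<eta>)) ^ (2 * tri k) * (of_int p ^ 2 * K1))"
        using p k \<eta> B[OF True, folded K1_def] by (intro Dec_recursion) auto
      moreover have "(1 + \<eta>) ^ (2 * tri k) * (C2 * \<tau> ^ N) + (of_int p * (1 + 1 / \<eta>)) ^ (2 * tri k) * (of_int p ^ 2 * K1) \<le> C2 * \<tau> ^ Suc N"
      proof -
        have pN: "of_int p powr ((lam - \<kappa>) * real (Suc N)) \<le> \<tau> ^ Suc N"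
        proof -
          have "of_int p powr ((lam - \<kappa>) * real (Suc N)) \<le> of_int p powr (\<mu> * real (Suc N))"
            using \<mu> rp by (intro powr_mono mult_right_mono) auto
          also have "\<dots> = \<tau> ^ Suc N" unfolding \<tau>_def using rp by (simp add: powr_powr[symmetric] powr_realpow del: power_Suc of_nat_Suc)
          finally show ?thesis .
        qed
        have "(of_int p * (1 + 1 / \<eta>)) ^ P * (of_int p ^ 2 * K1) = C4 * of_int p powr ((lam - \<kappa>) * real (Suc N))"
          unfolding C4_def K1_def by (simp only: mult_ac)
        also have "\<dots> \<le> C4 * \<tau> ^ Suc N" using pN C4 by (rule mult_left_mono)
        also have "\<dots> = (C4 * \<tau> / (\<tau> - \<rho>)) * ((\<tau> - \<rho>) * \<tau> ^ N)" using \<rho> by (simp add: field_simps)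
        also have "\<dots> \<le> C2 * ((\<tau> - \<rho>) * \<tau> ^ N)"
          using \<rho> \<tau> by (intro mult_right_mono) (auto simp: C2_def)
        finally have "(1 + \<eta>) ^ P * (C2 * \<tau> ^ N) + (of_int p * (1 + 1 / \<eta>)) ^ P * (of_int p ^ 2 * K1) \<le> \<rho> * (C2 * \<tau> ^ N) + C2 * ((\<tau> - \<rho>) * \<tau> ^ N)"
          unfolding \<eta>P by simp
        also have "\<dots> = C2 * \<tau> ^ Suc N" by (simp add: algebra_simps)
        finally show ?thesis unfolding P_def .
      qed
      ultimately show ?thesis by (rule Dec_mono)
    qed
  qed
  moreover have "\<tau> ^ N = of_int p powr (\<mu> * real N)" for N
    unfolding \<tau>_def using rp by (simp add: powr_powr[symmetric] powr_realpow)
  ultimately have "Dec_eps p k \<mu>" unfolding Dec_eps_def using C2 by auto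
  then show ?thesis using \<mu> by (intro exI[of _ \<mu>]) auto
qed

text \<open>The infimum of the admissible nonnegative exponents cannot be positive, since it could
  then be improved using the lower degrees supplied by the induction.\<close>

theorem moment_curve_decoupling:
  fixes p :: int
  assumes "prime p" "int k < p" "k \<ge> 1" "\<epsilon> > 0"
  shows "Dec_eps p k \<epsilon>"
  using assms(2-4)
proof (induction k arbitrary: \<epsilon> rule: less_induct)
  case (less k)
  have pp: "p > 1" using assms(1) by (simp add: prime_gt_1_int)
  show ?case
  proof (cases "k = 1")
    case True
    have "Dec p 1 N (1 * of_int p powr (\<epsilon> * real N))" for N
    proof (rule Dec_mono[OF Dec_1])
      show "1 \<le> 1 * of_int p powr (\<epsilon> * real N)"
        using pp less.prems by (simp add: ge_one_powr_ge_zero)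
    qed (use pp in simp)
    then show ?thesis unfolding True Dec_eps_def by blast
  next
    case False
    then have k: "k \<ge> 2" using less.prems by simp
    define M where "M = {\<mu>. \<mu> \<ge> 0 \<and> Dec_eps p k \<mu>}"
    define lam where "lam = Inf M"
    have "Dec p k N (1 * of_int p powr (real (tri k) * real N))" for N
      using Dec_trivial[of p k N] pp k by simp
    then have "Dec_eps p k (real (tri k))" unfolding Dec_eps_def by blast
    then have "real (tri k) \<in> M" by (simp add: M_def)
    then have M: "M \<noteq> {}" by blast
    have bdd: "bdd_below M" unfolding M_def by (rule bdd_belowI[of _ 0]) auto
    have lam0: "lam \<ge> 0" unfolding lam_def using M by (intro cInf_greatest) (auto simp: M_def)
    have HD: "Dec_eps p k (lam + \<delta>)" if \<delta>: "\<delta> > 0" for \<delta>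
    proof -
      obtain \<mu> where "\<mu> \<in> M" "\<mu> < lam + \<delta>"
        using cInf_lessD[OF M, of "lam + \<delta>"] \<delta> unfolding lam_def by auto
      then show ?thesis using pp by (rule_tac Dec_eps_mono[of p k \<mu>]) (auto simp: M_def)
    qed
    have "lam = 0"
    proof (rule ccontr)
      assume "lam \<noteq> 0"
      then have "lam > 0" using lam0 by simp
      moreover have "Dec_eps p l \<delta>" if "1 \<le> l" "l < k" "\<delta> > 0" for l \<delta>
        using that less.prems by (intro less.IH) auto
      ultimately obtain \<mu> where "\<mu> \<ge> 0" "\<mu> < lam" "Dec_eps p k \<mu>"
        using Dec_eps_improve[OF assms(1) less.prems(1) k _ HD] by blast
      then show False using cInf_lower[OF _ bdd, of \<mu>] unfolding lam_def M_def by auto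
    qed
    then show ?thesis using HD[of \<epsilon>] less.prems by simp
  qed
qed

subsection \<open>Vinogradov's mean value theorem\<close>

definition power_sum :: "nat \<Rightarrow> nat \<Rightarrow> (nat \<Rightarrow> nat) \<Rightarrow> int" where
  "power_sum t j f = (\<Sum>i<t. int (f i) ^ j)"

definition tuples :: "nat \<Rightarrow> nat \<Rightarrow> (nat \<Rightarrow> nat) set" where
  "tuples t X = PiE {..<t} (\<lambda>_. {..<X})"

lemma finite_tuples [simp]: "finite (tuples t X)"
  unfolding tuples_def by (intro finite_PiE) auto

lemma sum_power_tuples:
  fixes g :: "nat \<Rightarrow> 'a :: comm_semiring_1"
  shows "(\<Sum>n<X. g n) ^ t = (\<Sum>f\<in>tuples t X. \<Prod>i<t. g (f i))"
proof -
  have "(\<Sum>n<X. g n) ^ t = (\<Prod>i<t. \<Sum>n<X. g n)" by simp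
  also have "\<dots> = (\<Sum>f\<in>tuples t X. \<Prod>i<t. g (f i))"
    unfolding tuples_def by (rule prod_sum_PiE) auto
  finally show ?thesis .
qed

text \<open>With \<open>p ^ N\<close> between \<open>X\<close> and \<open>p * X\<close> the classes
  modulo \<open>p ^ N\<close> of \<open>{0..<X}\<close> are singletons, each with moment 1, so
  decoupling bounds the full moment by \<open>X powr (tri l + \<epsilon>)\<close> up to a constant.
  By orthogonality this moment counts solutions of congruences, among which are the solutions of the
  equations.\<close>

theorem vinogradov_mean_value:
  assumes l: "l \<ge> 1" and \<epsilon>: "\<epsilon> > 0"
  shows "\<exists>C\<ge>1. \<forall>X\<ge>1. real (card {(f, g). f \<in> tuples (tri l) X \<and> g \<in> tuples (tri l) X \<and>
      (\<forall>j\<in>{1..l}. power_sum (tri l) j f = power_sum (tri l) j g)}) \<le> C * real X powr (real (tri l) + \<epsilon>)"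
proof -
  define t where "t = tri l"
  have t: "t \<ge> 1" using l tri_ge_1[of l] by (simp add: t_def)
  obtain p0 :: nat where p0: "prime p0" "p0 > l" using bigger_prime by blast
  define p where "p = int p0"
  have p: "prime p" "int l < p" using p0 by (auto simp: p_def)
  have pp: "p > 1" using p by (simp add: prime_gt_1_int)
  then have rp: "real_of_int p > 1" by simp
  obtain C where C: "C \<ge> 1" "\<And>N. Dec p l N (C * of_int p powr (\<epsilon> * real N))"
    using moment_curve_decoupling[OF p l \<epsilon>] unfolding Dec_eps_def by blast
  have main: "real (card {(f, g). f \<in> tuples t X \<and> g \<in> tuples t X \<and> (\<forall>j\<in>{1..l}. power_sum t j f = power_sum t j g)})
     \<le> C * of_int p powr (real t + \<epsilon>) * real X powr (real t + \<epsilon>)" if X: "X \<ge> 1" for X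
  proof -
    define N where "N = nat \<lceil>log (of_int p) (real X)\<rceil>"
    have logX: "log (of_int p) (real X) \<ge> 0" using rp X by simp
    have N1: "real N \<ge> log (of_int p) (real X)" "real N \<le> log (of_int p) (real X) + 1"
      using logX unfolding N_def by linarith+
    have "real X = of_int p powr (log (of_int p) (real X))" using rp X by simp
    also have "\<dots> \<le> of_int p powr real N" using rp N1 by (intro powr_mono) auto
    finally have XN: "real X \<le> of_int p ^ N" using rp by (simp add: powr_realpow)
    have "of_int p powr real N \<le> of_int p powr (log (of_int p) (real X) + 1)" using rp N1 by (intro powr_mono) auto
    also have "\<dots> = of_int p * real X" using rp X by (simp add: powr_add)
    finally have NX: "of_int p powr real N \<le> of_int p * real X" .
    have "real_of_int (int X) \<le> of_int (p ^ N)" using XN by simp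
    then have XN': "int X \<le> p ^ N" by (simp only: of_int_le_iff)
    define Z where "Z = p ^ (l * N)"
    have Z: "Z > 0" using pp by (simp add: Z_def)
    define A where "A = int ` {..<X}"
    define c :: "int \<Rightarrow> complex" where "c = (\<lambda>_. 1)"
    define T where "T = {(f, g). f \<in> tuples t X \<and> g \<in> tuples t X \<and> (\<forall>j\<in>{1..l}. power_sum t j f = power_sum t j g)}"
    have fA: "finite A" by (simp add: A_def)
    have upper: "moment Z 0 l t c A \<le> C * of_int p powr (\<epsilon> * real N) * (of_int p ^ N) ^ t"
    proof -
      have "moment Z 0 l t c J powr (1 / real t) = 1" if J: "J \<in> res_parts (p ^ N) A" for J
      proof -
        obtain x where x: "x \<in> J" using res_parts_nonempty[OF J] by blast
        have "y = x" if "y \<in> J" for y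
        proof -
          have "p ^ N dvd y - x" using res_parts_cong[OF J that x] .
          moreover have "x \<in> A" "y \<in> A" using x that res_parts_subset[OF J] by auto
          then have "\<bar>y - x\<bar> < p ^ N" using XN' by (auto simp: A_def)
          ultimately have "y - x = 0" using zdvd_imp_le[of "p ^ N" "\<bar>y - x\<bar>"] by (cases "y - x = 0") auto
          then show ?thesis by simp
        qed
        then have "J = {x}" using x by blast
        then show ?thesis using Z by (simp add: moment_def expsum_def c_def avg_const rbox_nonempty)
      qed
      then have "sqfun Z 0 l t (p ^ N) c A = real (card (res_parts (p ^ N) A))" by (simp add: sqfun_def)
      also have "\<dots> \<le> of_int p ^ N" using card_res_parts_real[of "p ^ N" A] pp fA by simp
      finally have "sqfun Z 0 l t (p ^ N) c A ^ t \<le> (of_int p ^ N) ^ t" by (intro power_mono) auto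
      then have "C * of_int p powr (\<epsilon> * real N) * sqfun Z 0 l t (p ^ N) c A ^ t \<le> C * of_int p powr (\<epsilon> * real N) * (of_int p ^ N) ^ t"
        using C by (intro mult_left_mono) auto
      moreover have "moment Z 0 l t c A \<le> C * of_int p powr (\<epsilon> * real N) * sqfun Z 0 l t (p ^ N) c A ^ t"
        using C(2)[of N] fA unfolding Dec_def decoup_def Z_def t_def by blast
      ultimately show ?thesis by linarith
    qed
    have "expsum Z 0 l c A a ^ t = (\<Sum>f\<in>tuples t X. 1 * e (of_int (\<Sum>j=1..l. a j * power_sum t j f) / of_int Z))" for a
    proof -
      have "expsum Z 0 l c A a = (\<Sum>n<X. e (of_int (cform 0 l a (int n)) / of_int Z))"
        unfolding expsum_def A_def c_def by (subst sum.reindex) (auto simp: inj_on_def)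
      then have "expsum Z 0 l c A a ^ t = (\<Sum>f\<in>tuples t X. e (\<Sum>i<t. of_int (cform 0 l a (int (f i))) / of_int Z))"
        by (simp only: sum_power_tuples e_sum)
      moreover have "(\<Sum>i<t. of_int (cform 0 l a (int (f i))) / of_int Z) = real_of_int (\<Sum>j=1..l. a j * power_sum t j f) / of_int Z" for f
      proof -
        have "(\<Sum>i<t. cform 0 l a (int (f i))) = (\<Sum>j=1..l. a j * power_sum t j f)"
          unfolding cform_def power_sum_def sum_distrib_left by (subst sum.swap) simp
        then show ?thesis by (simp only: sum_divide_distrib[symmetric] of_int_sum[symmetric])
      qed
      ultimately show ?thesis by simp
    qed
    note pw = this
    have "moment Z 0 l t c A = avg (rbox l Z) (\<lambda>a. cmod (\<Sum>f\<in>tuples t X. 1 * e (of_int (\<Sum>j=1..l. a j * power_sum t j f) / of_int Z)) ^ 2)"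
      unfolding moment_def pw[symmetric] norm_power power_mult[symmetric] by (simp only: mult.commute)
    then have "complex_of_real (moment Z 0 l t c A) = (\<Sum>f\<in>tuples t X. \<Sum>g\<in>tuples t X. if \<forall>j\<in>{1..l}. Z dvd power_sum t j f - power_sum t j g then 1 * cnj 1 else 0)"
      by (simp only: parseval_rbox[OF Z finite_tuples])
    also have "\<dots> = complex_of_real (\<Sum>f\<in>tuples t X. \<Sum>g\<in>tuples t X. if \<forall>j\<in>{1..l}. Z dvd power_sum t j f - power_sum t j g then 1 else 0)"
      by (simp add: if_distrib[of complex_of_real] cong: if_cong)
    finally have mom: "moment Z 0 l t c A = (\<Sum>f\<in>tuples t X. \<Sum>g\<in>tuples t X. if \<forall>j\<in>{1..l}. Z dvd power_sum t j f - power_sum t j g then 1 else 0)"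
      by (simp only: of_real_eq_iff)
    have "real (card T) = (\<Sum>x\<in>tuples t X \<times> tuples t X. if x \<in> T then 1 else 0)"
    proof -
      have "T \<subseteq> tuples t X \<times> tuples t X" by (auto simp: T_def)
      then show ?thesis by (simp add: sum.If_cases Int_absorb1)
    qed
    also have "\<dots> = (\<Sum>f\<in>tuples t X. \<Sum>g\<in>tuples t X. if (f, g) \<in> T then 1 else 0)"
      by (simp add: sum.cartesian_product)
    also have "\<dots> \<le> moment Z 0 l t c A"
      unfolding mom by (intro sum_mono) (auto simp: T_def)
    also have "\<dots> \<le> C * of_int p powr (\<epsilon> * real N) * (of_int p ^ N) ^ t" by (rule upper)
    also have "\<dots> = C * (of_int p powr real N) powr (real t + \<epsilon>)"
      using rp by (simp add: powr_powr powr_add mult_ac distrib_left flip: powr_realpow)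
    also have "\<dots> \<le> C * (of_int p * real X) powr (real t + \<epsilon>)"
      using NX C \<epsilon> by (intro mult_left_mono powr_mono2) auto
    also have "\<dots> = C * of_int p powr (real t + \<epsilon>) * real X powr (real t + \<epsilon>)"
      using rp by (simp add: powr_mult)
    finally show ?thesis unfolding T_def .
  qed
  moreover have "C * of_int p powr (real t + \<epsilon>) \<ge> 1"
  proof -
    have "of_int p powr (real t + \<epsilon>) \<ge> 1" using rp \<epsilon> by (intro ge_one_powr_ge_zero) auto
    then have "1 * 1 \<le> C * of_int p powr (real t + \<epsilon>)" using C by (intro mult_mono) auto
    then show ?thesis by simp
  qed
  ultimately show ?thesis unfolding t_def by blast
qed

subsection \<open>Sums of geometric sums\<close>

text \<open>The chord of the concave function \<open>sin\<close> over
  \<open>{0..pi/2}\<close>.\<close>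

lemma jordan_sin:
  assumes "0 \<le> z" "z \<le> 1 / 2"
  shows "2 * z \<le> sin (pi * z)"
proof -
  have conc: "concave_on {0..pi/2} sin"
  proof (rule f''_le0_imp_concave)
    show "DERIV sin x :> cos x" for x :: real by (rule DERIV_sin)
    show "DERIV cos x :> - sin x" for x :: real by (rule DERIV_cos)
    show "- sin x \<le> 0" if "x \<in> {0..pi/2}" for x using that by (auto intro: sin_ge_zero)
  qed simp
  have "(1 - 2 * z) * sin 0 + (2 * z) * sin (pi / 2) \<le> sin ((1 - 2 * z) *\<^sub>R 0 + (2 * z) *\<^sub>R (pi / 2))"
    using assms by (intro concave_onD[OF conc]) auto
  then show ?thesis by (simp add: mult_ac)
qed

lemma cmod_one_minus_e: "cmod (1 - e z) = 2 * \<bar>sin (pi * z)\<bar>"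
proof -
  have "e z = cis (2 * (pi * z))" by (simp add: e_def cis_conv_exp mult_ac)
  then have "cmod (1 - e z) ^ 2 = (1 - cos (2 * (pi * z))) ^ 2 + sin (2 * (pi * z)) ^ 2"
    by (simp add: cmod_power2)
  also have "\<dots> = 2 - 2 * cos (2 * (pi * z))"
    by (simp add: power2_diff sin_squared_eq)
  also have "\<dots> = (2 * \<bar>sin (pi * z)\<bar>) ^ 2"
    unfolding cos_double_sin by (simp add: power_mult_distrib)
  finally show ?thesis by (rule power2_eq_imp_eq) simp_all
qed

definition dirichlet_kernel :: "nat \<Rightarrow> real \<Rightarrow> real" where
  "dirichlet_kernel Y x = cmod (\<Sum>h<Y. e (real h * x))"

lemma dirichlet_kernel_nonneg [simp]: "0 \<le> dirichlet_kernel Y x"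
  by (simp add: dirichlet_kernel_def)

lemma dirichlet_kernel_le: "dirichlet_kernel Y x \<le> real Y"
  unfolding dirichlet_kernel_def by (rule order_trans[OF norm_sum]) simp

lemma dirichlet_kernel_sin: "dirichlet_kernel Y x * \<bar>sin (pi * x)\<bar> \<le> 1"
proof -
  have "(\<Sum>h<Y. e (real h * x)) = (\<Sum>h<Y. e x ^ h)" by (simp add: e_of_nat_mult)
  then have "(1 - e x) * (\<Sum>h<Y. e (real h * x)) = 1 - e x ^ Y"
    by (simp add: one_diff_power_eq)
  then have "cmod (1 - e x) * dirichlet_kernel Y x = cmod (1 - e x ^ Y)"
    unfolding dirichlet_kernel_def by (metis norm_mult)
  also have "\<dots> \<le> cmod 1 + cmod (e x ^ Y)" by (rule norm_triangle_ineq4)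
  also have "\<dots> = 2" by (simp add: norm_power)
  finally show ?thesis unfolding cmod_one_minus_e by (simp add: mult_ac)
qed

text \<open>The usual bound by the inverse distance to the nearest integer, with the two sides kept
  apart: points on one side have comparable fractional parts, so that spacing can be exploited
  without wrapping around 1.\<close>

lemma dirichlet_kernel_frac:
  "dirichlet_kernel Y x * (2 * frac x) \<le> 1 \<or> dirichlet_kernel Y x * (2 * (1 - frac x)) \<le> 1"
proof -
  have "\<bar>sin (pi * x)\<bar> = \<bar>sin (pi * frac x)\<bar>"
  proof -
    have "cmod (1 - e x) = cmod (1 - e (frac x))" by (metis e_cong_int frac_def diff_diff_eq2 add_diff_cancel_left' Ints_of_int)
    then show ?thesis unfolding cmod_one_minus_e by simp
  qed
  then have K: "dirichlet_kernel Y x * \<bar>sin (pi * frac x)\<bar> \<le> 1" using dirichlet_kernel_sin[of Y x] by simp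
  have f: "0 \<le> frac x" "frac x < 1" by (auto simp: frac_lt_1)
  show ?thesis
  proof (cases "frac x \<le> 1 / 2")
    case True
    then have "2 * frac x \<le> \<bar>sin (pi * frac x)\<bar>" using jordan_sin[of "frac x"] f by linarith
    then have "dirichlet_kernel Y x * (2 * frac x) \<le> dirichlet_kernel Y x * \<bar>sin (pi * frac x)\<bar>" by (intro mult_left_mono) auto
    then show ?thesis using K by linarith
  next
    case False
    have "sin (pi * (1 - frac x)) = sin (pi * frac x)" by (simp add: right_diff_distrib sin_diff)
    then have "2 * (1 - frac x) \<le> \<bar>sin (pi * frac x)\<bar>" using jordan_sin[of "1 - frac x"] f False by linarith
    then have "dirichlet_kernel Y x * (2 * (1 - frac x)) \<le> dirichlet_kernel Y x * \<bar>sin (pi * frac x)\<bar>" by (intro mult_left_mono) auto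
    then show ?thesis using K by linarith
  qed
qed

text \<open>Each cell of length \<open>\<delta>\<close> contains at most one of the points. In cell
  0 the bound \<open>Y\<close> is used, in cell \<open>i\<close> the bound
  \<open>J / (2 * i)\<close>, and these add up to a harmonic sum.\<close>

lemma sum_spaced:
  fixes z F :: "'a \<Rightarrow> real"
  assumes U: "finite U" and \<delta>: "\<delta> > 0" "1 / \<delta> = real J" and Y: "Y \<ge> 0"
    and z: "\<And>u. u \<in> U \<Longrightarrow> 0 \<le> z u \<and> z u \<le> 1"
    and sp: "\<And>u v. u \<in> U \<Longrightarrow> v \<in> U \<Longrightarrow> u \<noteq> v \<Longrightarrow> \<bar>z u - z v\<bar> \<ge> \<delta>"
    and F: "\<And>u. u \<in> U \<Longrightarrow> F u \<le> Y" "\<And>u. u \<in> U \<Longrightarrow> F u * (2 * z u) \<le> 1"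
  shows "(\<Sum>u\<in>U. F u) \<le> Y + real J / 2 * harm J"
proof -
  define j where "j u = nat \<lfloor>z u / \<delta>\<rfloor>" for u
  define B where "B i = (if i = 0 then Y else real J / (2 * real i))" for i :: nat
  have jz: "real (j u) \<le> z u / \<delta>" "z u / \<delta> < real (j u) + 1" if "u \<in> U" for u
    using z[OF that] \<delta> unfolding j_def by (auto simp: nat_less_iff floor_le_iff)
  have inj: "inj_on j U"
  proof (rule inj_onI, rule ccontr)
    fix u v assume uv: "u \<in> U" "v \<in> U" "j u = j v" "u \<noteq> v"
    then have "\<bar>z u / \<delta> - z v / \<delta>\<bar> < 1" using jz[OF uv(1)] jz[OF uv(2)] by linarith
    then have "\<bar>z u - z v\<bar> / \<delta> < 1" using \<delta> by (simp add: abs_divide flip: diff_divide_distrib)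
    then show False using sp[OF uv(1,2,4)] \<delta> by simp
  qed
  have range: "j ` U \<subseteq> {0..J}"
  proof
    fix i assume "i \<in> j ` U"
    then obtain u where u: "u \<in> U" "i = j u" by auto
    have "z u / \<delta> \<le> real J" using z[OF u(1)] \<delta> by (metis divide_right_mono less_eq_real_def)
    then show "i \<in> {0..J}" using jz(1)[OF u(1)] u by simp
  qed
  have FB: "F u \<le> B (j u)" if u: "u \<in> U" for u
  proof (cases "j u = 0")
    case False
    have "\<delta> * real J = 1" using \<delta> by (simp add: field_simps)
    have "F u * (2 * real (j u)) \<le> real J"
    proof (cases "F u \<ge> 0")
      case True
      then have "F u * (2 * (real (j u) * \<delta>)) \<le> F u * (2 * z u)"
        using jz(1)[OF u] \<delta> by (intro mult_left_mono) (auto simp: field_simps)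
      also have "\<dots> \<le> 1" by (rule F(2)[OF u])
      finally have "real J * (F u * (2 * (real (j u) * \<delta>))) \<le> real J * 1" by (intro mult_left_mono) auto
      then show ?thesis using \<open>\<delta> * real J = 1\<close> by (simp add: mult_ac) (metis mult.assoc mult.commute mult_1)
    next
      case False
      then have "F u * (2 * real (j u)) \<le> 0" by (intro mult_nonpos_nonneg) auto
      then show ?thesis by (rule order_trans) simp
    qed
    then show ?thesis using False by (simp add: B_def field_simps)
  qed (use F(1)[OF u] in \<open>simp add: B_def\<close>)
  have B0: "B i \<ge> 0" for i using Y by (simp add: B_def)
  have "(\<Sum>u\<in>U. F u) \<le> (\<Sum>u\<in>U. B (j u))" by (intro sum_mono FB)
  also have "\<dots> = (\<Sum>i\<in>j ` U. B i)" using inj by (simp add: sum.reindex)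
  also have "\<dots> \<le> (\<Sum>i\<in>{0..J}. B i)" using range B0 by (intro sum_mono2) auto
  also have "\<dots> = Y + (\<Sum>i\<in>{1..J}. real J / (2 * real i))"
    by (simp add: sum.atLeast_Suc_atMost B_def)
  also have "(\<Sum>i\<in>{1..J}. real J / (2 * real i)) = real J / 2 * harm J"
    unfolding harm_def sum_distrib_left by (intro sum.cong refl) (simp only: divide_inverse inverse_mult_distrib mult_ac)
  finally show ?thesis .
qed

text \<open>The fraction \<open>b * u / q\<close> is at distance at least \<open>1 / q\<close> from
  every integer, and replacing \<open>b / q\<close> by \<open>\<beta>\<close> moves it by at most
  half of that. Besides spacing the kernel arguments, this later keeps multiples of the leading
  coefficient of \<open>f\<close> away from integers.\<close>

lemma rational_approx_spaced:
  fixes b q u :: int and \<beta> :: real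
  assumes q: "q \<ge> 1" "coprime b q" "\<bar>\<beta> - of_int b / of_int q\<bar> \<le> 1 / of_int q ^ 2"
    and u: "u \<noteq> 0" "2 * \<bar>u\<bar> \<le> q"
  shows "\<bar>\<beta> * of_int u - of_int n\<bar> \<ge> 1 / (2 * of_int q)"
proof -
  have "\<not> q dvd b * u"
  proof
    assume "q dvd b * u"
    then have "q dvd u" using q(2) by (simp add: coprime_dvd_mult_right_iff coprime_commute)
    then have "q \<le> \<bar>u\<bar>" using u(1) zdvd_imp_le[of q "\<bar>u\<bar>"] by simp
    then show False using u q by simp
  qed
  then have "b * u - n * q \<noteq> 0" by (metis dvd_triv_right eq_iff_diff_eq_0)
  then have "\<bar>b * u - n * q\<bar> \<ge> 1" by simp
  then have "real_of_int \<bar>b * u - n * q\<bar> \<ge> 1" by (simp only: of_int_1_le_iff)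
  then have "1 / real_of_int q \<le> \<bar>of_int b * of_int u - of_int n * of_int q\<bar> / of_int q"
    using q by (intro divide_right_mono) auto
  also have "\<dots> = \<bar>(of_int b * of_int u - of_int n * of_int q) / of_int q\<bar>"
    using q(1) by (simp add: abs_divide)
  also have "(real_of_int b * of_int u - of_int n * of_int q) / of_int q = of_int b / of_int q * of_int u - of_int n"
    using q(1) by (simp add: field_simps)
  finally have 1: "1 / real_of_int q \<le> \<bar>of_int b / of_int q * of_int u - of_int n\<bar>" .
  have "\<bar>(\<beta> - of_int b / of_int q) * of_int u\<bar> \<le> 1 / of_int q ^ 2 * (of_int q / 2)"
    unfolding abs_mult using q u by (intro mult_mono) auto
  also have "\<dots> = 1 / (2 * of_int q)" using q by (simp add: power2_eq_square)
  finally have 2: "\<bar>(\<beta> - of_int b / of_int q) * of_int u\<bar> \<le> 1 / (2 * of_int q)" .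
  have "\<beta> * of_int u - of_int n = (\<beta> - of_int b / of_int q) * of_int u + (of_int b / of_int q * of_int u - of_int n)"
    by (simp add: algebra_simps)
  moreover have "1 / real_of_int q = 1 / (2 * of_int q) + 1 / (2 * of_int q)" by simp
  ultimately show ?thesis using 1 2 by linarith
qed

lemma sum_dirichlet_kernel_short:
  fixes b q :: int and \<beta> :: real
  assumes q: "q \<ge> 1" "coprime b q" "\<bar>\<beta> - of_int b / of_int q\<bar> \<le> 1 / of_int q ^ 2"
    and U: "finite U" "\<And>u v. u \<in> U \<Longrightarrow> v \<in> U \<Longrightarrow> 2 * \<bar>u - v\<bar> \<le> q"
  shows "(\<Sum>u\<in>U. dirichlet_kernel Y (\<beta> * of_int u)) \<le> 2 * (real Y + of_int q * harm (nat (2 * q)))"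
proof -
  define z where "z u = frac (\<beta> * of_int u)" for u :: int
  define F where "F u = dirichlet_kernel Y (\<beta> * of_int u)" for u :: int
  define U1 where "U1 = {u\<in>U. F u * (2 * z u) \<le> 1}"
  define U2 where "U2 = U - U1"
  have U2: "F u * (2 * (1 - z u)) \<le> 1" if "u \<in> U2" for u
    using that dirichlet_kernel_frac[of Y "\<beta> * of_int u"] by (auto simp: U1_def U2_def F_def z_def)
  have sp: "\<bar>z u - z v\<bar> \<ge> 1 / (2 * of_int q)" if uv: "u \<in> U" "v \<in> U" "u \<noteq> v" for u v
  proof -
    have "z u - z v = \<beta> * of_int (u - v) - of_int (\<lfloor>\<beta> * of_int u\<rfloor> - \<lfloor>\<beta> * of_int v\<rfloor>)"
      by (simp add: z_def frac_def algebra_simps)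
    moreover have "u - v \<noteq> 0" using uv(3) by simp
    ultimately show ?thesis using rational_approx_spaced[OF q _ U(2)[OF uv(1,2)]] by metis
  qed
  have zr: "0 \<le> z u" "z u \<le> 1" for u by (auto simp: z_def less_imp_le frac_lt_1)
  have FY: "F u \<le> real Y" for u by (simp add: F_def dirichlet_kernel_le)
  have J: "real (nat (2 * q)) = 2 * of_int q" using q by simp
  have "(\<Sum>u\<in>U1. F u) \<le> real Y + real (nat (2 * q)) / 2 * harm (nat (2 * q))"
    by (rule sum_spaced[of _ "1 / (2 * of_int q)" _ _ z]) (use U q J zr FY sp in \<open>auto simp: U1_def\<close>)
  moreover have "(\<Sum>u\<in>U2. F u) \<le> real Y + real (nat (2 * q)) / 2 * harm (nat (2 * q))"
    by (rule sum_spaced[of _ "1 / (2 * of_int q)" _ _ "\<lambda>u. 1 - z u"])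
       (use U q J zr FY sp U2 in \<open>auto simp: U2_def abs_minus_commute\<close>)
  moreover have "(\<Sum>u\<in>U. F u) = (\<Sum>u\<in>U2. F u) + (\<Sum>u\<in>U1. F u)"
    unfolding U2_def using U by (intro sum.subset_diff) (auto simp: U1_def)
  ultimately show ?thesis unfolding F_def[symmetric] J by (simp add: algebra_simps)
qed

text \<open>\<open>P i n\<close> stands for a quantity attached to the block of length
  \<open>n\<close> that starts at \<open>i\<close>; the last, incomplete block accounts for the
  summand 1. It serves both for kernel sums and for exponential sums.\<close>

lemma subadditive_blocks:
  fixes P :: "nat \<Rightarrow> nat \<Rightarrow> real"
  assumes B: "B \<ge> 1" and K: "K \<ge> 0"
    and sub: "\<And>i m n. P i (m + n) \<le> P i m + P (i + m) n"
    and short: "\<And>i n. n \<le> B \<Longrightarrow> P i n \<le> K"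
  shows "P i N \<le> (real N / real B + 1) * K"
proof (induction N arbitrary: i rule: less_induct)
  case (less N)
  show ?case
  proof (cases "N \<le> B")
    case True
    then have "P i N \<le> 1 * K" using short by simp
    also have "\<dots> \<le> (real N / real B + 1) * K" using K by (intro mult_right_mono) auto
    finally show ?thesis .
  next
    case False
    have "P i N = P i (B + (N - B))" using False by simp
    also have "\<dots> \<le> P i B + P (i + B) (N - B)" by (rule sub)
    also have "\<dots> \<le> K + (real (N - B) / real B + 1) * K"
      using False B by (intro add_mono short less.IH) auto
    also have "\<dots> = (real N / real B + 1) * K"
      using False B by (simp add: of_nat_diff field_simps)
    finally show ?thesis .
  qed
qed

lemma sum_dirichlet_kernel:
  fixes b q u0 :: int and \<beta> :: real
  assumes q: "q \<ge> 1" "coprime b q" "\<bar>\<beta> - of_int b / of_int q\<bar> \<le> 1 / of_int q ^ 2"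
  shows "(\<Sum>i<N. dirichlet_kernel Y (\<beta> * of_int (u0 + int i))) \<le>
     (2 * real N / of_int q + 1) * (2 * (real Y + of_int q * harm (nat (2 * q))))"
proof -
  define K where "K = 2 * (real Y + of_int q * harm (nat (2 * q)))"
  define P where "P i n = (\<Sum>j\<in>{i..<i+n}. dirichlet_kernel Y (\<beta> * of_int (u0 + int j)))" for i n
  \<comment> \<open>This is \<open>q / 2\<close> rounded up: integers in a block of \<open>B\<close>
    consecutive ones differ by at most \<open>B - 1\<close>, which is at most
    \<open>q / 2\<close>.\<close>
  define B where "B = nat ((q + 1) div 2)"
  have B: "int B = (q + 1) div 2" "B \<ge> 1" using q by (auto simp: B_def)
  have B2: "q \<le> 2 * int B" "2 * int B \<le> q + 1" unfolding B(1) by presburger+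
  have K0: "K \<ge> 0" using q by (simp add: K_def harm_nonneg)
  have "P 0 N \<le> (real N / real B + 1) * K"
  proof (rule subadditive_blocks[OF B(2) K0])
    show "P i (m + n) \<le> P i m + P (i + m) n" for i m n
    proof -
      have "{i..<i + (m + n)} = {i..<i + m} \<union> {i + m..<i + m + n}" by auto
      then show ?thesis unfolding P_def by (simp only:) (subst sum.union_disjoint, auto)
    qed
    show "P i n \<le> K" if n: "n \<le> B" for i n
    proof -
      have "P i n = (\<Sum>u\<in>(\<lambda>j. u0 + int j) ` {i..<i+n}. dirichlet_kernel Y (\<beta> * of_int u))"
        unfolding P_def by (subst sum.reindex) (auto simp: inj_on_def)
      also have "\<dots> \<le> K" unfolding K_def
      proof (rule sum_dirichlet_kernel_short[OF q])
        fix u v assume "u \<in> (\<lambda>j. u0 + int j) ` {i..<i+n}" "v \<in> (\<lambda>j. u0 + int j) ` {i..<i+n}"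
        then have "\<bar>u - v\<bar> + 1 \<le> int n" by auto
        also have "int n \<le> int B" using n by simp
        finally have "2 * (\<bar>u - v\<bar> + 1) \<le> 2 * int B" by simp
        also note B2(2)
        finally show "2 * \<bar>u - v\<bar> \<le> q" by simp
      qed simp
      finally show ?thesis .
    qed
  qed
  also have "\<dots> \<le> (2 * real N / of_int q + 1) * K"
  proof (intro mult_right_mono add_right_mono K0)
    have "real_of_int q \<le> of_int (2 * int B)" using B2(1) by (simp only: of_int_le_iff)
    then have "real_of_int q \<le> 2 * real B" by simp
    then have "real N / real B \<le> real N / (of_int q / 2)" using q by (intro divide_left_mono) auto
    then show "real N / real B \<le> 2 * real N / of_int q" by (simp add: mult.commute)
  qed
  finally show ?thesis unfolding P_def K_def by (simp add: atLeast0LessThan)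
qed

lemma harm_le_ln: "n \<ge> 1 \<Longrightarrow> harm n \<le> 1 + ln (real n)"
proof -
  assume "n \<ge> 1"
  then obtain m where m: "n = Suc m" by (cases n) auto
  have "harm (Suc m) - ln (real (Suc m)) \<le> harm (Suc 0) - ln (real (Suc 0))"
    using decseqD[OF decseq_harm_diff_ln, of 0 m] by simp
  then show ?thesis by (simp add: m harm_def)
qed

text \<open>The dual form of the large sieve inequality for points in arithmetic progression (Schur test).\<close>

lemma sum_sq_progression:
  fixes a :: "int \<Rightarrow> complex"
  assumes W: "finite W" and K: "\<And>w. w \<in> W \<Longrightarrow> (\<Sum>w'\<in>W. dirichlet_kernel Y (\<beta> * of_int (w - w'))) \<le> K"
  shows "(\<Sum>h<Y. cmod (\<Sum>w\<in>W. a w * e ((\<beta> * real h + \<gamma>) * of_int w)) ^ 2) \<le> K * (\<Sum>w\<in>W. cmod (a w) ^ 2)"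
proof -
  define E where "E h w = e ((\<beta> * real h + \<gamma>) * of_int w)" for h :: nat and w :: int
  define D where "D w w' = (\<Sum>h<Y. E h w * cnj (E h w'))" for w w'
  have D: "cmod (D w w') = dirichlet_kernel Y (\<beta> * of_int (w - w'))" for w w'
  proof -
    have "E h w * cnj (E h w') = e (\<gamma> * of_int (w - w')) * e (real h * (\<beta> * of_int (w - w')))" for h
      unfolding E_def e_uminus[symmetric] e_add[symmetric] by (simp add: algebra_simps)
    then have "D w w' = e (\<gamma> * of_int (w - w')) * (\<Sum>h<Y. e (real h * (\<beta> * of_int (w - w'))))"
      unfolding D_def by (simp add: sum_distrib_left)
    then show ?thesis by (simp add: dirichlet_kernel_def norm_mult)
  qed
  have Dsym: "cmod (D w w') = cmod (D w' w)" for w w'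
  proof -
    have "D w w' = cnj (D w' w)" unfolding D_def by (simp add: mult.commute)
    then show ?thesis by simp
  qed
  have "complex_of_real (\<Sum>h<Y. cmod (\<Sum>w\<in>W. a w * E h w) ^ 2) = (\<Sum>h<Y. \<Sum>w\<in>W. \<Sum>w'\<in>W. (a w * E h w) * cnj (a w' * E h w'))"
    by (simp only: of_real_sum cmod_sum_sq)
  also have "\<dots> = (\<Sum>w\<in>W. \<Sum>w'\<in>W. \<Sum>h<Y. (a w * E h w) * cnj (a w' * E h w'))"
    by (subst sum.swap, intro sum.cong refl, subst sum.swap, rule refl)
  also have "\<dots> = (\<Sum>w\<in>W. \<Sum>w'\<in>W. a w * cnj (a w') * D w w')"
    unfolding D_def by (intro sum.cong refl) (simp add: sum_distrib_left mult_ac)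
  finally have eq: "complex_of_real (\<Sum>h<Y. cmod (\<Sum>w\<in>W. a w * E h w) ^ 2) = \<dots>" .
  have "(\<Sum>h<Y. cmod (\<Sum>w\<in>W. a w * E h w) ^ 2) = cmod (\<Sum>w\<in>W. \<Sum>w'\<in>W. a w * cnj (a w') * D w w')"
    unfolding eq[symmetric] norm_of_real by (simp add: sum_nonneg)
  also have "\<dots> \<le> (\<Sum>w\<in>W. \<Sum>w'\<in>W. cmod (a w * cnj (a w') * D w w'))"
    by (intro order_trans[OF norm_sum] sum_mono norm_sum)
  also have "\<dots> \<le> (\<Sum>w\<in>W. \<Sum>w'\<in>W. cmod (a w) ^ 2 * cmod (D w w') / 2 + cmod (a w') ^ 2 * cmod (D w' w) / 2)"
  proof (intro sum_mono)
    fix w w'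
    have "2 * (cmod (a w) * cmod (a w')) \<le> cmod (a w) ^ 2 + cmod (a w') ^ 2"
      using sum_squares_bound[of "cmod (a w)" "cmod (a w')"] by (simp add: mult_ac)
    then have "cmod (a w) * cmod (a w') * cmod (D w w') \<le> ((cmod (a w) ^ 2 + cmod (a w') ^ 2) / 2) * cmod (D w w')"
      by (intro mult_right_mono) auto
    then show "cmod (a w * cnj (a w') * D w w') \<le> cmod (a w) ^ 2 * cmod (D w w') / 2 + cmod (a w') ^ 2 * cmod (D w' w) / 2"
      unfolding Dsym[of w' w] by (simp add: norm_mult algebra_simps add_divide_distrib)
  qed
  also have "\<dots> = (\<Sum>w\<in>W. \<Sum>w'\<in>W. cmod (a w) ^ 2 * cmod (D w w') / 2) + (\<Sum>w\<in>W. \<Sum>w'\<in>W. cmod (a w') ^ 2 * cmod (D w' w) / 2)"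
    by (simp add: sum.distrib)
  also have "(\<Sum>w\<in>W. \<Sum>w'\<in>W. cmod (a w') ^ 2 * cmod (D w' w) / 2) = (\<Sum>w\<in>W. \<Sum>w'\<in>W. cmod (a w) ^ 2 * cmod (D w w') / 2)"
    by (rule sum.swap)
  also have "(\<Sum>w\<in>W. \<Sum>w'\<in>W. cmod (a w) ^ 2 * cmod (D w w') / 2) + (\<Sum>w\<in>W. \<Sum>w'\<in>W. cmod (a w) ^ 2 * cmod (D w w') / 2)
     = (\<Sum>w\<in>W. cmod (a w) ^ 2 * (\<Sum>w'\<in>W. cmod (D w w')))"
    by (simp add: sum_distrib_left sum_distrib_right mult.commute flip: sum.distrib)
  also have "\<dots> \<le> (\<Sum>w\<in>W. cmod (a w) ^ 2 * K)"
    using K by (intro sum_mono mult_left_mono) (auto simp: D)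
  also have "\<dots> = K * (\<Sum>w\<in>W. cmod (a w) ^ 2)" by (simp add: sum_distrib_left mult.commute)
  finally show ?thesis unfolding E_def .
qed

subsection \<open>Weyl sums\<close>

lemma sum_lessThan_add: "(\<Sum>m<a + b. f m) = (\<Sum>m<a. f m) + (\<Sum>m<b. f (a + m))"
  for f :: "nat \<Rightarrow> 'a :: comm_monoid_add"
  by (induction b) (simp_all add: add_ac)

text \<open>The two intervals of summation differ in at most \<open>h\<close> terms at either
  end.\<close>

lemma sum_shift_diff:
  fixes \<phi> :: "nat \<Rightarrow> complex"
  assumes "\<And>m. cmod (\<phi> m) \<le> 1"
  shows "cmod (\<Sum>m<x. \<phi> m) \<le> cmod (\<Sum>m<x. \<phi> (m + h)) + 2 * real h"
proof -
  have b: "cmod (\<Sum>m<h. \<phi> (c + m)) \<le> real h" for c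
    using sum_norm_le[of "{..<h}" "\<lambda>m. \<phi> (c + m)" "\<lambda>_. 1"] assms by simp
  have "(\<Sum>m<x. \<phi> m) + (\<Sum>m<h. \<phi> (x + m)) = (\<Sum>m<h. \<phi> m) + (\<Sum>m<x. \<phi> (h + m))"
    using sum_lessThan_add[of \<phi> x h] sum_lessThan_add[of \<phi> h x] by (simp add: add.commute)
  then have "(\<Sum>m<x. \<phi> m) = (\<Sum>m<x. \<phi> (m + h)) + ((\<Sum>m<h. \<phi> (0 + m)) - (\<Sum>m<h. \<phi> (x + m)))"
    by (simp add: add.commute algebra_simps)
  then have "cmod (\<Sum>m<x. \<phi> m) \<le> cmod (\<Sum>m<x. \<phi> (m + h)) + (cmod (\<Sum>m<h. \<phi> (0 + m)) + cmod (\<Sum>m<h. \<phi> (x + m)))"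
    by (metis (no_types, lifting) norm_triangle_ineq norm_triangle_ineq4 order_trans add_left_mono)
  then show ?thesis using b[of 0] b[of x] by linarith
qed

text \<open>The Taylor coefficient of order \<open>j\<close> of \<open>g\<close> at
  \<open>h\<close>, written with a bound \<open>k\<close> for the degree.\<close>

definition shift_coeff :: "real poly \<Rightarrow> nat \<Rightarrow> nat \<Rightarrow> real \<Rightarrow> real" where
  "shift_coeff g k j h = (\<Sum>i=j..k. coeff g i * of_nat (i choose j) * h ^ (i - j))"

lemma poly_shift_coeff:
  assumes "degree g \<le> k"
  shows "poly g (x + h) = (\<Sum>j\<le>k. shift_coeff g k j h * x ^ j)"
proof -
  have "poly g (x + h) = (\<Sum>i\<le>k. coeff g i * (\<Sum>j\<le>i. of_nat (i choose j) * x ^ j * h ^ (i - j)))"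
    unfolding poly_bounded_degree[OF assms] binomial_ring ..
  also have "\<dots> = (\<Sum>i\<le>k. \<Sum>j\<le>i. coeff g i * of_nat (i choose j) * h ^ (i - j) * x ^ j)"
    by (simp add: sum_distrib_left mult_ac)
  also have "\<dots> = (\<Sum>j\<le>k. \<Sum>i=j..k. coeff g i * of_nat (i choose j) * h ^ (i - j) * x ^ j)"
    by (simp add: sum.Sigma) (rule sum.reindex_bij_witness[of _ "\<lambda>(j, i). (i, j)" "\<lambda>(i, j). (j, i)"], auto)
  finally show ?thesis by (simp add: shift_coeff_def sum_distrib_right)
qed

lemma shift_coeff_top: "shift_coeff g k k h = coeff g k"
  by (simp add: shift_coeff_def)

lemma shift_coeff_second:
  assumes "k \<ge> 1"
  shows "shift_coeff g k (k - 1) h = (coeff g k * real k) * h + coeff g (k - 1)"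
proof -
  obtain n where k: "k = Suc n" using assms by (cases k) auto
  have "{n..Suc n} = {n, Suc n}" by auto
  then show ?thesis by (simp add: shift_coeff_def k)
qed

lemma sum_lessThan_tri: "(\<Sum>j\<in>{1..<n}. j) = tri (n - 1)"
proof (cases n)
  case (Suc m)
  have "{1..<Suc m} = {0..m} - {0}" by auto
  then have "(\<Sum>j\<in>{1..<Suc m}. j) = (\<Sum>j\<in>{0..m}. j)" by (simp add: sum_diff1_nat)
  also have "\<dots> = tri m" by (simp add: tri_def gauss_sum_nat)
  finally show ?thesis by (simp add: Suc)
qed (simp add: tri_def)

lemma power_sum_bounds:
  assumes "f \<in> tuples t x" "x \<le> M"
  shows "0 \<le> power_sum t j f" "power_sum t j f \<le> int (t * M ^ j)"
proof -
  show "0 \<le> power_sum t j f" by (simp add: power_sum_def sum_nonneg)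
  have "power_sum t j f \<le> (\<Sum>i<t. int M ^ j)"
    unfolding power_sum_def
  proof (intro sum_mono power_mono)
    fix i assume "i \<in> {..<t}"
    then have "f i < x" using assms by (auto simp: tuples_def PiE_iff)
    then show "int (f i) \<le> int M" using assms by simp
  qed simp
  then show "power_sum t j f \<le> int (t * M ^ j)" by simp
qed

text \<open>The coefficients of \<open>m\<^sup>k\<^sup>-\<^sup>1\<close> in the shifts \<open>g (m + h)\<close> are in arithmetic progression with
  difference \<open>k \<beta>\<close>, so the large sieve applies to them; nothing is used about the lower ones.\<close>

lemma weyl_shift_moment:
  fixes g :: "real poly" and b q :: int and k :: nat
  defines "t \<equiv> tri (k - 1)"
  assumes k: "k \<ge> 2" and g: "degree g \<le> k" and xM: "x \<le> M" "M \<ge> 1"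
    and q: "q \<ge> 1" "coprime b q" "\<bar>coeff g k - of_int b / of_int q\<bar> \<le> 1 / of_int q ^ 2"
    and J: "real (card {(f, g). f \<in> tuples t x \<and> g \<in> tuples t x \<and>
      (\<forall>j\<in>{1..k - 1}. power_sum t j f = power_sum t j g)}) \<le> J"
  shows "(\<Sum>h<Y. cmod (\<Sum>m<x. e (poly g (real m + real h))) ^ (2 * t)) \<le>
     real (t + 1) ^ (k - 2) * real M ^ tri (k - 2) *
      ((2 * (real k * real t * real M ^ (k - 1) + 1) / of_int q + 1) * (2 * (real Y + of_int q * harm (nat (2 * q)))) * J)"
proof -
  define n where "n = k - 1"
  have n: "n \<ge> 1" "k = Suc n" using k by (auto simp: n_def)
  define \<beta> where "\<beta> = coeff g k"
  define \<gamma> where "\<gamma> = coeff g (k - 1)"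
  define \<Omega> where "\<Omega> = tuples t x"
  define V where "V = t * M ^ n"
  define Ws where "Ws = {0..int V}"
  \<comment> \<open>Power sums of orders 1 to \<open>k - 2\<close>; order \<open>k - 1\<close> is
    \<open>w\<close>, while order \<open>k\<close> has the coefficient \<open>\<beta>\<close>,
    independent of \<open>h\<close>, and is stored in \<open>a\<close>. The restriction makes
    equality of these vectors the same as equality of the power sums.\<close>
  define \<kappa> where "\<kappa> f = restrict (\<lambda>j. power_sum t j f) {1..<n}" for f
  define w where "w = power_sum t n"
  define Vs where "Vs = \<kappa> ` \<Omega>"
  define B where "B v u = {f\<in>\<Omega>. (\<kappa> f, w f) = (v, u)}" for v u
  define a where "a v u = (\<Sum>f\<in>B v u. e (\<beta> * of_int (power_sum t k f)))" for v u
  define A where "A = shift_coeff g k"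
  define K where "K = (2 * (real k * real t * real M ^ (k - 1) + 1) / of_int q + 1) * (2 * (real Y + of_int q * harm (nat (2 * q))))"
  have f\<Omega>: "finite \<Omega>" by (simp add: \<Omega>_def)
  have fV: "finite Vs" by (simp add: Vs_def f\<Omega>)
  have fW: "finite Ws" by (simp add: Ws_def)
  have wW: "w f \<in> Ws" if "f \<in> \<Omega>" for f
    using power_sum_bounds[of f t x M n] that xM by (auto simp: \<Omega>_def Ws_def w_def V_def)
  have pow: "(\<Sum>m<x. e (poly g (real m + real h))) ^ t =
     e (A 0 h * real t) * (\<Sum>v\<in>Vs. e (\<Sum>j\<in>{1..<n}. A j h * of_int (v j)) * (\<Sum>u\<in>Ws. a v u * e ((\<beta> * real k * real h + \<gamma>) * of_int u)))"
    for h :: nat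
  proof -
    have arg: "(\<Sum>i<t. poly g (real (f i) + real h)) =
        A 0 h * real t + ((\<Sum>j\<in>{1..<n}. A j h * of_int (\<kappa> f j)) + ((\<beta> * real k * real h + \<gamma>) * of_int (w f) + \<beta> * of_int (power_sum t k f)))" for f
    proof -
      have "(\<Sum>i<t. poly g (real (f i) + real h)) = (\<Sum>i<t. \<Sum>j\<le>k. A j h * real (f i) ^ j)"
        unfolding A_def by (intro sum.cong refl poly_shift_coeff g)
      also have "\<dots> = (\<Sum>j\<le>k. A j h * of_int (power_sum t j f))"
        by (subst sum.swap) (simp add: power_sum_def sum_distrib_left)
      also have "{..k} = insert 0 ({1..<n} \<union> {n, k})" using n by auto
      also have "(\<Sum>j\<in>insert 0 ({1..<n} \<union> {n, k}). A j h * of_int (power_sum t j f)) =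
         A 0 h * of_int (power_sum t 0 f) + ((\<Sum>j\<in>{1..<n}. A j h * of_int (power_sum t j f)) + (\<Sum>j\<in>{n, k}. A j h * of_int (power_sum t j f)))"
        using n by (subst sum.insert) (auto simp: sum.union_disjoint)
      also have "(\<Sum>j\<in>{n, k}. A j h * of_int (power_sum t j f)) = A n h * of_int (w f) + A k h * of_int (power_sum t k f)"
        using n by (simp add: w_def)
      also have "A k h = \<beta>" by (simp add: A_def \<beta>_def shift_coeff_top)
      also have "A n h = \<beta> * real k * real h + \<gamma>"
        using shift_coeff_second[of k g "real h"] k by (simp add: A_def \<beta>_def \<gamma>_def n_def)
      also have "(\<Sum>j\<in>{1..<n}. A j h * of_int (power_sum t j f)) = (\<Sum>j\<in>{1..<n}. A j h * of_int (\<kappa> f j))"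
        by (simp add: \<kappa>_def)
      also have "real_of_int (power_sum t 0 f) = real t" by (simp add: power_sum_def)
      finally show ?thesis .
    qed
    have "(\<Sum>m<x. e (poly g (real m + real h))) ^ t = (\<Sum>f\<in>\<Omega>. e (\<Sum>i<t. poly g (real (f i) + real h)))"
      unfolding sum_power_tuples \<Omega>_def e_sum ..
    also have "\<dots> = (\<Sum>f\<in>\<Omega>. e (A 0 h * real t) * (e (\<Sum>j\<in>{1..<n}. A j h * of_int (\<kappa> f j)) * (e (\<beta> * of_int (power_sum t k f)) * e ((\<beta> * real k * real h + \<gamma>) * of_int (w f)))))"
      unfolding arg e_add by (simp add: mult_ac)
    also have "\<dots> = (\<Sum>y\<in>Vs \<times> Ws. \<Sum>f\<in>{f\<in>\<Omega>. (\<kappa> f, w f) = y}. e (A 0 h * real t) * (e (\<Sum>j\<in>{1..<n}. A j h * of_int (\<kappa> f j)) * (e (\<beta> * of_int (power_sum t k f)) * e ((\<beta> * real k * real h + \<gamma>) * of_int (w f)))))"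
      using f\<Omega> fV fW wW by (intro sum.group[symmetric]) (auto simp: Vs_def)
    also have "\<dots> = (\<Sum>v\<in>Vs. \<Sum>u\<in>Ws. \<Sum>f\<in>B v u. e (A 0 h * real t) * (e (\<Sum>j\<in>{1..<n}. A j h * of_int (\<kappa> f j)) * (e (\<beta> * of_int (power_sum t k f)) * e ((\<beta> * real k * real h + \<gamma>) * of_int (w f)))))"
      unfolding B_def sum.cartesian_product by (rule sum.cong[OF refl]) (simp only: case_prod_beta prod.collapse)
    also have "\<dots> = (\<Sum>v\<in>Vs. \<Sum>u\<in>Ws. e (A 0 h * real t) * (e (\<Sum>j\<in>{1..<n}. A j h * of_int (v j)) * (a v u * e ((\<beta> * real k * real h + \<gamma>) * of_int u))))"
    proof (intro sum.cong refl)
      fix v u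
      have "(\<Sum>f\<in>B v u. e (A 0 h * real t) * (e (\<Sum>j\<in>{1..<n}. A j h * of_int (\<kappa> f j)) * (e (\<beta> * of_int (power_sum t k f)) * e ((\<beta> * real k * real h + \<gamma>) * of_int (w f)))))
        = (\<Sum>f\<in>B v u. e (A 0 h * real t) * (e (\<Sum>j\<in>{1..<n}. A j h * of_int (v j)) * (e (\<beta> * of_int (power_sum t k f)) * e ((\<beta> * real k * real h + \<gamma>) * of_int u))))"
        by (intro sum.cong refl) (auto simp: B_def)
      then show "(\<Sum>f\<in>B v u. e (A 0 h * real t) * (e (\<Sum>j\<in>{1..<n}. A j h * of_int (\<kappa> f j)) * (e (\<beta> * of_int (power_sum t k f)) * e ((\<beta> * real k * real h + \<gamma>) * of_int (w f)))))
        = e (A 0 h * real t) * (e (\<Sum>j\<in>{1..<n}. A j h * of_int (v j)) * (a v u * e ((\<beta> * real k * real h + \<gamma>) * of_int u)))"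
        by (simp add: a_def sum_distrib_left sum_distrib_right)
    qed
    finally show ?thesis by (simp add: sum_distrib_left)
  qed
  have step: "cmod (\<Sum>m<x. e (poly g (real m + real h))) ^ (2 * t) \<le>
     real (card Vs) * (\<Sum>v\<in>Vs. cmod (\<Sum>u\<in>Ws. a v u * e ((\<beta> * real k * real h + \<gamma>) * of_int u)) ^ 2)" for h :: nat
  proof -
    have "cmod (\<Sum>m<x. e (poly g (real m + real h))) ^ (2 * t) = cmod ((\<Sum>m<x. e (poly g (real m + real h))) ^ t) ^ 2"
      by (simp add: norm_power power_mult[symmetric] mult.commute)
    \<comment> \<open>The triangle inequality removes the unimodular factors with the uncontrolled
      coefficients \<open>A j h\<close>, \<open>j < k - 1\<close>. The Cauchy--Schwarz step that
      follows costs the number of vectors \<open>v\<close>, about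
      \<open>M ^ tri (k - 2)\<close>.\<close>
    also have "\<dots> \<le> (\<Sum>v\<in>Vs. cmod (\<Sum>u\<in>Ws. a v u * e ((\<beta> * real k * real h + \<gamma>) * of_int u))) ^ 2"
    proof (rule power_mono)
      show "cmod ((\<Sum>m<x. e (poly g (real m + real h))) ^ t) \<le> (\<Sum>v\<in>Vs. cmod (\<Sum>u\<in>Ws. a v u * e ((\<beta> * real k * real h + \<gamma>) * of_int u)))"
        unfolding pow norm_mult cmod_e mult_1 by (rule order_trans[OF norm_sum]) (simp add: norm_mult)
    qed simp
    also have "(\<Sum>v\<in>Vs. cmod (\<Sum>u\<in>Ws. a v u * e ((\<beta> * real k * real h + \<gamma>) * of_int u))) ^ 2 \<le>
        (\<Sum>v\<in>Vs. cmod (\<Sum>u\<in>Ws. a v u * e ((\<beta> * real k * real h + \<gamma>) * of_int u)) ^ 2) * real (card Vs)"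
      by (rule sum_squared_le_sum_of_squares)
    finally show ?thesis by (simp only: mult.commute)
  qed
  have Kb: "(\<Sum>u'\<in>Ws. dirichlet_kernel Y (\<beta> * real k * of_int (u - u'))) \<le> K" if u: "u \<in> Ws" for u
  proof -
    \<comment> \<open>The arguments \<open>k * (u - u')\<close> are distinct integers in an interval
      of length \<open>k * V + 1\<close> that starts at \<open>u0\<close>. Summing over all its
      integers allows the approximation of \<open>\<beta>\<close> itself to be used instead of one
      of \<open>k * \<beta>\<close>.\<close>
    define u0 where "u0 = int k * (u - int V)"
    have "(\<Sum>u'\<in>Ws. dirichlet_kernel Y (\<beta> * real k * of_int (u - u'))) = (\<Sum>i\<in>(\<lambda>u'. nat (int k * (int V - u'))) ` Ws. dirichlet_kernel Y (\<beta> * of_int (u0 + int i)))"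
    proof (subst sum.reindex)
      show "inj_on (\<lambda>u'. nat (int k * (int V - u'))) Ws"
        using k by (auto simp: inj_on_def Ws_def nat_eq_iff)
      show "(\<Sum>u'\<in>Ws. dirichlet_kernel Y (\<beta> * real k * of_int (u - u'))) = sum ((\<lambda>i. dirichlet_kernel Y (\<beta> * of_int (u0 + int i))) \<circ> (\<lambda>u'. nat (int k * (int V - u')))) Ws"
      proof (intro sum.cong refl)
        fix u' assume "u' \<in> Ws"
        then have "int (nat (int k * (int V - u'))) = int k * (int V - u')" by (auto simp: Ws_def)
        then have "u0 + int (nat (int k * (int V - u'))) = int k * (u - u')" by (simp add: u0_def algebra_simps)
        then show "dirichlet_kernel Y (\<beta> * real k * of_int (u - u')) = ((\<lambda>i. dirichlet_kernel Y (\<beta> * of_int (u0 + int i))) \<circ> (\<lambda>u'. nat (int k * (int V - u')))) u'"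
          by (simp only: o_def of_int_mult of_int_of_nat_eq mult.assoc)
      qed
    qed
    also have "\<dots> \<le> (\<Sum>i<k * V + 1. dirichlet_kernel Y (\<beta> * of_int (u0 + int i)))"
    proof (intro sum_mono2)
      show "(\<lambda>u'. nat (int k * (int V - u'))) ` Ws \<subseteq> {..<k * V + 1}"
      proof
        fix i assume "i \<in> (\<lambda>u'. nat (int k * (int V - u'))) ` Ws"
        then obtain u' where u': "u' \<in> Ws" "i = nat (int k * (int V - u'))" by auto
        have "int k * (int V - u') \<le> int k * int V" using u' by (intro mult_left_mono) (auto simp: Ws_def)
        then have "i \<le> k * V" using u' by (simp add: nat_le_iff)
        then show "i \<in> {..<k * V + 1}" by simp
      qed
    qed auto
    also have "\<dots> \<le> (2 * real (k * V + 1) / of_int q + 1) * (2 * (real Y + of_int q * harm (nat (2 * q))))"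
      using q by (intro sum_dirichlet_kernel) (auto simp: \<beta>_def)
    also have "\<dots> = K" by (simp add: K_def V_def n_def mult_ac)
    finally show ?thesis .
  qed
  have K0: "K \<ge> 0" unfolding K_def using q by (intro mult_nonneg_nonneg add_nonneg_nonneg) (auto simp: harm_nonneg)
  \<comment> \<open>The squared fibre sizes count pairs of tuples with equal power sums of all
    orders up to \<open>k - 1\<close>, the quantity in the mean value theorem.\<close>
  have energy: "(\<Sum>v\<in>Vs. \<Sum>u\<in>Ws. cmod (a v u) ^ 2) \<le> J"
  proof -
    define T where "T = {(f, g). f \<in> tuples t x \<and> g \<in> tuples t x \<and> (\<forall>j\<in>{1..k - 1}. power_sum t j f = power_sum t j g)}"
    have fT: "finite T" by (rule finite_subset[of _ "\<Omega> \<times> \<Omega>"]) (auto simp: T_def \<Omega>_def)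
    have i: "{1..k - 1} = insert n {1..<n}" unfolding n_def[symmetric] using n(1) by auto
    have "\<kappa> f = \<kappa> g \<longleftrightarrow> (\<forall>j\<in>{1..<n}. power_sum t j f = power_sum t j g)" for f g
      unfolding \<kappa>_def fun_eq_iff restrict_def by metis
    then have Tk: "T = {(f, g). f \<in> \<Omega> \<and> g \<in> \<Omega> \<and> \<kappa> f = \<kappa> g \<and> w f = w g}"
      unfolding T_def \<Omega>_def i w_def by blast
    have "cmod (a v u) ^ 2 \<le> real (card {y\<in>T. (\<kappa> (fst y), w (fst y)) = (v, u)})" for v u
    proof -
      have "cmod (a v u) \<le> real (card (B v u))"
        unfolding a_def by (rule order_trans[OF norm_sum]) simp
      then have "cmod (a v u) ^ 2 \<le> real (card (B v u)) ^ 2" by (intro power_mono) auto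
      also have "\<dots> = real (card (B v u \<times> B v u))" by (simp add: card_cartesian_product power2_eq_square)
      also have "B v u \<times> B v u = {y\<in>T. (\<kappa> (fst y), w (fst y)) = (v, u)}" by (auto simp: B_def Tk)
      finally show ?thesis .
    qed
    then have "(\<Sum>v\<in>Vs. \<Sum>u\<in>Ws. cmod (a v u) ^ 2) \<le> (\<Sum>v\<in>Vs. \<Sum>u\<in>Ws. real (card {y\<in>T. (\<kappa> (fst y), w (fst y)) = (v, u)}))"
      by (intro sum_mono)
    also have "\<dots> = (\<Sum>z\<in>Vs \<times> Ws. \<Sum>y\<in>{y\<in>T. (\<kappa> (fst y), w (fst y)) = z}. 1)"
      unfolding sum.cartesian_product by (rule sum.cong[OF refl]) (simp only: case_prod_beta prod.collapse card_eq_sum of_nat_sum of_nat_1)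
    also have "\<dots> = (\<Sum>y\<in>T. 1)"
      using fT fV fW wW by (intro sum.group) (auto simp: Vs_def Tk)
    also have "\<dots> \<le> J" using J by (simp add: T_def)
    finally show ?thesis .
  qed
  have cV: "real (card Vs) \<le> real (t + 1) ^ (k - 2) * real M ^ tri (k - 2)"
  proof -
    have "Vs \<subseteq> PiE {1..<n} (\<lambda>j. {0..int (t * M ^ j)})"
      using power_sum_bounds[of _ t x M] xM by (auto simp: Vs_def \<kappa>_def \<Omega>_def PiE_iff)
    then have "card Vs \<le> card (PiE {1..<n} (\<lambda>j. {0..int (t * M ^ j)}))"
      by (intro card_mono finite_PiE) auto
    also have "\<dots> = (\<Prod>j\<in>{1..<n}. t * M ^ j + 1)"
    proof -
      have c: "card {0..int m} = m + 1" for m by (simp add: nat_add_distrib)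
      show ?thesis by (simp only: card_PiE finite_atLeastLessThan c)
    qed
    also have "\<dots> \<le> (\<Prod>j\<in>{1..<n}. (t + 1) * M ^ j)"
      using xM by (intro prod_mono) auto
    also have "\<dots> = (t + 1) ^ (n - 1) * M ^ (\<Sum>j\<in>{1..<n}. j)"
      by (simp only: prod.distrib power_sum prod_constant card_atLeastLessThan)
    also have "(\<Sum>j\<in>{1..<n}. j) = tri (n - 1)" by (rule sum_lessThan_tri)
    finally have "real (card Vs) \<le> real ((t + 1) ^ (n - 1) * M ^ tri (n - 1))" by (simp only: of_nat_le_iff)
    then show ?thesis by (simp add: n_def numeral_2_eq_2)
  qed
  have "(\<Sum>h<Y. cmod (\<Sum>m<x. e (poly g (real m + real h))) ^ (2 * t)) \<le>
     (\<Sum>h<Y. real (card Vs) * (\<Sum>v\<in>Vs. cmod (\<Sum>u\<in>Ws. a v u * e ((\<beta> * real k * real h + \<gamma>) * of_int u)) ^ 2))"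
    by (intro sum_mono step)
  also have "\<dots> = real (card Vs) * (\<Sum>v\<in>Vs. \<Sum>h<Y. cmod (\<Sum>u\<in>Ws. a v u * e ((\<beta> * real k * real h + \<gamma>) * of_int u)) ^ 2)"
    by (subst sum.swap) (simp add: sum_distrib_left)
  also have "\<dots> \<le> real (card Vs) * (\<Sum>v\<in>Vs. K * (\<Sum>u\<in>Ws. cmod (a v u) ^ 2))"
    by (intro mult_left_mono sum_mono sum_sq_progression fW Kb) auto
  also have "\<dots> = real (card Vs) * (K * (\<Sum>v\<in>Vs. \<Sum>u\<in>Ws. cmod (a v u) ^ 2))" by (simp add: sum_distrib_left)
  also have "\<dots> \<le> (real (t + 1) ^ (k - 2) * real M ^ tri (k - 2)) * (K * J)"
    using K0 energy by (intro mult_mono cV mult_left_mono mult_nonneg_nonneg sum_nonneg) auto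
  finally show ?thesis unfolding K_def .
qed

text \<open>The shifts run up to \<open>M / L\<^sup>\<sigma>\<close>, so replacing the sum by its shifts is affordable.\<close>

lemma weyl_bound:
  fixes k :: nat and C0 :: real
  defines "\<sigma> \<equiv> 1 / (real (k * (k - 1)) + 2)"
  assumes k: "k \<ge> 2" and C0: "C0 \<ge> 1"
  shows "\<exists>C\<ge>1. \<forall>(M::nat) L (g::real poly) (q::int) b x. degree g \<le> k \<longrightarrow> 1 \<le> L \<longrightarrow> L \<le> real M \<longrightarrow>
     real M \<le> C0 * L ^ 3 \<longrightarrow> 1 \<le> q \<longrightarrow> coprime b q \<longrightarrow> \<bar>coeff g k - of_int b / of_int q\<bar> \<le> 1 / of_int q ^ 2 \<longrightarrow>
     L \<le> C0 * of_int q \<longrightarrow> of_int q \<le> C0 * real M ^ k / L \<longrightarrow> x \<le> M \<longrightarrow>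
     cmod (\<Sum>m<x. e (poly g (real m))) \<le> C * real M * L powr (- \<sigma>)"
proof -
  define n where "n = k - 1"
  define t where "t = tri n"
  \<comment> \<open>Two losses \<open>M powr \<epsilon>\<close> occur, one from the harmonic sum and
    one from the mean value. As \<open>M \<le> C0 * L ^ 3\<close>, together they cost at most
    \<open>C0 * L powr (6 * \<epsilon>)\<close>, that is
    \<open>C0 * L powr \<sigma>\<close>.\<close>
  define \<epsilon> where "\<epsilon> = \<sigma> / 6"
  have n: "n \<ge> 1" using k by (simp add: n_def)
  have t1: "t \<ge> 1" unfolding t_def by (rule tri_ge_1[OF n])
  have t2: "2 * t = k * (k - 1)" unfolding t_def double_tri using k by (simp add: n_def)
  have tt: "tri (k - 2) + n = t"
  proof -
    obtain i where "k = i + 2" using k le_Suc_ex[of 2 k] by auto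
    then have "2 * (tri (k - 2) + n) = 2 * t"
      unfolding t2 distrib_left double_tri by (simp add: n_def algebra_simps)
    then show ?thesis by simp
  qed
  have \<sigma>: "\<sigma> > 0" "\<sigma> \<le> 1" "\<sigma> * real (2 * t) = 1 - 2 * \<sigma>"
  proof -
    have s: "\<sigma> * (real (2 * t) + 2) = 1" unfolding \<sigma>_def t2
      using of_nat_0_le_iff[of "k * (k - 1)", where 'a = real] by (simp del: of_nat_mult of_nat_0_le_iff)
    then show "\<sigma> * real (2 * t) = 1 - 2 * \<sigma>" by (simp add: distrib_left)
    show "\<sigma> > 0" "\<sigma> \<le> 1"
      using of_nat_0_le_iff[of "k * (k - 1)", where 'a = real] unfolding \<sigma>_def by (simp_all del: of_nat_mult of_nat_0_le_iff)
  qed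
  have \<epsilon>: "\<epsilon> > 0" "2 * \<epsilon> \<le> 1" "6 * \<epsilon> = \<sigma>" using \<sigma> by (auto simp: \<epsilon>_def)
  obtain Cv where Cv: "Cv \<ge> 1" "\<And>X. X \<ge> 1 \<Longrightarrow> real (card {(f, g). f \<in> tuples t X \<and> g \<in> tuples t X \<and>
      (\<forall>j\<in>{1..n}. power_sum t j f = power_sum t j g)}) \<le> Cv * real X powr (real t + \<epsilon>)"
    using vinogradov_mean_value[OF n \<epsilon>(1)] unfolding t_def by blast
  define Ch where "Ch = 1 + ln (2 * C0) + real k / \<epsilon>"
  define A1 where "A1 = real (t + 1) ^ (k - 2)"
  define A2 where "A2 = 2 * real k * real t + 2"
  define C6 where "C6 = A1 * A2 * (2 * Ch) * Cv * (2 * C0 + 2) * C0"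
  have "ln (2 * C0) \<ge> 0" using C0 by simp
  then have Ch: "Ch \<ge> 1" using \<epsilon> by (simp add: Ch_def)
  have A1: "A1 \<ge> 1" unfolding A1_def by (intro one_le_power) simp
  have A2: "A2 \<ge> 1" by (simp add: A2_def)
  have C6: "C6 \<ge> 1"
  proof -
    have 1: "x * y \<ge> 1" if "x \<ge> 1" "y \<ge> 1" for x y :: real using mult_mono[of 1 x 1 y] that by simp
    show ?thesis unfolding C6_def using A1 A2 Ch Cv C0 by (intro 1) auto
  qed
  have main: "cmod (\<Sum>m<x. e (poly g (real m))) \<le> (C6 + 4) * real M * L powr (- \<sigma>)"
    if h: "degree g \<le> k" "1 \<le> L" "L \<le> real M" "real M \<le> C0 * L ^ 3" "1 \<le> q" "coprime b q"
      "\<bar>coeff g k - of_int b / of_int q\<bar> \<le> 1 / of_int q ^ 2" "L \<le> C0 * of_int q" "of_int q \<le> C0 * real M ^ k / L" "x \<le> M"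
    for M x :: nat and L and g :: "real poly" and q b :: int
  proof -
    \<comment> \<open>The size aimed at; with about \<open>R\<close> shifts, the error of each shift
      is of the same order.\<close>
    define R where "R = real M * L powr (- \<sigma>)"
    define Y where "Y = nat \<lceil>R\<rceil>"
    define W where "W = cmod (\<Sum>m<x. e (poly g (real m)))"
    define Fh where "Fh h = cmod (\<Sum>m<x. e (poly g (real m + real h)))" for h :: nat
    have M1: "real M \<ge> 1" using h by linarith
    have "L powr \<sigma> \<le> L powr 1" using \<sigma> h by (intro powr_mono) auto
    then have "L powr \<sigma> \<le> real M" using h by simp
    then have R1: "R \<ge> 1" unfolding R_def using h by (simp add: powr_minus field_simps)
    have Y: "R \<le> real Y" "real Y \<le> 2 * R" "Y \<ge> 1" using R1 unfolding Y_def by linarith+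
    define P where "P = real M powr (2 * \<epsilon>)"
    have Me: "real M powr \<epsilon> \<ge> 1" using M1 \<epsilon> by (intro ge_one_powr_ge_zero) auto
    have harm: "harm (nat (2 * q)) \<le> Ch * real M powr \<epsilon>"
    proof -
      have "of_int q \<le> C0 * real M ^ k"
      proof -
        have "C0 * real M ^ k / L \<le> C0 * real M ^ k / 1" using h C0 by (intro divide_left_mono) auto
        then show ?thesis using h by simp
      qed
      then have "2 * of_int q \<le> (2 * C0) * real M ^ k" by simp
      then have "ln (2 * of_int q) \<le> ln ((2 * C0) * real M ^ k)" using h C0 M1 by (subst ln_le_cancel_iff) auto
      also have "\<dots> = ln (2 * C0) + real k * ln (real M)" using C0 M1 by (simp add: ln_mult ln_realpow)
      also have "\<dots> \<le> ln (2 * C0) + real k * (real M powr \<epsilon> / \<epsilon>)"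
        using ln_powr_bound[OF M1 \<epsilon>(1)] by (intro add_left_mono mult_left_mono) auto
      finally have l: "ln (2 * of_int q) \<le> ln (2 * C0) + real k / \<epsilon> * real M powr \<epsilon>" by simp
      have "harm (nat (2 * q)) \<le> 1 + ln (2 * real_of_int q)" using harm_le_ln[of "nat (2 * q)"] h by simp
      also have "\<dots> \<le> (1 + ln (2 * C0)) * 1 + real k / \<epsilon> * real M powr \<epsilon>" using l by simp
      also have "\<dots> \<le> (1 + ln (2 * C0)) * real M powr \<epsilon> + real k / \<epsilon> * real M powr \<epsilon>"
        using Me \<open>ln (2 * C0) \<ge> 0\<close> by (intro add_right_mono mult_left_mono) auto
      finally show ?thesis by (simp add: Ch_def distrib_right)
    qed
    \<comment> \<open>Multiplied out, the four terms of Weyl's inequality: \<open>1 / q\<close>,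
      \<open>1 / Y\<close>, \<open>1 / M ^ n\<close> and \<open>q / (M ^ n * Y)\<close>.\<close>
    define u where "u = (1 / of_int q + 1 / real M ^ n) * (1 + of_int q / real Y)"
    have qp: "real_of_int q > 0" using h by simp
    have Yp: "real Y > 0" using Y by simp
    have Mp: "real M > 0" using M1 by simp
    have Lp: "L > 0" using h by simp
    have "x \<le> M" "M \<ge> 1" using h M1 by auto
    have J: "real (card {(f, g). f \<in> tuples t x \<and> g \<in> tuples t x \<and> (\<forall>j\<in>{1..n}. power_sum t j f = power_sum t j g)}) \<le> Cv * real M powr (real t + \<epsilon>)"
    proof (cases "x = 0")
      case True
      then have "tuples t x = {}" using t1 by (auto simp: tuples_def PiE_eq_empty_iff intro!: exI[of _ 0])
      then show ?thesis using Cv by simp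
    next
      case False
      then have "real (card {(f, g). f \<in> tuples t x \<and> g \<in> tuples t x \<and> (\<forall>j\<in>{1..n}. power_sum t j f = power_sum t j g)}) \<le> Cv * real x powr (real t + \<epsilon>)"
        by (intro Cv) simp
      also have "\<dots> \<le> Cv * real M powr (real t + \<epsilon>)"
        using Cv h \<epsilon> by (intro mult_left_mono powr_mono2) auto
      finally show ?thesis .
    qed
    have "(\<Sum>h<Y. Fh h ^ (2 * t)) \<le> A1 * real M ^ tri (k - 2) *
      ((2 * (real k * real t * real M ^ n + 1) / of_int q + 1) * (2 * (real Y + of_int q * harm (nat (2 * q)))) * (Cv * real M powr (real t + \<epsilon>)))"
      unfolding Fh_def A1_def t_def n_def
      by (rule weyl_shift_moment[OF k h(1) \<open>x \<le> M\<close> \<open>M \<ge> 1\<close> h(5-7) J[unfolded t_def n_def]])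
    also have "\<dots> \<le> A1 * real M ^ tri (k - 2) *
      ((A2 * real M ^ n * (1 / of_int q + 1 / real M ^ n)) * (2 * Ch * real M powr \<epsilon> * real Y * (1 + of_int q / real Y)) * (Cv * real M powr (real t + \<epsilon>)))"
    proof (rule mult_left_mono[OF mult_right_mono[OF mult_mono]])
      have Mn: "real M ^ n \<ge> 1" using M1 by (rule one_le_power)
      have "2 * (real k * real t * real M ^ n + 1) \<le> A2 * real M ^ n" using Mn by (simp add: A2_def algebra_simps)
      then have "2 * (real k * real t * real M ^ n + 1) / of_int q \<le> A2 * real M ^ n / of_int q"
        using qp by (intro divide_right_mono) auto
      moreover have "A2 * real M ^ n * (1 / of_int q + 1 / real M ^ n) = A2 * real M ^ n / of_int q + A2"
        using Mp by (simp add: distrib_left)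
      ultimately show "2 * (real k * real t * real M ^ n + 1) / of_int q + 1 \<le> A2 * real M ^ n * (1 / of_int q + 1 / real M ^ n)"
        using A2 by linarith
      have "real_of_int q * harm (nat (2 * q)) \<le> of_int q * (Ch * real M powr \<epsilon>)" using harm qp by (intro mult_left_mono) auto
      moreover have "1 * 1 \<le> Ch * real M powr \<epsilon>" using Ch Me by (intro mult_mono) auto
      then have "real Y * 1 \<le> real Y * (Ch * real M powr \<epsilon>)" using Yp by (intro mult_left_mono) auto
      ultimately have "2 * (real Y + of_int q * harm (nat (2 * q))) \<le> 2 * (Ch * real M powr \<epsilon> * (real Y + of_int q))"
        by (simp add: algebra_simps)
      also have "real Y + of_int q = real Y * (1 + of_int q / real Y)" using Yp by (simp add: field_simps)
      finally show "2 * (real Y + of_int q * harm (nat (2 * q))) \<le> 2 * Ch * real M powr \<epsilon> * real Y * (1 + of_int q / real Y)"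
        by (simp add: mult_ac)
    qed (use A1 A2 Ch Cv qp in \<open>auto simp: harm_nonneg\<close>)
    also have "\<dots> = real Y * ((A1 * A2 * (2 * Ch) * Cv) * u * (real M ^ tri (k - 2) * real M ^ n * (real M powr \<epsilon> * real M powr (real t + \<epsilon>))))"
      by (simp add: u_def mult_ac)
    also have "real M ^ tri (k - 2) * real M ^ n * (real M powr \<epsilon> * real M powr (real t + \<epsilon>)) = real M ^ (2 * t) * P"
    proof -
      have "real M ^ tri (k - 2) * real M ^ n = real M ^ t" by (simp only: power_add[symmetric] tt)
      moreover have "real M powr \<epsilon> * real M powr (real t + \<epsilon>) = real M ^ t * P"
        using Mp by (simp add: P_def powr_add[symmetric] powr_realpow[symmetric] add.commute)
      ultimately show ?thesis by (simp add: mult_2 power_add)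
    qed
    finally have S: "(\<Sum>h<Y. Fh h ^ (2 * t)) \<le> real Y * ((A1 * A2 * (2 * Ch) * Cv) * u * (real M ^ (2 * t) * P))" .
    have uL: "u \<le> (2 * C0 + 2) * L powr (\<sigma> - 1)"
    proof -
      have Ls: "1 / L \<le> L powr (\<sigma> - 1)"
        using powr_mono[of "-1" "\<sigma> - 1" L] \<sigma> h by (simp add: powr_minus_divide)
      have a: "1 / of_int q \<le> C0 * L powr (\<sigma> - 1)"
      proof -
        have "1 / of_int q \<le> C0 * (1 / L)" using h(8) qp Lp by (simp add: field_simps)
        also have "\<dots> \<le> C0 * L powr (\<sigma> - 1)" using Ls C0 by (intro mult_left_mono) auto
        finally show ?thesis .
      qed
      have b: "1 / real Y \<le> L powr (\<sigma> - 1)"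
      proof -
        have "1 / real Y \<le> 1 / R" using Y R1 by (intro divide_left_mono) auto
        also have "\<dots> = L powr \<sigma> / real M" unfolding R_def using Lp by (simp add: powr_minus field_simps)
        also have "\<dots> \<le> L powr \<sigma> / L" using h(3) Lp Mp by (intro divide_left_mono) auto
        also have "\<dots> = L powr (\<sigma> - 1)" using Lp by (simp add: powr_diff)
        finally show ?thesis .
      qed
      have c: "1 / real M ^ n \<le> L powr (\<sigma> - 1)"
      proof -
        have "real M ^ 1 \<le> real M ^ n" using M1 n by (intro power_increasing) auto
        then have "L \<le> real M ^ n" using h(3) unfolding power_one_right by linarith
        then have "1 / real M ^ n \<le> 1 / L" using Lp Mp by (intro divide_left_mono) auto
        then show ?thesis using Ls by linarith
      qed
      have d: "of_int q / (real M ^ n * real Y) \<le> C0 * L powr (\<sigma> - 1)"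
      proof -
        have "of_int q / (real M ^ n * real Y) \<le> (C0 * real M ^ k / L) / (real M ^ n * real Y)"
          using h Mp Yp by (intro divide_right_mono) auto
        also have "\<dots> = C0 * (real M / L) * (1 / real Y)"
        proof -
          have "real M ^ k = real M ^ n * real M" using k by (simp add: n_def flip: power_Suc2)
          then show ?thesis using Mp by simp
        qed
        also have "\<dots> \<le> C0 * (real M / L) * (1 / R)"
          using Y R1 C0 Mp Lp by (intro mult_left_mono divide_left_mono) auto
        also have "\<dots> = C0 * L powr (\<sigma> - 1)" unfolding R_def using Mp Lp by (simp add: powr_minus powr_diff field_simps)
        finally show ?thesis .
      qed
      have "u = 1 / of_int q + 1 / real Y + 1 / real M ^ n + of_int q / (real M ^ n * real Y)"
        unfolding u_def using qp by (simp add: distrib_left distrib_right add_ac add_divide_distrib)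
      also have "\<dots> \<le> C0 * L powr (\<sigma> - 1) + L powr (\<sigma> - 1) + L powr (\<sigma> - 1) + C0 * L powr (\<sigma> - 1)"
        using a b c d by linarith
      finally show ?thesis by (simp add: algebra_simps)
    qed
    have PL: "P \<le> C0 * L powr \<sigma>"
    proof -
      have "P \<le> (C0 * L ^ 3) powr (2 * \<epsilon>)" unfolding P_def using h \<epsilon> by (intro powr_mono2) auto
      also have "\<dots> = C0 powr (2 * \<epsilon>) * (L powr 3) powr (2 * \<epsilon>)" using C0 Lp by (simp add: powr_mult powr_numeral)
      also have "(L powr 3) powr (2 * \<epsilon>) = L powr \<sigma>" using \<epsilon>(3) by (simp add: powr_powr)
      also have "C0 powr (2 * \<epsilon>) \<le> C0" using powr_mono[of "2 * \<epsilon>" 1 C0] C0 \<epsilon> by simp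
      finally show ?thesis using Lp by (simp add: mult_right_mono)
    qed
    \<comment> \<open>This fixes \<open>\<sigma>\<close>: the total saving is
      \<open>L powr (1 - 2 * \<sigma>)\<close>, and distributing it over \<open>2 * t\<close>
      factors must give \<open>L powr \<sigma>\<close> for each.\<close>
    have RP: "real M ^ (2 * t) * L powr (2 * \<sigma> - 1) = R ^ (2 * t)"
    proof -
      have "(L powr (- \<sigma>)) ^ (2 * t) = L powr (- \<sigma> * real (2 * t))" using Lp by (simp add: powr_realpow[symmetric] powr_powr)
      also have "- \<sigma> * real (2 * t) = 2 * \<sigma> - 1" using \<sigma>(3) by simp
      finally show ?thesis by (simp add: R_def power_mult_distrib)
    qed
    have "(A1 * A2 * (2 * Ch) * Cv) * u * (real M ^ (2 * t) * P) \<le> (A1 * A2 * (2 * Ch) * Cv) * ((2 * C0 + 2) * L powr (\<sigma> - 1)) * (real M ^ (2 * t) * (C0 * L powr \<sigma>))"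
    proof (intro mult_mono mult_left_mono uL PL)
      show "0 \<le> u" unfolding u_def using qp Yp by (intro mult_nonneg_nonneg add_nonneg_nonneg) auto
    qed (use A1 A2 Ch Cv C0 in \<open>auto simp: P_def\<close>)
    also have "\<dots> = C6 * (real M ^ (2 * t) * (L powr (\<sigma> - 1) * L powr \<sigma>))" by (simp add: C6_def mult_ac)
    also have "L powr (\<sigma> - 1) * L powr \<sigma> = L powr (2 * \<sigma> - 1)" using Lp by (simp flip: powr_add)
    finally have fin: "(A1 * A2 * (2 * Ch) * Cv) * u * (real M ^ (2 * t) * P) \<le> C6 * R ^ (2 * t)" unfolding RP .
    \<comment> \<open>If the sum were larger, every one of its \<open>Y\<close> shifts would exceed
      \<open>C6 * R\<close>, against the bound for the mean of their powers.\<close>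
    have "W \<le> C6 * R + 2 * real Y"
    proof (rule ccontr)
      assume neg: "\<not> W \<le> C6 * R + 2 * real Y"
      have "(C6 * R) ^ (2 * t) < Fh h ^ (2 * t)" if "h < Y" for h
      proof -
        have "W \<le> Fh h + 2 * real h" unfolding W_def Fh_def
          using sum_shift_diff[of "\<lambda>m. e (poly g (real m))" x h] by simp
        then have "C6 * R < Fh h" using neg that by linarith
        then show ?thesis using C6 R1 t1 by (intro power_strict_mono) auto
      qed
      then have "(\<Sum>h<Y. (C6 * R) ^ (2 * t)) < (\<Sum>h<Y. Fh h ^ (2 * t))"
        using Y by (intro sum_strict_mono) (auto simp: lessThan_empty_iff)
      also have "\<dots> \<le> real Y * (C6 * R ^ (2 * t))" using S fin Yp by (meson mult_left_mono order_trans less_imp_le)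
      finally have "(C6 * R) ^ (2 * t) < C6 * R ^ (2 * t)" using Yp by simp
      moreover have "C6 * R ^ (2 * t) \<le> C6 ^ (2 * t) * R ^ (2 * t)"
        using C6 t1 R1 power_increasing[of 1 "2 * t" C6] by (intro mult_right_mono) auto
      ultimately show False by (simp add: power_mult_distrib)
    qed
    also have "\<dots> \<le> (C6 + 4) * R" using Y by (simp add: distrib_right)
    finally show ?thesis by (simp add: W_def R_def mult.assoc)
  qed
  then show ?thesis using C6 by (intro exI[of _ "C6 + 4"]) auto
qed

section \<open>From sums of polynomial length to arbitrary length\<close>

lemma coeff_pcompose_linear:
  fixes g :: "real poly"
  assumes "degree g \<le> k" "r \<noteq> 0"
  shows "degree (pcompose g [:c, r:]) \<le> k" "coeff (pcompose g [:c, r:]) k = coeff g k * r ^ k"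
proof -
  have d: "degree (pcompose g [:c, r:]) = degree g" using assms by (simp add: degree_pcompose)
  show "degree (pcompose g [:c, r:]) \<le> k" using d assms by simp
  show "coeff (pcompose g [:c, r:]) k = coeff g k * r ^ k"
  proof (cases "degree g = k")
    case True
    then have "lead_coeff (pcompose g [:c, r:]) = lead_coeff g * r ^ k"
      using lead_coeff_comp[of "[:c, r:]" g] assms by simp
    then show ?thesis using d True by simp
  next
    case False
    then show ?thesis using d assms by (simp add: coeff_eq_0)
  qed
qed

text \<open>For \<open>c < R\<close> the number of \<open>y\<close> with
  \<open>c + R * y < M\<close> is \<open>(M - c) / R\<close> rounded up; adding \<open>R - 1\<close>
  first keeps the subtraction of natural numbers exact.\<close>

lemma sum_mod_classes:
  fixes R M :: nat and f :: "nat \<Rightarrow> 'a :: comm_monoid_add"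
  assumes "R \<ge> 1"
  shows "(\<Sum>m<M. f m) = (\<Sum>c<R. \<Sum>y<(M + R - 1 - c) div R. f (c + R * y))"
proof -
  have iff: "y < (M + R - 1 - c) div R \<longleftrightarrow> c + R * y < M" if "c < R" for c y
  proof -
    have "y < (M + R - 1 - c) div R \<longleftrightarrow> Suc y * R \<le> M + R - 1 - c"
      using assms by (simp add: Suc_le_eq[symmetric] less_eq_div_iff_mult_less_eq)
    also have "\<dots> \<longleftrightarrow> c + R * y < M" using that by (auto simp: algebra_simps)
    finally show ?thesis .
  qed
  have "(\<Sum>c<R. \<Sum>y<(M + R - 1 - c) div R. f (c + R * y)) = (\<Sum>(c, y)\<in>Sigma {..<R} (\<lambda>c. {..<(M + R - 1 - c) div R}). f (c + R * y))"
    by (simp add: sum.Sigma)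
  also have "\<dots> = (\<Sum>m<M. f m)"
    using assms iff
    by (intro sum.reindex_bij_witness[of _ "\<lambda>m. (m mod R, m div R)" "\<lambda>(c, y). c + R * y"]) auto
  finally show ?thesis ..
qed

lemma real_Dirichlet_approx:
  fixes \<beta> X :: real
  assumes X: "X > 0"
  obtains q a :: int where "1 \<le> q" "of_int q \<le> X + 1" "coprime a q"
    "\<bar>of_int q * \<beta> - of_int a\<bar> < 1 / X" "\<bar>\<beta> - of_int a / of_int q\<bar> \<le> 1 / of_int q ^ 2"
proof -
  define N where "N = nat \<lceil>X\<rceil>"
  have N: "N > 0" "real N \<ge> X" "real N \<le> X + 1" unfolding N_def using X by linarith+
  obtain a q where aq: "coprime a q" "0 < q" "q \<le> int N" "\<bar>of_int q * \<beta> - of_int a\<bar> < 1 / real N"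
    using Dirichlet_approx_coprime[OF N(1)] by blast
  have qN: "real_of_int q \<le> real N" using aq(3) by linarith
  have "1 / real N \<le> 1 / X" using N X by (intro divide_left_mono) auto
  then have 1: "\<bar>of_int q * \<beta> - of_int a\<bar> < 1 / X" using aq(4) by linarith
  have "\<bar>\<beta> - of_int a / of_int q\<bar> = \<bar>of_int q * \<beta> - of_int a\<bar> / of_int q"
    using aq(2) by (simp add: field_simps abs_if)
  also have "\<dots> \<le> (1 / real N) / of_int q" using aq by (intro divide_right_mono) auto
  also have "\<dots> \<le> (1 / of_int q) / of_int q"
    using aq qN N by (intro divide_right_mono divide_left_mono) auto
  also have "\<dots> = 1 / of_int q ^ 2" by (simp add: power2_eq_square)
  finally show ?thesis using that[of q a] aq 1 qN N by auto
qed

text \<open>No power of \<open>M\<close> is lost: if \<open>\<beta>\<close> first becomes well approximable at the scale \<open>K\<close>, then on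
  progressions inside blocks of length \<open>K\<close> whose step is \<open>1\<close> modulo the denominator, the number of
  terms can be made polynomial in \<open>L\<close> while the leading coefficient stays equally far from
  fractions with denominator at most \<open>L\<close>.\<close>

lemma weyl_minor_arc:
  fixes k :: nat
  defines "\<sigma> \<equiv> 1 / (real (k * (k - 1)) + 2)"
  assumes k: "k \<ge> 2"
  shows "\<exists>C\<ge>1. \<forall>(M::nat) L (g::real poly). degree g \<le> k \<longrightarrow> 1 \<le> L \<longrightarrow> L \<le> real M \<longrightarrow>
     (\<forall>(q::int) (a::int). 1 \<le> q \<longrightarrow> of_int q \<le> L \<longrightarrow> \<bar>of_int q * coeff g k - of_int a\<bar> \<ge> L / real M ^ k) \<longrightarrow>
     cmod (\<Sum>m<M. e (poly g (real m))) \<le> C * real M * L powr (- \<sigma>)"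
proof -
  define C0 :: real where "C0 = 2 ^ (k + 1) + 6"
  have C0: "C0 \<ge> 6" by (simp add: C0_def)
  obtain C where C: "C \<ge> 1" "\<And>(M::nat) L (g::real poly) (q::int) b x. degree g \<le> k \<Longrightarrow> 1 \<le> L \<Longrightarrow> L \<le> real M \<Longrightarrow>
     real M \<le> C0 * L ^ 3 \<Longrightarrow> 1 \<le> q \<Longrightarrow> coprime b q \<Longrightarrow> \<bar>coeff g k - of_int b / of_int q\<bar> \<le> 1 / of_int q ^ 2 \<Longrightarrow>
     L \<le> C0 * of_int q \<Longrightarrow> of_int q \<le> C0 * real M ^ k / L \<Longrightarrow> x \<le> M \<Longrightarrow>
     cmod (\<Sum>m<x. e (poly g (real m))) \<le> C * real M * L powr (- \<sigma>)"
    using weyl_bound[OF k, of C0] C0 unfolding \<sigma>_def by force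
  have main: "cmod (\<Sum>m<M. e (poly g (real m))) \<le> (2 * C) * real M * L powr (- \<sigma>)"
    if g: "degree g \<le> k" and L: "1 \<le> L" "L \<le> real M"
      and far: "\<And>q a :: int. 1 \<le> q \<Longrightarrow> of_int q \<le> L \<Longrightarrow> \<bar>of_int q * coeff g k - of_int a\<bar> \<ge> L / real M ^ k"
    for M :: nat and L and g :: "real poly"
  proof -
    define \<beta> where "\<beta> = coeff g k"
    \<comment> \<open>The shortest scale considered. The factor 2 ensures that a length
      \<open>M1 \<ge> M0\<close> satisfies \<open>4 * L\<^sup>2 \<le> M1 ^ k\<close>, which is
      needed to compare two rational approximations below.\<close>
    define M0 where "M0 = nat \<lceil>2 * L\<rceil>"
    have M0: "2 * L \<le> real M0" "real M0 \<le> 3 * L" unfolding M0_def using L by linarith+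
    have L3: "L \<le> L ^ 3" "L ^ 2 \<le> L ^ 3" using L power_increasing[of 1 3 L] power_increasing[of 2 3 L] by auto
    have Lp: "L powr (- \<sigma>) > 0" using L by simp
    have Mp: "real M > 0" using L by linarith
    have Xq: "of_int q \<le> C0 * X ^ k / L" if "of_int q \<le> X ^ k / L + 1" "X \<ge> L" for X :: real and q :: int
    proof -
      have "L \<le> X ^ k" using power_increasing[of 1 k X] k that L by simp
      then have "1 \<le> X ^ k / L" using L by simp
      then have "of_int q \<le> 2 * (X ^ k / L)" using that by linarith
      also have "\<dots> \<le> C0 * (X ^ k / L)" using C0 \<open>1 \<le> X ^ k / L\<close> by (intro mult_right_mono) auto
      finally show ?thesis by simp
    qed
    have qL: "L \<le> C0 * of_int q" if "of_int q \<ge> L" for q :: int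
    proof -
      have "1 * L \<le> C0 * of_int q" using that C0 L by (intro mult_mono) auto
      then show ?thesis by simp
    qed
    have Lcube: "X \<le> C0 * L ^ 3" if "X \<le> 6 * L ^ 2" for X
    proof -
      have "6 * L ^ 2 \<le> C0 * L ^ 3" using C0 L3 L by (intro mult_mono) auto
      then show ?thesis using that by linarith
    qed
    have LL: "L \<le> L ^ 2" using L power_increasing[of 1 2 L] by simp
    show ?thesis
    proof (cases "real M \<le> 3 * L")
      case True
      obtain q a :: int where q: "1 \<le> q" "of_int q \<le> real M ^ k / L + 1" "coprime a q"
        "\<bar>of_int q * \<beta> - of_int a\<bar> < 1 / (real M ^ k / L)" "\<bar>\<beta> - of_int a / of_int q\<bar> \<le> 1 / of_int q ^ 2"
        using real_Dirichlet_approx[of "real M ^ k / L" \<beta>] Mp L by auto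
      have "of_int q \<ge> L"
      proof (rule ccontr)
        assume "\<not> of_int q \<ge> L"
        then have "of_int q \<le> L" by simp
        then show False using far[OF q(1), of a] q(4) by (simp add: \<beta>_def)
      qed
      then have "cmod (\<Sum>m<M. e (poly g (real m))) \<le> C * real M * L powr (- \<sigma>)"
        using q True L LL by (intro C(2)[OF g L _ q(1,3)] Lcube Xq qL) (auto simp: \<beta>_def)
      also have "\<dots> \<le> (2 * C) * real M * L powr (- \<sigma>)" using C Lp by (intro mult_right_mono) auto
      finally show ?thesis .
    next
      case False
      then have M0M: "M0 \<le> M" using M0 by linarith
      have M0p: "real M0 > 0" using M0 L by linarith
      obtain q a :: int where q: "1 \<le> q" "of_int q \<le> real M0 ^ k / L + 1" "coprime a q"
        "\<bar>of_int q * \<beta> - of_int a\<bar> < 1 / (real M0 ^ k / L)" "\<bar>\<beta> - of_int a / of_int q\<bar> \<le> 1 / of_int q ^ 2"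
        using real_Dirichlet_approx[of "real M0 ^ k / L" \<beta>] M0p L by auto
      show ?thesis
      proof (cases "of_int q \<ge> L")
        case True
        \<comment> \<open>No good approximation exists already at scale \<open>M0\<close>. A
          translation leaves the leading coefficient unchanged, so the sum may be cut into blocks of
          length \<open>M0\<close>.\<close>
        define P where "P i n = cmod (\<Sum>y<n. e (poly g (real (i + y))))" for i n
        have "P 0 M \<le> (real M / real M0 + 1) * (C * real M0 * L powr (- \<sigma>))"
        proof (rule subadditive_blocks)
          show "P i (m + n) \<le> P i m + P (i + m) n" for i m n
            unfolding P_def sum_lessThan_add by (rule order_trans[OF norm_triangle_ineq]) (simp add: add.assoc)
          show "P i n \<le> C * real M0 * L powr (- \<sigma>)" if n: "n \<le> M0" for i n
          proof -
            have "P i n = cmod (\<Sum>y<n. e (poly (pcompose g [:real i, 1:]) (real y)))"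
              unfolding P_def by (simp add: poly_pcompose)
            also have "\<dots> \<le> C * real M0 * L powr (- \<sigma>)"
              using q True L LL M0 n coeff_pcompose_linear[OF g, of 1 "real i"]
              by (intro C(2)[OF _ L(1) _ _ q(1,3)] Lcube Xq qL) (auto simp: \<beta>_def)
            finally show ?thesis .
          qed
        qed (use M0 L C Lp in auto)
        also have "\<dots> = (real M + real M0) * (C * L powr (- \<sigma>))" using M0p by (simp add: field_simps)
        also have "\<dots> \<le> (2 * real M) * (C * L powr (- \<sigma>))"
          using M0M C Lp by (intro mult_right_mono) auto
        finally show ?thesis by (simp add: P_def mult_ac)
      next
        case False
        define \<delta> where "\<delta> = \<bar>of_int q * \<beta> - of_int a\<bar>"
        have \<delta>: "L / real M ^ k \<le> \<delta>" "\<delta> < L / real M0 ^ k"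
          using far[OF q(1), of a] q(4) False by (auto simp: \<delta>_def \<beta>_def)
        have \<delta>p: "\<delta> > 0" using \<delta>(1) L Mp by (meson divide_pos_pos less_le_trans zero_less_power zero_less_one)
        \<comment> \<open>The scale at which the approximation by \<open>a / q\<close> reaches the
          threshold: \<open>\<delta> = L / K ^ k\<close>. By assumption it lies between
          \<open>M0\<close> and \<open>M\<close>.\<close>
        define K where "K = (L / \<delta>) powr (1 / real k)"
        have Kk: "K ^ k = L / \<delta>" unfolding K_def using \<delta>p L k by (intro powr_inverse_power) auto
        have K0: "K \<ge> 0" by (simp add: K_def)
        have KM: "K \<le> real M"
        proof (rule power_le_imp_le_base[of _ "k - 1"])
          have "K ^ k \<le> real M ^ k" unfolding Kk using \<delta>(1) \<delta>p Mp by (simp add: field_simps)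
          then show "K ^ Suc (k - 1) \<le> real M ^ Suc (k - 1)" using k by simp
        qed simp
        have KM0: "real M0 \<le> K"
        proof (rule power_le_imp_le_base[of _ "k - 1"])
          have "real M0 ^ k \<le> K ^ k" unfolding Kk using \<delta>(2) \<delta>p M0p by (simp add: field_simps)
          then show "real M0 ^ Suc (k - 1) \<le> K ^ Suc (k - 1)" using k by simp
        qed (rule K0)
        have qp: "real_of_int q > 0" using q by simp
        define s where "s = nat \<lfloor>(K / real M0 - 1) / of_int q\<rfloor>"
        \<comment> \<open>The largest number congruent to 1 modulo \<open>q\<close> that does not
          exceed \<open>K / M0\<close>. It is prime to \<open>q\<close>, and since the next
          candidate \<open>R + q\<close> is too large, \<open>K / R\<close> is at most
          \<open>M0 * (1 + q)\<close>, quadratic in \<open>L\<close>.\<close>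
        define R where "R = 1 + nat q * s"
        have KM1: "K / real M0 \<ge> 1" using KM0 M0p by simp
        have s: "real s \<le> (K / real M0 - 1) / of_int q" "(K / real M0 - 1) / of_int q < real s + 1"
        proof -
          have "(K / real M0 - 1) / of_int q \<ge> 0" using KM1 qp by simp
          then show "real s \<le> (K / real M0 - 1) / of_int q" "(K / real M0 - 1) / of_int q < real s + 1"
            unfolding s_def by linarith+
        qed
        have Rr: "real R = 1 + of_int q * real s" using q by (simp add: R_def)
        have R1: "real R \<ge> 1" "real R > 0" unfolding Rr using qp by (auto intro: add_pos_nonneg)
        have RK: "real R \<le> K / real M0" using s(1) qp unfolding Rr by (simp add: field_simps)
        have RK2: "K / real M0 < real R + of_int q" using s(2) qp unfolding Rr by (simp add: field_simps)
        define M1 where "M1 = nat \<lfloor>K / real R\<rfloor>"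
        have "K / real R \<ge> real M0" using RK R1 M0p by (simp add: field_simps)
        then have "int M0 \<le> \<lfloor>K / real R\<rfloor>" by (simp add: le_floor_iff)
        then have i: "int M0 \<le> \<lfloor>K / real R\<rfloor>" "int M1 = \<lfloor>K / real R\<rfloor>" unfolding M1_def by linarith+
        then have M1: "real M1 \<le> K / real R" "K / real R < real M1 + 1" "real M0 \<le> real M1"
          by linarith+
        have M1L: "real M1 \<ge> 2 * L" using M1 M0 by linarith
        have M1p: "real M1 > 0" using M1L L by linarith
        have M1u: "real M1 \<le> 6 * L ^ 2"
        proof -
          have "K / real R \<le> real M0 * (1 + of_int q)"
          proof -
            have "K \<le> real M0 * (real R + of_int q)" using RK2 M0p by (simp add: field_simps)
            also have "\<dots> \<le> real M0 * (real R * (1 + of_int q))"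
              using R1 qp mult_right_mono[of 1 "real R" "of_int q"] by (intro mult_left_mono) (auto simp: distrib_left)
            finally show ?thesis using R1 by (simp add: field_simps)
          qed
          also have "\<dots> \<le> (3 * L) * (L + L)" using M0 False L qp by (intro mult_mono) auto
          finally show ?thesis using M1(1) by (simp add: power2_eq_square)
        qed
        have RM: "real R * real M1 \<le> real M" using M1(1) R1 KM by (simp add: field_simps)
        \<comment> \<open>The leading coefficient along a progression with step \<open>R\<close>.
          The fraction \<open>a' / q\<close> remains reduced and the defect is multiplied by
          \<open>R ^ k\<close>, so that it sits at the threshold for the length
          \<open>K / R\<close>.\<close>
        define \<beta>' where "\<beta>' = \<beta> * real R ^ k"
        define a' where "a' = a * int R ^ k"
        define \<delta>' where "\<delta>' = \<bar>of_int q * \<beta>' - of_int a'\<bar>"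
        have "of_int q * \<beta>' - of_int a' = (of_int q * \<beta> - of_int a) * real R ^ k"
          by (simp add: \<beta>'_def a'_def algebra_simps)
        then have "\<delta>' = \<delta> * real R ^ k" by (simp add: \<delta>'_def \<delta>_def abs_mult)
        also have "\<delta> = L / K ^ k" unfolding Kk using \<delta>p L by simp
        finally have \<delta>': "\<delta>' = L / (K / real R) ^ k" using R1 by (simp add: power_divide)
        have KR: "K / real R > 0" using M1 M1p by linarith
        have \<delta>'u: "\<delta>' \<le> L / real M1 ^ k"
          unfolding \<delta>' using M1 M1p L KR by (intro divide_left_mono power_mono mult_pos_pos zero_less_power) auto
        have \<delta>'l: "\<delta>' \<ge> L / (real M1 + 1) ^ k"
          unfolding \<delta>' using M1 M1p L KR by (intro divide_left_mono power_mono mult_pos_pos zero_less_power) auto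
        define X where "X = 2 * (real M1 + 1) ^ k / L"
        have Xp: "X > 0" unfolding X_def using L M1p by simp
        obtain q2 a2 :: int where q2: "1 \<le> q2" "of_int q2 \<le> X + 1" "coprime a2 q2"
          "\<bar>of_int q2 * \<beta>' - of_int a2\<bar> < 1 / X" "\<bar>\<beta>' - of_int a2 / of_int q2\<bar> \<le> 1 / of_int q2 ^ 2"
          using real_Dirichlet_approx[OF Xp, of \<beta>'] by blast
        have MkL: "4 * L ^ 2 \<le> real M1 ^ k"
        proof -
          have "4 * L ^ 2 = (2 * L) ^ 2" by (simp add: power_mult_distrib)
          also have "\<dots> \<le> real M1 ^ 2" using M1L L by (intro power_mono) auto
          also have "\<dots> \<le> real M1 ^ k" using M1L L k by (intro power_increasing) auto
          finally show ?thesis .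
        qed
        have q2L: "L \<le> of_int q2"
        proof (rule ccontr)
          assume "\<not> L \<le> of_int q2"
          then have q2s: "real_of_int q2 \<le> L" by simp
          \<comment> \<open>If \<open>q2 < L\<close>, this determinant of the two approximations is
            an integer of modulus at most 1/2, hence zero. Then \<open>q2\<close> is a multiple of
            \<open>q\<close>, so its defect is at least \<open>\<delta>'\<close>, contradicting the
            quality of the approximation by \<open>a2 / q2\<close>.\<close>
          define D where "D = a2 * q - a' * q2"
          have "real_of_int D = of_int q2 * (of_int q * \<beta>' - of_int a') - of_int q * (of_int q2 * \<beta>' - of_int a2)"
            by (simp add: D_def algebra_simps)
          then have "\<bar>real_of_int D\<bar> \<le> of_int q2 * \<delta>' + of_int q * \<bar>of_int q2 * \<beta>' - of_int a2\<bar>"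
            unfolding \<delta>'_def using qp q2(1)
            by (metis abs_mult abs_of_nonneg abs_triangle_ineq4 less_imp_le of_int_0_le_iff order_trans zero_le_one)
          also have "\<dots> \<le> L * (L / real M1 ^ k) + L * (1 / X)"
            using q2 q2s \<delta>'u False L by (intro add_mono mult_mono) (auto simp: \<delta>'_def)
          also have "L * (1 / X) \<le> L * (L / real M1 ^ k)"
          proof -
            have "1 / X = L / (2 * (real M1 + 1) ^ k)" by (simp add: X_def)
            also have "\<dots> \<le> L / real M1 ^ k"
            proof (intro divide_left_mono)
              have "real M1 ^ k \<le> (real M1 + 1) ^ k" by (intro power_mono) auto
              moreover have "0 \<le> (real M1 + 1) ^ k" by simp
              ultimately show "real M1 ^ k \<le> 2 * (real M1 + 1) ^ k" by linarith
            qed (use L M1p in auto)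
            finally show ?thesis using L by (intro mult_left_mono) auto
          qed
          also have "L * (L / real M1 ^ k) + L * (L / real M1 ^ k) \<le> 1 / 2"
            using MkL L M1p by (simp add: field_simps power2_eq_square)
          finally have "D = 0" by linarith
          then have eq: "a2 * q = a' * q2" by (simp add: D_def)
          have "coprime (int R) q"
          proof -
            have "int R = 1 + q * int s" using q by (simp add: R_def)
            then show ?thesis by (metis coprime_1_left coprime_iff_gcd_eq_1 gcd_add_mult gcd.commute mult.commute add.commute)
          qed
          then have "coprime a' q" using q(3) by (simp add: a'_def)
          moreover have "q dvd a' * q2" by (metis eq dvd_triv_right)
          ultimately have "q dvd q2" by (simp add: coprime_dvd_mult_right_iff coprime_commute)
          then obtain j where j: "q2 = q * j" by auto
          then have "a2 = a' * j" using eq q by simp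
          have j1: "j \<ge> 1" using j q q2(1) by (smt (verit) mult_nonneg_nonpos)
          have "of_int q2 * \<beta>' - of_int a2 = of_int j * (of_int q * \<beta>' - of_int a')"
            by (simp add: j \<open>a2 = a' * j\<close> algebra_simps)
          then have "\<bar>of_int q2 * \<beta>' - of_int a2\<bar> = of_int j * \<delta>'" using j1 by (simp add: abs_mult \<delta>'_def)
          also have "\<dots> \<ge> 1 * \<delta>'" using j1 by (intro mult_right_mono) (auto simp: \<delta>'_def)
          finally have "\<delta>' < 1 / X" using q2(4) by simp
          moreover have "1 / X \<le> L / (real M1 + 1) ^ k" unfolding X_def using L M1p by (simp add: field_simps)
          ultimately show False using \<delta>'l by linarith
        qed
        have q2u: "of_int q2 \<le> C0 * real M1 ^ k / L"
        proof -
          have "(real M1 + 1) ^ k \<le> (2 * real M1) ^ k" using M1L L by (intro power_mono) auto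
          then have "X \<le> 2 * (2 * real M1) ^ k / L" unfolding X_def using L by (intro divide_right_mono) auto
          also have "\<dots> = 2 ^ (k + 1) * (real M1 ^ k / L)" by (simp add: power_mult_distrib)
          finally have "X \<le> 2 ^ (k + 1) * (real M1 ^ k / L)" .
          moreover have "1 \<le> real M1 ^ k / L"
          proof -
            have "L \<le> real M1 ^ k" using MkL LL L by linarith
            then show ?thesis using L by simp
          qed
          ultimately have "of_int q2 \<le> 2 ^ (k + 1) * (real M1 ^ k / L) + 6 * (real M1 ^ k / L)" using q2(2) by linarith
          then show ?thesis by (simp add: C0_def distrib_right add_divide_distrib)
        qed
        have bl: "cmod (\<Sum>y<Z. e (poly g (real (c + R * y)))) \<le> (real Z / real M1 + 1) * (C * real M1 * L powr (- \<sigma>))" for c Z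
        proof -
          define P where "P i n = cmod (\<Sum>y<n. e (poly g (real (c + R * (i + y)))))" for i n
          have "P 0 Z \<le> (real Z / real M1 + 1) * (C * real M1 * L powr (- \<sigma>))"
          proof (rule subadditive_blocks)
            show "P i (m + n) \<le> P i m + P (i + m) n" for i m n
              unfolding P_def sum_lessThan_add by (rule order_trans[OF norm_triangle_ineq]) (simp add: add.assoc)
            show "P i n \<le> C * real M1 * L powr (- \<sigma>)" if n: "n \<le> M1" for i n
            proof -
              have "P i n = cmod (\<Sum>y<n. e (poly (pcompose g [:real (c + R * i), real R:]) (real y)))"
                unfolding P_def by (simp add: poly_pcompose algebra_simps)
              also have "\<dots> \<le> C * real M1 * L powr (- \<sigma>)"
                using q2 q2L q2u L M1L M1u n R1 coeff_pcompose_linear[OF g, of "real R" "real (c + R * i)"]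
                by (intro C(2)[OF _ L(1) _ _ q2(1,3)] Lcube qL) (auto simp: \<beta>_def \<beta>'_def)
              finally show ?thesis .
            qed
          qed (use M1p C Lp in auto)
          then show ?thesis by (simp add: P_def)
        qed
        have Rn: "R \<ge> 1" by (simp add: R_def)
        define Z where "Z c = (M + R - 1 - c) div R" for c
        have ZM: "(\<Sum>c<R. real (Z c)) = real M"
          using sum_mod_classes[OF Rn, of "\<lambda>_. 1 :: real" M] by (simp add: Z_def)
        have "cmod (\<Sum>m<M. e (poly g (real m))) \<le> (\<Sum>c<R. cmod (\<Sum>y<Z c. e (poly g (real (c + R * y)))))"
          unfolding sum_mod_classes[OF Rn, of "\<lambda>m. e (poly g (real m))" M] Z_def by (rule norm_sum)
        also have "\<dots> \<le> (\<Sum>c<R. (real (Z c) / real M1 + 1) * (C * real M1 * L powr (- \<sigma>)))"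
          by (intro sum_mono bl)
        also have "\<dots> = (real M / real M1 + real R) * (C * real M1 * L powr (- \<sigma>))"
          by (simp add: sum.distrib ZM flip: sum_distrib_right sum_divide_distrib)
        also have "\<dots> = (real M + real R * real M1) * (C * L powr (- \<sigma>))" using M1p by (simp add: field_simps)
        also have "\<dots> \<le> (2 * real M) * (C * L powr (- \<sigma>))" using RM C Lp by (intro mult_right_mono) auto
        finally show ?thesis by (simp add: mult_ac)
      qed
    qed
  qed
  then show ?thesis using C(1) by (intro exI[of _ "2 * C"]) auto
qed

subsection \<open>Binary digits\<close>

lemma binary_digit_sum_eq:
  assumes "n < 2 ^ N"
  shows "binary_digit_sum n = (\<Sum>i<N. n div 2 ^ i mod 2)"
proof -
  have z: "n div 2 ^ i mod 2 = 0" if "n < 2 ^ a" "a \<le> i" for a i :: nat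
  proof -
    have "(2::nat) ^ a \<le> 2 ^ i" using that by (intro power_increasing) auto
    then have "n < 2 ^ i" using that by linarith
    then show ?thesis by simp
  qed
  have "(\<Sum>i<a. n div 2 ^ i mod 2) = (\<Sum>i<max n N. n div 2 ^ i mod 2)" if "n < 2 ^ a" "a \<le> max n N" for a
    using that z[OF that(1)] by (intro sum.mono_neutral_left) auto
  from this[of n] this[of N] show ?thesis
    using assms by (simp add: binary_digit_sum_def less_exp)
qed

lemma binary_digit_sum_add:
  assumes k: "k < 2 ^ u"
  shows "binary_digit_sum (k + 2 ^ u * m) = binary_digit_sum k + binary_digit_sum m"
proof -
  define v where "v = m"
  have m: "m < 2 ^ v" by (simp add: v_def less_exp)
  have "k + 2 ^ u * m < 2 ^ u * (m + 1)" using k by simp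
  also have "\<dots> \<le> 2 ^ u * 2 ^ v" using m by (intro mult_le_mono2) simp
  also have "\<dots> = 2 ^ (u + v)" by (simp add: power_add)
  finally have lt: "k + 2 ^ u * m < 2 ^ (u + v)" .
  have low: "(k + 2 ^ u * m) div 2 ^ i mod 2 = k div 2 ^ i mod 2" if "i < u" for i
  proof -
    have "u = i + Suc (u - Suc i)" using that by simp
    then have "(2::nat) ^ u = 2 ^ i * (2 * 2 ^ (u - Suc i))" by (metis power_add power_Suc)
    then have "(k + 2 ^ u * m) div 2 ^ i = k div 2 ^ i + 2 * (2 ^ (u - Suc i) * m)" by (simp add: mult.assoc)
    then show ?thesis by simp
  qed
  have high: "(k + 2 ^ u * m) div 2 ^ (u + i) mod 2 = m div 2 ^ i mod 2" for i
    using k by (simp add: power_add div_mult2_eq)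
  show ?thesis
    unfolding binary_digit_sum_eq[OF lt] sum_lessThan_add binary_digit_sum_eq[OF k] binary_digit_sum_eq[OF m]
    using low high by simp
qed

lemma binary_digit_sum_le: "n < 2 ^ u \<Longrightarrow> binary_digit_sum n \<le> u"
  using sum_bounded_above[of "{..<u}" "\<lambda>i. n div 2 ^ i mod 2" 1] by (simp add: binary_digit_sum_eq)

lemma finite_G [simp]: "finite (G s r)"
  by (rule finite_subset[of _ "{..<2 ^ r}"]) (auto simp: G_def)

lemma card_G_le: "card (G s r) \<le> 2 ^ r"
  using card_mono[of "{..<2 ^ r}" "G s r"] by (auto simp: G_def)

text \<open>Digit sums add because \<open>k + 2 ^ u * m\<close> with \<open>k < 2 ^ u\<close>
  produces no carries; \<open>j\<close> is the digit sum of the low part.\<close>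

lemma sum_G_split:
  fixes \<phi> :: "nat \<Rightarrow> 'a :: comm_monoid_add"
  shows "(\<Sum>n\<in>G s (u + v). \<phi> n) = (\<Sum>j\<in>{..min s u}. \<Sum>m\<in>G (s - j) v. \<Sum>k\<in>G j u. \<phi> (k + 2 ^ u * m))"
proof -
  have "(\<Sum>j\<in>{..min s u}. \<Sum>m\<in>G (s - j) v. \<Sum>k\<in>G j u. \<phi> (k + 2 ^ u * m)) =
      (\<Sum>(j, m, k)\<in>Sigma {..min s u} (\<lambda>j. G (s - j) v \<times> G j u). \<phi> (k + 2 ^ u * m))"
    by (simp add: sum.Sigma sum.cartesian_product)
  also have "\<dots> = (\<Sum>n\<in>G s (u + v). \<phi> n)"
  proof (rule sum.reindex_bij_witness[of _ "\<lambda>n. (binary_digit_sum (n mod 2 ^ u), n div 2 ^ u, n mod 2 ^ u)" "\<lambda>(j, m, k). k + 2 ^ u * m"])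
    fix n assume n: "n \<in> G s (u + v)"
    have split: "n mod 2 ^ u + 2 ^ u * (n div 2 ^ u) = n" by simp
    have b: "binary_digit_sum n = binary_digit_sum (n mod 2 ^ u) + binary_digit_sum (n div 2 ^ u)"
      using binary_digit_sum_add[of "n mod 2 ^ u" u "n div 2 ^ u"] by simp
    have "n div 2 ^ u < 2 ^ v" using n by (simp add: G_def power_add less_mult_imp_div_less mult.commute)
    then show "(binary_digit_sum (n mod 2 ^ u), n div 2 ^ u, n mod 2 ^ u) \<in> Sigma {..min s u} (\<lambda>j. G (s - j) v \<times> G j u)"
      using n b binary_digit_sum_le[of "n mod 2 ^ u" u] by (auto simp: G_def)
  next
    fix y assume y: "y \<in> Sigma {..min s u} (\<lambda>j. G (s - j) v \<times> G j u)"
    obtain j m k where jmk: "y = (j, m, k)" by (cases y) auto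
    have h: "j \<le> s" "k < 2 ^ u" "m < 2 ^ v" "binary_digit_sum k = j" "binary_digit_sum m = s - j"
      using y by (auto simp: jmk G_def)
    have "k + 2 ^ u * m < 2 ^ u * (m + 1)" using h by simp
    also have "\<dots> \<le> 2 ^ u * 2 ^ v" using h by (intro mult_le_mono2) simp
    finally show "(case y of (j, m, k) \<Rightarrow> k + 2 ^ u * m) \<in> G s (u + v)"
      using h by (simp add: jmk G_def binary_digit_sum_add power_add)
    show "(\<lambda>n. (binary_digit_sum (n mod 2 ^ u), n div 2 ^ u, n mod 2 ^ u)) (case y of (j, m, k) \<Rightarrow> k + 2 ^ u * m) = y"
      using h by (simp add: jmk)
  qed auto
  finally show ?thesis ..
qed

lemma card_G: "card (G s r) = r choose s"
proof (induction r arbitrary: s)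
  case 0
  have "G s 0 = (if s = 0 then {0} else {})" by (auto simp: G_def binary_digit_sum_def)
  then show ?case by (cases s) auto
next
  case (Suc r)
  have b: "binary_digit_sum 0 = 0" "binary_digit_sum 1 = 1" by (simp_all add: binary_digit_sum_def)
  have g: "G 0 1 = {0}" "G 1 1 = {1}"
    using b by (auto simp: G_def less_2_cases_iff)
  have "card (G s (1 + r)) = (\<Sum>j\<in>{..min s 1}. \<Sum>m\<in>G (s - j) r. \<Sum>k\<in>G j 1. 1)"
    using sum_G_split[of "\<lambda>_. 1::nat" s 1 r] by simp
  also have "\<dots> = (\<Sum>j\<in>{..min s 1}. card (G (s - j) r) * card (G j 1))" by simp
  also have "\<dots> = Suc r choose s"
  proof (cases s)
    case 0
    then show ?thesis using g Suc.IH by simp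
  next
    case (Suc s')
    then have "{..min s 1} = {0, 1}" by auto
    then show ?thesis using g Suc.IH by (simp add: Suc)
  qed
  finally show ?case by simp
qed

text \<open>The splitting applied to the constant 1. It reassembles the weights of the different
  \<open>j\<close> into a single binomial coefficient, so that Cauchy--Schwarz preserves the
  dependence on \<open>s\<close>.\<close>

lemma vandermonde_G:
  "(\<Sum>j\<in>{..min s u}. real (card (G (s - j) v)) * real (card (G j u))) = real ((u + v) choose s)"
proof -
  have "card (G s (u + v)) = (\<Sum>j\<in>{..min s u}. card (G (s - j) v) * card (G j u))"
    using sum_G_split[of "\<lambda>_. 1::nat" s u v] by simp
  then show ?thesis unfolding card_G by simp
qed

text \<open>Cauchy--Schwarz over the high digits, which are then completed to a full interval.\<close>

lemma cauchy_digits: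
  assumes \<phi>: "\<And>n. cmod (\<phi> n) = 1" and W: "W \<ge> 0"
    and off: "\<And>k k'. k < 2 ^ u \<Longrightarrow> k' < 2 ^ u \<Longrightarrow> k \<noteq> k' \<Longrightarrow>
      cmod (\<Sum>m<2 ^ v. \<phi> (k + 2 ^ u * m) * cnj (\<phi> (k' + 2 ^ u * m))) \<le> W"
  shows "cmod (\<Sum>n\<in>G s (u + v). \<phi> n) ^ 2 \<le> real (u + 1) * real ((u + v) choose s) * (2 ^ v + 2 ^ u * W)"
proof -
  define T where "T j m = (\<Sum>k\<in>G j u. \<phi> (k + 2 ^ u * m))" for j m
  have diag: "(\<Sum>m<2 ^ v. cmod (T j m) ^ 2) \<le> real (card (G j u)) * (2 ^ v + 2 ^ u * W)" for j
  proof -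
    define E where "E k k' = (\<Sum>m<2 ^ v. \<phi> (k + 2 ^ u * m) * cnj (\<phi> (k' + 2 ^ u * m)))" for k k'
    have "complex_of_real (\<Sum>m<2 ^ v. cmod (T j m) ^ 2) = (\<Sum>m<2 ^ v. \<Sum>k\<in>G j u. \<Sum>k'\<in>G j u. \<phi> (k + 2 ^ u * m) * cnj (\<phi> (k' + 2 ^ u * m)))"
      unfolding T_def by (simp only: of_real_sum cmod_sum_sq)
    also have "\<dots> = (\<Sum>k\<in>G j u. \<Sum>m<2 ^ v. \<Sum>k'\<in>G j u. \<phi> (k + 2 ^ u * m) * cnj (\<phi> (k' + 2 ^ u * m)))"
      by (rule sum.swap)
    also have "\<dots> = (\<Sum>k\<in>G j u. \<Sum>k'\<in>G j u. E k k')"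
      unfolding E_def by (rule sum.cong[OF refl], rule sum.swap)
    finally have eq: "complex_of_real (\<Sum>m<2 ^ v. cmod (T j m) ^ 2) = (\<Sum>k\<in>G j u. \<Sum>k'\<in>G j u. E k k')" .
    \<comment> \<open>Schur bound for the Gram matrix: one diagonal entry of size
      \<open>2 ^ v\<close> and at most \<open>2 ^ u\<close> others, each bounded by
      \<open>W\<close>.\<close>
    have row: "(\<Sum>k'\<in>G j u. cmod (E k k')) \<le> 2 ^ v + 2 ^ u * W" if k: "k \<in> G j u" for k
    proof -
      have "cmod (E k k) \<le> (\<Sum>m<(2::nat) ^ v. 1)"
        unfolding E_def by (intro sum_norm_le) (simp add: norm_mult \<phi>)
      then have 1: "cmod (E k k) \<le> 2 ^ v" by simp
      have "(\<Sum>k'\<in>G j u - {k}. cmod (E k k')) \<le> (\<Sum>k'\<in>G j u - {k}. W)"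
        unfolding E_def using k by (intro sum_mono off) (auto simp: G_def)
      also have "\<dots> \<le> (\<Sum>k'\<in>G j u. W)" using W by (intro sum_mono2) auto
      also have "\<dots> \<le> 2 ^ u * W"
      proof -
        have "real (card (G j u)) \<le> real (2 ^ u)" using card_G_le by (simp only: of_nat_le_iff)
        then show ?thesis using W by (simp add: mult_right_mono)
      qed
      finally show ?thesis using 1 k by (simp add: sum.remove)
    qed
    have "(\<Sum>m<2 ^ v. cmod (T j m) ^ 2) = cmod (\<Sum>k\<in>G j u. \<Sum>k'\<in>G j u. E k k')"
      unfolding eq[symmetric] norm_of_real by (simp add: sum_nonneg)
    also have "\<dots> \<le> (\<Sum>k\<in>G j u. \<Sum>k'\<in>G j u. cmod (E k k'))"
      by (intro order_trans[OF norm_sum] sum_mono norm_sum)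
    also have "\<dots> \<le> (\<Sum>k\<in>G j u. 2 ^ v + 2 ^ u * W)" by (intro sum_mono row)
    finally show ?thesis by simp
  qed
  have TT: "cmod (\<Sum>m\<in>G (s - j) v. T j m) ^ 2 \<le> real (card (G (s - j) v)) * real (card (G j u)) * (2 ^ v + 2 ^ u * W)" for j
  proof -
    have "cmod (\<Sum>m\<in>G (s - j) v. T j m) ^ 2 \<le> (\<Sum>m\<in>G (s - j) v. cmod (T j m)) ^ 2"
      by (intro power_mono norm_sum) auto
    also have "\<dots> \<le> (\<Sum>m\<in>G (s - j) v. cmod (T j m) ^ 2) * real (card (G (s - j) v))"
      by (rule sum_squared_le_sum_of_squares)
    \<comment> \<open>The squares are nonnegative, so the digit condition on \<open>m\<close> may be
      dropped. The condition on \<open>k\<close> is kept and produces the factor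
      \<open>card (G j u)\<close>.\<close>
    also have "(\<Sum>m\<in>G (s - j) v. cmod (T j m) ^ 2) \<le> (\<Sum>m<2 ^ v. cmod (T j m) ^ 2)"
      by (intro sum_mono2) (auto simp: G_def)
    also have "\<dots> \<le> real (card (G j u)) * (2 ^ v + 2 ^ u * W)" by (rule diag)
    finally show ?thesis by (simp add: mult_ac mult_right_mono)
  qed
  have "cmod (\<Sum>n\<in>G s (u + v). \<phi> n) ^ 2 = cmod (\<Sum>j\<in>{..min s u}. \<Sum>m\<in>G (s - j) v. T j m) ^ 2"
    unfolding sum_G_split T_def ..
  also have "\<dots> \<le> (\<Sum>j\<in>{..min s u}. cmod (\<Sum>m\<in>G (s - j) v. T j m)) ^ 2"
    by (intro power_mono norm_sum) auto
  also have "\<dots> \<le> (\<Sum>j\<in>{..min s u}. cmod (\<Sum>m\<in>G (s - j) v. T j m) ^ 2) * real (card {..min s u})"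
    by (rule sum_squared_le_sum_of_squares)
  also have "\<dots> \<le> (\<Sum>j\<in>{..min s u}. real (card (G (s - j) v)) * real (card (G j u)) * (2 ^ v + 2 ^ u * W)) * real (u + 1)"
    using W by (intro mult_mono sum_mono TT sum_nonneg) auto
  also have "(\<Sum>j\<in>{..min s u}. real (card (G (s - j) v)) * real (card (G j u)) * (2 ^ v + 2 ^ u * W)) = real ((u + v) choose s) * (2 ^ v + 2 ^ u * W)"
    unfolding sum_distrib_right[symmetric] vandermonde_G ..
  finally show ?thesis by (simp add: mult_ac)
qed

section \<open>The differenced polynomial and the final choice of parameters\<close>

text \<open>Both translates have the same leading coefficient, which cancels. The next Taylor
  coefficient is affine in the translation, so the difference retains \<open>k - k'\<close> times an
  integer multiple of the leading coefficient of \<open>f\<close>.\<close>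

lemma difference_poly:
  fixes f :: "real poly"
  assumes f: "degree f = Suc \<kappa>"
  obtains g where "degree g \<le> \<kappa>"
    "coeff g \<kappa> = of_int (int l * int (Suc \<kappa>) * int H ^ \<kappa> * (int k - int k')) * coeff f (Suc \<kappa>)"
    "\<And>m. poly g (real m) = real l * (poly f (real (k + H * m)) - poly f (real (k' + H * m)))"
proof -
  define b where "b j = real l * (shift_coeff f (Suc \<kappa>) j (real k) - shift_coeff f (Suc \<kappa>) j (real k')) * real H ^ j" for j
  define g where "g = (\<Sum>j\<le>\<kappa>. monom (b j) j)"
  have "degree g \<le> \<kappa>" unfolding g_def
    by (rule degree_sum_le) (auto intro: order_trans[OF degree_monom_le])
  moreover have "coeff g \<kappa> = of_int (int l * int (Suc \<kappa>) * int H ^ \<kappa> * (int k - int k')) * coeff f (Suc \<kappa>)"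
  proof -
    have "coeff g \<kappa> = b \<kappa>" unfolding g_def by (simp add: coeff_sum)
    also have "\<dots> = real l * (coeff f (Suc \<kappa>) * real (Suc \<kappa>) * (real k - real k')) * real H ^ \<kappa>"
      unfolding b_def using shift_coeff_second[of "Suc \<kappa>" f] by (simp add: right_diff_distrib)
    finally show ?thesis by simp
  qed
  moreover have "poly g (real m) = real l * (poly f (real (k + H * m)) - poly f (real (k' + H * m)))" for m
  proof -
    have p: "poly f (real (c + H * m)) = (\<Sum>j\<le>\<kappa>. shift_coeff f (Suc \<kappa>) j (real c) * (real H ^ j * real m ^ j)) + coeff f (Suc \<kappa>) * (real H * real m) ^ Suc \<kappa>" for c
    proof -
      have "poly f (real (c + H * m)) = poly f (real H * real m + real c)" by (simp add: add.commute)
      also have "\<dots> = (\<Sum>j\<le>Suc \<kappa>. shift_coeff f (Suc \<kappa>) j (real c) * (real H * real m) ^ j)"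
        by (rule poly_shift_coeff) (simp add: f)
      finally show ?thesis by (simp add: shift_coeff_top power_mult_distrib)
    qed
    have "poly g (real m) = (\<Sum>j\<le>\<kappa>. b j * real m ^ j)" by (simp add: g_def poly_sum poly_monom)
    also have "\<dots> = real l * ((\<Sum>j\<le>\<kappa>. shift_coeff f (Suc \<kappa>) j (real k) * (real H ^ j * real m ^ j)) - (\<Sum>j\<le>\<kappa>. shift_coeff f (Suc \<kappa>) j (real k') * (real H ^ j * real m ^ j)))"
      unfolding b_def sum_subtractf[symmetric] sum_distrib_left by (intro sum.cong refl) (simp add: algebra_simps)
    finally show ?thesis unfolding p by simp
  qed
  ultimately show ?thesis using that by blast
qed

text \<open>The new leading coefficient is an integer \<open>cc\<close> times that of
  \<open>f\<close>. For \<open>q' \<le> L\<close> the product \<open>q' * cc\<close> is nonzero and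
  at most \<open>q / 2\<close> in modulus, so its multiple of the coefficient stays at distance
  \<open>1 / (2 * q)\<close> from the integers. The upper bound for \<open>q\<close> makes this at
  least the threshold of the minor arc bound.\<close>

lemma digit_difference_sum:
  fixes \<kappa> :: nat
  defines "\<sigma> \<equiv> 1 / (real (\<kappa> * (\<kappa> - 1)) + 2)"
  assumes \<kappa>: "\<kappa> \<ge> 2"
  shows "\<exists>C\<ge>1. \<forall>(f::real poly) (a::int) (q::int) (l::nat) (u::nat) (v::nat) L (k::nat) (k'::nat).
    degree f = Suc \<kappa> \<longrightarrow> 1 \<le> q \<longrightarrow> coprime a q \<longrightarrow> \<bar>coeff f (Suc \<kappa>) - of_int a / of_int q\<bar> \<le> 1 / of_int q ^ 2 \<longrightarrow>
    1 \<le> l \<longrightarrow> 0 < L \<longrightarrow> L \<le> 2 ^ v \<longrightarrow> 2 * L * real (Suc \<kappa>) * real l * (2 ^ u) ^ Suc \<kappa> \<le> of_int q \<longrightarrow>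
    2 * of_int q * L \<le> (2 ^ v) ^ \<kappa> \<longrightarrow> k < 2 ^ u \<longrightarrow> k' < 2 ^ u \<longrightarrow> k \<noteq> k' \<longrightarrow>
    cmod (\<Sum>m<2 ^ v. e (real l * poly f (real (k + 2 ^ u * m))) * cnj (e (real l * poly f (real (k' + 2 ^ u * m)))))
      \<le> C * 2 ^ v * L powr (- \<sigma>)"
proof -
  obtain C where C: "C \<ge> 1" "\<And>(M::nat) L (g::real poly). degree g \<le> \<kappa> \<Longrightarrow> 1 \<le> L \<Longrightarrow> L \<le> real M \<Longrightarrow>
     (\<And>(q::int) (a::int). 1 \<le> q \<Longrightarrow> of_int q \<le> L \<Longrightarrow> \<bar>of_int q * coeff g \<kappa> - of_int a\<bar> \<ge> L / real M ^ \<kappa>) \<Longrightarrow>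
     cmod (\<Sum>m<M. e (poly g (real m))) \<le> C * real M * L powr (- \<sigma>)"
    using weyl_minor_arc[OF \<kappa>] unfolding \<sigma>_def by force
  have "cmod (\<Sum>m<2 ^ v. e (real l * poly f (real (k + 2 ^ u * m))) * cnj (e (real l * poly f (real (k' + 2 ^ u * m)))))
      \<le> C * 2 ^ v * L powr (- \<sigma>)"
    if h: "degree f = Suc \<kappa>" "1 \<le> q" "coprime a q" "\<bar>coeff f (Suc \<kappa>) - of_int a / of_int q\<bar> \<le> 1 / of_int q ^ 2"
      "1 \<le> l" "0 < L" "L \<le> 2 ^ v" "2 * L * real (Suc \<kappa>) * real l * (2 ^ u) ^ Suc \<kappa> \<le> of_int q"
      "2 * of_int q * L \<le> (2 ^ v) ^ \<kappa>" "k < 2 ^ u" "k' < 2 ^ u" "k \<noteq> k'"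
    for f :: "real poly" and a q :: int and l u v k k' :: nat and L
  \<comment> \<open>Below 1 the factor \<open>L powr (- \<sigma>)\<close> is at least 1 and the
    trivial bound suffices.\<close>
  proof (cases "L < 1")
    case True
    have "cmod (\<Sum>m<(2::nat) ^ v. e (real l * poly f (real (k + 2 ^ u * m))) * cnj (e (real l * poly f (real (k' + 2 ^ u * m))))) \<le> (\<Sum>m<(2::nat) ^ v. 1)"
      by (intro sum_norm_le) (simp add: norm_mult)
    also have "\<dots> = 1 * 2 ^ v * 1" by simp
    also have "\<dots> \<le> C * 2 ^ v * L powr (- \<sigma>)"
    proof (intro mult_mono)
      have "L powr 0 \<le> L powr (- \<sigma>)" using True h(6) by (intro powr_mono') (auto simp: \<sigma>_def)
      then show "1 \<le> L powr (- \<sigma>)" using h(6) by simp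
    qed (use C in auto)
    finally show ?thesis .
  next
    case False
    define H :: nat where "H = 2 ^ u"
    define cc where "cc = int l * int (Suc \<kappa>) * int H ^ \<kappa> * (int k - int k')"
    obtain g where g: "degree g \<le> \<kappa>" "coeff g \<kappa> = of_int cc * coeff f (Suc \<kappa>)"
      "\<And>m. poly g (real m) = real l * (poly f (real (k + H * m)) - poly f (real (k' + H * m)))"
      using difference_poly[OF h(1), of l H k k'] unfolding cc_def by metis
    have far: "L / real (2 ^ v) ^ \<kappa> \<le> \<bar>of_int q' * coeff g \<kappa> - of_int n\<bar>" if q': "1 \<le> q'" "of_int q' \<le> L" for q' n :: int
    proof -
      have H: "int H > 0" by (simp add: H_def)
      have "q' * cc \<noteq> 0" using q' h H by (simp add: cc_def)
      moreover have "2 * \<bar>q' * cc\<bar> \<le> q"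
      proof -
        have "\<bar>int k - int k'\<bar> \<le> int H" using h(10,11) unfolding H_def[symmetric] by linarith
        then have "real_of_int \<bar>int k - int k'\<bar> \<le> of_int (int H)" by (simp only: of_int_le_iff)
        then have kk: "real_of_int \<bar>int k - int k'\<bar> \<le> real H" by simp
        have "real_of_int (2 * \<bar>q' * cc\<bar>) = 2 * of_int q' * (real (Suc \<kappa>) * real l * real H ^ \<kappa> * of_int \<bar>int k - int k'\<bar>)"
          using q'(1) by (simp add: cc_def abs_mult)
        also have "\<dots> \<le> 2 * L * (real (Suc \<kappa>) * real l * real H ^ \<kappa> * real H)"
          using q' kk by (intro mult_mono mult_left_mono) auto
        also have "\<dots> = 2 * L * real (Suc \<kappa>) * real l * (2 ^ u) ^ Suc \<kappa>" by (simp add: H_def mult_ac)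
        also have "\<dots> \<le> of_int q" by (rule h(8))
        finally show ?thesis by (simp only: of_int_le_iff)
      qed
      ultimately have "1 / (2 * of_int q) \<le> \<bar>coeff f (Suc \<kappa>) * of_int (q' * cc) - of_int n\<bar>"
        by (rule rational_approx_spaced[OF h(2-4)])
      moreover have "L / real (2 ^ v) ^ \<kappa> \<le> 1 / (2 * of_int q)" using h(2,9) by (simp add: field_simps)
      ultimately show ?thesis unfolding g(2) by (simp add: mult_ac)
    qed
    have "cmod (\<Sum>m<2 ^ v. e (poly g (real m))) \<le> C * real (2 ^ v) * L powr (- \<sigma>)"
      using False h(7) by (intro C(2) g(1) far) auto
    moreover have "e (real l * poly f (real (k + 2 ^ u * m))) * cnj (e (real l * poly f (real (k' + 2 ^ u * m)))) = e (poly g (real m))" for m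
      unfolding g(3) H_def by (simp only: e_uminus[symmetric] e_add[symmetric] diff_conv_add_uminus distrib_left mult_minus_right)
    ultimately show ?thesis by simp
  qed
  then show ?thesis using C(1) by blast
qed

theorem theorem2p14:
  fixes d :: nat
  assumes "d \<ge> 3"
  shows "\<exists>r0 :: nat. \<forall>(f :: real poly) (a :: int) (q :: int) (l :: nat) (s :: nat) (r :: nat).
    degree f = d \<longrightarrow> coeff f 0 = 0 \<longrightarrow>
    q \<ge> 1 \<longrightarrow> gcd a q = 1 \<longrightarrow>
    \<bar>coeff f d - of_int a / of_int q\<bar> < 1 / (of_int q) ^ 2 \<longrightarrow>
    l \<ge> 1 \<longrightarrow> s \<le> r \<longrightarrow> r \<ge> r0 \<longrightarrow>
    cmod (S f r l s) \<le>
      real r * 2 powr (real r / 2) * real (r choose s) powr (1 / 2) *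
      (real l powr eta1 d * of_int q powr (- eta1 d)
       + real l powr vartheta d * 2 powr (- zeta1 d * real r)
       + 2 powr (- zeta2 d * real r)
       + 2 powr (- zeta3 d * real r) * of_int q powr eta2 d) powr (1 / 2)"
proof -
  define \<kappa> where "\<kappa> = d - 1"
  have \<kappa>: "\<kappa> \<ge> 2" "d = Suc \<kappa>" using assms by (auto simp: \<kappa>_def)
  define D where "D = \<kappa> * (\<kappa> - 1)"
  define \<sigma> where "\<sigma> = 1 / (real D + 2)"
  \<comment> \<open>Exponents of \<open>H\<close> in the three conditions on \<open>L\<close>: from
    \<open>l * L * H ^ d\<close> against \<open>q\<close>, from \<open>L * H\<close> against
    \<open>N\<close>, and from \<open>q * L * H ^ \<kappa>\<close> against
    \<open>N ^ \<kappa>\<close>.\<close>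
  define E1 where "E1 = D + 2 + Suc \<kappa>"
  define E2 where "E2 = D + 3"
  define E3 where "E3 = D + 2 + \<kappa>"
  have rD: "real D = real \<kappa> * (real \<kappa> - 1)" using \<kappa> by (simp add: D_def of_nat_diff)
  have ex: "eta1 d = 1 / real E1" "eta2 d = 1 / real E3" "zeta2 d = 1 / real E2" "zeta3 d = real \<kappa> / real E3"
    unfolding eta1_def eta2_def zeta2_def zeta3_def E1_def E2_def E3_def \<kappa>(2)
    by (simp_all add: rD power2_eq_square algebra_simps)
  obtain C where C: "C \<ge> 1" "\<And>(f::real poly) (a::int) (q::int) (l::nat) (u::nat) (v::nat) L (k::nat) (k'::nat).
    degree f = Suc \<kappa> \<Longrightarrow> 1 \<le> q \<Longrightarrow> coprime a q \<Longrightarrow> \<bar>coeff f (Suc \<kappa>) - of_int a / of_int q\<bar> \<le> 1 / of_int q ^ 2 \<Longrightarrow>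
    1 \<le> l \<Longrightarrow> 0 < L \<Longrightarrow> L \<le> 2 ^ v \<Longrightarrow> 2 * L * real (Suc \<kappa>) * real l * (2 ^ u) ^ Suc \<kappa> \<le> of_int q \<Longrightarrow>
    2 * of_int q * L \<le> (2 ^ v) ^ \<kappa> \<Longrightarrow> k < 2 ^ u \<Longrightarrow> k' < 2 ^ u \<Longrightarrow> k \<noteq> k' \<Longrightarrow>
    cmod (\<Sum>m<2 ^ v. e (real l * poly f (real (k + 2 ^ u * m))) * cnj (e (real l * poly f (real (k' + 2 ^ u * m)))))
      \<le> C * 2 ^ v * L powr (- \<sigma>)"
    using digit_difference_sum[OF \<kappa>(1)] unfolding \<sigma>_def D_def by blast
  \<comment> \<open>Rounding \<open>u\<close> up costs a factor \<open>2 ^ E\<close> in each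
    condition. Since \<open>E1\<close> is the largest of the three exponents, a single constant
    compensates all of them.\<close>
  define c :: real where "c = 1 / (2 * real d * 2 ^ E1)"
  define C' where "C' = C * c powr (- \<sigma>)"
  \<comment> \<open>Makes \<open>2 * (1 + C') \<le> r\<close>, so that all constants and the factor
    \<open>u + 1\<close> are absorbed into \<open>r\<^sup>2\<close>.\<close>
  define r0 where "r0 = nat \<lceil>2 * (1 + C')\<rceil> + 2"
  have c: "c > 0" using \<kappa> by (simp add: c_def)
  have c1: "2 * real d * c * 2 ^ E1 \<le> 1" unfolding c_def using \<kappa> by simp
  have c23: "c * 2 ^ E2 \<le> 1" "2 * c * 2 ^ E3 \<le> 1"
  proof -
    have "2 * c * 2 ^ E1 * 1 \<le> 2 * c * 2 ^ E1 * real d" using c \<kappa> by (intro mult_left_mono) auto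
    then have 1: "2 * c * 2 ^ E1 \<le> 1" using c1 by (simp add: mult_ac)
    have "2 * c * 2 ^ E3 \<le> 2 * c * 2 ^ E1" using c by (intro mult_left_mono power_increasing) (auto simp: E1_def E3_def)
    then show "2 * c * 2 ^ E3 \<le> 1" using 1 by linarith
    have "c * 2 ^ E2 \<le> c * 2 ^ E1" using c \<kappa> by (intro mult_left_mono power_increasing) (auto simp: E1_def E2_def)
    moreover have "c * 2 ^ E1 \<le> 2 * c * 2 ^ E1" using c by simp
    ultimately show "c * 2 ^ E2 \<le> 1" using 1 by linarith
  qed
  have main: "cmod (S f r l s) \<le> real r * 2 powr (real r / 2) * real (r choose s) powr (1 / 2) * B powr (1 / 2)"
    if h: "degree f = d" "q \<ge> 1" "gcd a q = 1" "\<bar>coeff f d - of_int a / of_int q\<bar> < 1 / (of_int q) ^ 2"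
      "l \<ge> 1" "r \<ge> r0"
      and B1: "real l powr eta1 d * of_int q powr (- eta1 d) \<le> B"
      and B2: "2 powr (- zeta2 d * real r) \<le> B"
      and B3: "2 powr (- zeta3 d * real r) * of_int q powr eta2 d \<le> B"
    for f :: "real poly" and a q :: int and l s r :: nat and B
  proof -
    define N :: real where "N = 2 ^ r"
    define b where "b = real (r choose s)"
    have N0: "N > 0" by (simp add: N_def)
    have r2: "real r \<ge> 2" "2 * (1 + C') \<le> real r" using h(6) unfolding r0_def by linarith+
    have B0: "B > 0" using B2 by (rule less_le_trans[rotated]) simp
    have qp: "real_of_int q > 0" "real l > 0" using h by auto
    have cS: "cmod (S f r l s) \<le> b"
    proof -
      have "cmod (S f r l s) \<le> (\<Sum>n\<in>G s r. 1)" unfolding S_def by (intro sum_norm_le) simp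
      then show ?thesis by (simp add: b_def card_G)
    qed
    have bN: "0 \<le> b" "b \<le> N"
    proof -
      have "real (card (G s r)) \<le> real (2 ^ r)" using card_G_le by (simp only: of_nat_le_iff)
      then show "b \<le> N" by (simp add: b_def N_def card_G)
    qed (simp add: b_def)
    have "cmod (S f r l s) ^ 2 \<le> real r ^ 2 * N * b * B"
    proof (cases "B \<ge> 1")
      case True
      have "cmod (S f r l s) ^ 2 \<le> b ^ 2" using cS by (intro power_mono) auto
      also have "\<dots> = 1 * b * b * 1" by (simp add: power2_eq_square)
      also have "\<dots> \<le> real r ^ 2 * N * b * B"
        using True bN N0 r2 by (intro mult_mono) auto
      finally show ?thesis .
    next
      case False
      \<comment> \<open>Gives \<open>1 / B \<le> H < 2 / B\<close>: the lower bound makes the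
        diagonal small enough, the upper bound turns the bounds on \<open>B\<close> into conditions
        on \<open>H\<close>.\<close>
      define u where "u = nat \<lceil>log 2 (1 / B)\<rceil>"
      define H :: real where "H = 2 ^ u"
      have lg: "log 2 (1 / B) > 0" using False B0 by simp
      have u: "log 2 (1 / B) \<le> real u" "real u < log 2 (1 / B) + 1" unfolding u_def using lg by linarith+
      have "1 / B = 2 powr (log 2 (1 / B))" using B0 by simp
      also have "\<dots> \<le> 2 powr real u" using u by (intro powr_mono) auto
      finally have HB: "1 / B \<le> H" by (simp add: H_def powr_realpow)
      have "2 powr real u < 2 powr (log 2 (1 / B) + 1)" using u by (intro powr_less_mono) auto
      also have "\<dots> = 2 / B" using B0 by (simp add: powr_add)
      finally have H2: "H < 2 / B" by (simp add: H_def powr_realpow)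
      have H0: "H > 0" by (simp add: H_def)
      have BH: "B \<le> 2 / H" using H2 H0 B0 by (simp add: field_simps)
      have raise: "x * H ^ n \<le> 2 ^ n" if "x powr (1 / real n) \<le> B" "n \<ge> 1" "x \<ge> 0" for x and n :: nat
      proof -
        have "x = (x powr (1 / real n)) ^ n" using that by (simp add: powr_inverse_power)
        also have "\<dots> \<le> (2 / H) ^ n" using that BH by (intro power_mono) auto
        finally show ?thesis using H0 by (simp add: power_divide field_simps)
      qed
      have e1: "real l * H ^ E1 \<le> 2 ^ E1 * of_int q"
      proof -
        have "(real l / of_int q) powr (1 / real E1) \<le> B"
          using B1 qp unfolding ex by (simp add: powr_divide powr_minus_divide)
        then have "real l / of_int q * H ^ E1 \<le> 2 ^ E1" using qp by (intro raise) (auto simp: E1_def)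
        then show ?thesis using qp by (simp add: field_simps)
      qed
      have e2: "H ^ E2 \<le> 2 ^ E2 * N"
      proof -
        have "(1 / N) powr (1 / real E2) = 2 powr (- zeta2 d * real r)"
          unfolding ex N_def by (simp add: powr_divide powr_minus_divide powr_powr flip: powr_realpow)
        then have "(1 / N) powr (1 / real E2) \<le> B" using B2 by simp
        then have "1 / N * H ^ E2 \<le> 2 ^ E2" using N0 by (intro raise) (auto simp: E2_def)
        then show ?thesis using N0 by (simp add: field_simps)
      qed
      have e3: "of_int q * H ^ E3 \<le> 2 ^ E3 * N ^ \<kappa>"
      proof -
        have "(of_int q / N ^ \<kappa>) powr (1 / real E3) = 2 powr (- zeta3 d * real r) * of_int q powr eta2 d"
          unfolding ex N_def using qp
          by (simp add: powr_divide powr_minus_divide powr_powr mult_ac flip: powr_realpow power_mult)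
        then have "(of_int q / N ^ \<kappa>) powr (1 / real E3) \<le> B" using B3 by simp
        then have "of_int q / N ^ \<kappa> * H ^ E3 \<le> 2 ^ E3" using N0 qp by (intro raise) (auto simp: E3_def)
        then show ?thesis using N0 by (simp add: field_simps)
      qed
      \<comment> \<open>Otherwise \<open>H \<ge> 2 * N\<close>, and the condition with exponent
        \<open>E2\<close> would give \<open>N ^ E2 \<le> N\<close> although
        \<open>N > 1\<close>.\<close>
      have ur: "u \<le> r"
      proof (rule ccontr)
        assume "\<not> u \<le> r"
        then have "2 * N \<le> H" unfolding N_def H_def using power_increasing[of "Suc r" u "2::real"] by simp
        then have "(2 * N) ^ E2 \<le> H ^ E2" using N0 by (intro power_mono) auto
        then have "2 ^ E2 * N ^ E2 \<le> 2 ^ E2 * N" using e2 unfolding power_mult_distrib by linarith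
        then have "N ^ E2 \<le> N" by simp
        moreover have "N ^ 1 < N ^ E2" unfolding N_def using r2 by (intro power_strict_increasing) (auto simp: E2_def)
        ultimately show False by simp
      qed
      define v where "v = r - u"
      define M :: real where "M = 2 ^ v"
      have NHM: "N = H * M" unfolding N_def H_def M_def v_def using ur by (simp flip: power_add)
      have M0: "M > 0" by (simp add: M_def)
      \<comment> \<open>Chosen so that \<open>L powr (- \<sigma>)\<close> is a constant over
        \<open>H\<close>: the off-diagonal total \<open>H * W\<close> then has the same order
        \<open>M\<close> as the diagonal.\<close>
      define L where "L = c * H ^ (D + 2)"
      have L0: "L > 0" unfolding L_def using c H0 by simp
      have L1: "L \<le> M"
      proof -
        have "H * L = c * H ^ E2" by (simp add: L_def E2_def numeral_3_eq_3 numeral_2_eq_2)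
        also have "\<dots> \<le> c * (2 ^ E2 * N)" using e2 c by (intro mult_left_mono) auto
        also have "\<dots> = (c * 2 ^ E2) * N" by simp
        also have "\<dots> \<le> 1 * N" using c23 N0 by (intro mult_right_mono) auto
        also have "\<dots> = H * M" by (simp add: NHM)
        finally show ?thesis using H0 by simp
      qed
      have L2: "2 * L * real (Suc \<kappa>) * real l * H ^ Suc \<kappa> \<le> of_int q"
      proof -
        have "2 * L * real (Suc \<kappa>) * real l * H ^ Suc \<kappa> = 2 * real d * c * (real l * H ^ E1)"
          unfolding L_def E1_def power_add \<kappa>(2) by (simp only: mult_ac)
        also have "\<dots> \<le> 2 * real d * c * (2 ^ E1 * of_int q)" using e1 c by (intro mult_left_mono) auto
        also have "\<dots> = (2 * real d * c * 2 ^ E1) * of_int q" by simp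
        also have "\<dots> \<le> 1 * of_int q" using c1 qp by (intro mult_right_mono) auto
        finally show ?thesis by simp
      qed
      have L3: "2 * of_int q * L \<le> M ^ \<kappa>"
      proof -
        have "2 * of_int q * L * H ^ \<kappa> = 2 * c * (of_int q * H ^ E3)"
          unfolding L_def E3_def power_add by (simp only: mult_ac)
        also have "\<dots> \<le> 2 * c * (2 ^ E3 * N ^ \<kappa>)" using e3 c by (intro mult_left_mono) auto
        also have "\<dots> = (2 * c * 2 ^ E3) * N ^ \<kappa>" by simp
        also have "\<dots> \<le> 1 * N ^ \<kappa>" using c23 N0 by (intro mult_right_mono) auto
        also have "\<dots> = M ^ \<kappa> * H ^ \<kappa>" by (simp add: NHM power_mult_distrib)
        finally show ?thesis using H0 by simp
      qed
      have Ls: "L powr (- \<sigma>) = c powr (- \<sigma>) / H"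
      proof -
        have "(H ^ (D + 2)) powr (- \<sigma>) = H powr (real (D + 2) * (- \<sigma>))"
          by (simp only: powr_realpow[OF H0, symmetric] powr_powr)
        also have "real (D + 2) * (- \<sigma>) = - 1" by (simp add: \<sigma>_def)
        finally show ?thesis unfolding L_def using c H0 by (simp add: powr_mult powr_minus divide_inverse)
      qed
      define W where "W = C * M * L powr (- \<sigma>)"
      have W0: "W \<ge> 0" unfolding W_def using C M0 by simp
      have HW: "H * W = C' * M" unfolding W_def Ls C'_def using H0 by simp
      have "cmod (\<Sum>n\<in>G s (u + v). e (real l * poly f (real n))) ^ 2 \<le> real (u + 1) * real ((u + v) choose s) * (2 ^ v + 2 ^ u * W)"
      proof (rule cauchy_digits[OF _ W0])
        fix k k' :: nat
        assume "k < 2 ^ u" "k' < 2 ^ u" "k \<noteq> k'"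
        then show "cmod (\<Sum>m<2 ^ v. e (real l * poly f (real (k + 2 ^ u * m))) * cnj (e (real l * poly f (real (k' + 2 ^ u * m))))) \<le> W"
          unfolding W_def M_def
          using h \<kappa>(2) L0 L1 L2 L3 by (intro C(2)[of f q a]) (auto simp: M_def H_def coprime_iff_gcd_eq_1)
      qed simp
      moreover have uv: "u + v = r" using ur by (simp add: v_def)
      ultimately have "cmod (S f r l s) ^ 2 \<le> real (u + 1) * b * (M + H * W)"
        unfolding uv b_def M_def H_def S_def by simp
      also have "\<dots> = (real (u + 1) * (1 + C')) * (b * M)" unfolding HW by (simp add: algebra_simps)
      also have "\<dots> \<le> real r ^ 2 * (b * (N * B))"
      proof (intro mult_mono mult_left_mono)
        have C'0: "C' \<ge> 0" unfolding C'_def using C by simp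
        have "real (u + 1) * (1 + C') \<le> (2 * real r) * (1 + C')"
          using ur r2 C'0 by (intro mult_right_mono) auto
        also have "\<dots> = real r * (2 * (1 + C'))" by simp
        also have "\<dots> \<le> real r * real r" using r2 by (intro mult_left_mono) auto
        finally show "real (u + 1) * (1 + C') \<le> real r ^ 2" by (simp add: power2_eq_square)
        show "M \<le> N * B" unfolding NHM using HB B0 M0 by (simp add: field_simps)
      qed (use bN M0 in auto)
      finally show ?thesis by (simp add: mult_ac)
    qed
    also have "\<dots> = (real r * 2 powr (real r / 2) * b powr (1 / 2) * B powr (1 / 2)) ^ 2"
    proof -
      have "(x powr (1 / 2)) ^ 2 = x" if "x \<ge> 0" for x :: real
        using powr_inverse_power[of 2 x] that by simp
      moreover have "(2 powr (real r / 2)) ^ 2 = N"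
      proof -
        have "(2 powr (real r / 2)) ^ 2 = (2::real) powr (real r)" by (simp add: power2_eq_square flip: powr_add)
        then show ?thesis by (simp add: N_def powr_realpow)
      qed
      ultimately show ?thesis using bN B0 by (simp add: power_mult_distrib)
    qed
    finally show ?thesis unfolding b_def by (rule power2_le_imp_le) simp
  qed
  show ?thesis
  proof (intro exI[of _ r0] allI impI)
    fix f :: "real poly" and a q :: int and l s r :: nat
    assume h: "degree f = d" "q \<ge> 1" "gcd a q = 1" "\<bar>coeff f d - of_int a / of_int q\<bar> < 1 / (of_int q) ^ 2"
      "l \<ge> 1" "r \<ge> r0"
    show "cmod (S f r l s) \<le>
      real r * 2 powr (real r / 2) * real (r choose s) powr (1 / 2) *
      (real l powr eta1 d * of_int q powr (- eta1 d)
       + real l powr vartheta d * 2 powr (- zeta1 d * real r)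
       + 2 powr (- zeta2 d * real r)
       + 2 powr (- zeta3 d * real r) * of_int q powr eta2 d) powr (1 / 2)"
      by (rule main[OF h]) auto
  qed
qed

end
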